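(* Let $n\ge 1$ be an integer, let $\alpha>0$ and $1<q\le 1+\frac{\alpha}{n}$ be real numbers, and let $\mathbb S=(0,+\infty)\times\mathbb R^n$. Let $\mathcal L=\sum_{i,j=1}^n\frac{\partial}{\partial x_i}\left[a_{ij}(t,x)\frac{\partial}{\partial x_j}\right]$, where the $a_{ij}$ are measurable and locally bounded in $\mathbb S$, $a_{ij}=a_{ji}$ a.e. in $\mathbb S$, and $0\le\sum_{i,j=1}^n a_{ij}(t,x)\xi_i\xi_j\le A(t,x)|\xi|^2$ for all $\xi\in\mathbb R^n$ and almost all $(t,x)\in\mathbb S$, with $A$ a measurable, non-negative, locally bounded function in $\mathbb S$. Suppose there is a constant $c>0$ such that $$\operatorname*{ess\,sup}_{(t,x)\in(0,+\infty)\times\{R/2<|x|<R\}}A(t,x)\le cR^{2-\alpha}\quad\text{for all }R>1 .$$ Let $u_0,v_0:\mathbb R^n\to\mathbb R$ be arbitrary initial data. Let $u$ be an entire weak solution of the Cauchy problem, with initial data $u(0,\cdot)=u_0$, for the inequality $u_t\ge\mathcal Lu+|u|^{q-1}u$ in $\mathbb S$, and let $v$ be an entire weak solution of the Cauchy problem, with initial data $v(0,\cdot)=v_0$, for the inequality $v_t\le\mathcal Lv+|v|^{q-1}v$ in $\mathbb S$, such that $u\ge v$ (a.e.) in $\mathbb S$. Then $u=v$ (a.e.) in $\mathbb S$.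
   Context: For a bounded domain $\Pi\subset\mathbb S$ and $\hat q=\max\{1,q\}$, $W^{\mathcal L,q}(\Pi)$ denotes the completion of (the functions of finite norm in) $C^\infty(\Pi)$ with respect to the norm $$\|w\|_{W^{\mathcal L,q}(\Pi)}=\int_\Pi|w_t|\,dt\,dx+\left[\int_\Pi\sum_{i,j=1}^n a_{ij}(t,x)\frac{\partial w}{\partial x_i}\frac{\partial w}{\partial x_j}\,dt\,dx\right]^{1/2}+\left[\int_\Pi|w|^{\hat q}\,dt\,dx\right]^{1/\hat q}.$$ A function $w$ belongs to $W^{\mathcal L,q}_{\mathrm{loc}}(\mathbb S)$ if it belongs to $W^{\mathcal L,q}(\Pi)$ for every bounded domain $\Pi\subset\mathbb S$. For elements of the completion, $w_t$ and the expressions $\sum a_{ij}\frac{\partial\varphi}{\partial x_i}\frac{\partial w}{\partial x_j}$, $\sum a_{ij}\frac{\partial w}{\partial x_i}\frac{\partial w}{\partial x_j}$ are understood as limits along approximating sequences of smooth functions. A measurable function $w$ on $\mathbb S$ is an entire weak solution of $w_t\ge\mathcal Lw+|w|^{q-1}w$ (respectively $w_t\le\mathcal Lw+|w|^{q-1}w$) in $\mathbb S$ if $w\in W^{\mathcal L,q}_{\mathrm{loc}}(\mathbb S)$ and, for every non-negative $\varphi\in C^\infty(\mathbb S)$ with compact support in $\mathbb S$, $$\int_{\mathbb S}\Big[w_t\varphi+\sum_{i,j=1}^n a_{ij}\frac{\partial\varphi}{\partial x_i}\frac{\partial w}{\partial x_j}-|w|^{q-1}w\,\varphi\Big]dt\,dx\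 \ge 0\quad(\text{respectively }\le 0).$$ An entire weak solution of the Cauchy problem with initial data $w_0$ is an entire weak solution $w$ in $\mathbb S$ that takes these data at $t=0$, i.e. $w(t,\cdot)\to w_0$ in $L^1_{\mathrm{loc}}(\mathbb R^n)$ as $t\to0^+$. No other condition is imposed on the initial data, and none on the behaviour of solutions at infinity. *)

theory Defs
  imports "HOL-Analysis.Analysis" "HOL-Probability.Essential_Supremum"
begin

text \<open>Points of space-time are pairs \<open>(t, x)\<close> of type \<open>real \<times> (real ^ 'n)\<close>; the spatial
  dimension is \<open>CARD('n)\<close>.\<close>

definition half_space :: "(real \<times> (real ^ 'n)) set" where
  "half_space = {0<..} \<times> UNIV"

definition bounded_domain :: "(real \<times> (real ^ 'n)) set \<Rightarrow> bool" where
  "bounded_domain \<Omega> \<longleftrightarrow>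
     open \<Omega> \<and> connected \<Omega> \<and> \<Omega> \<noteq> {} \<and> bounded \<Omega> \<and> \<Omega> \<subseteq> half_space"

fun Ck_on :: "nat \<Rightarrow> 'a::real_normed_vector set \<Rightarrow> ('a \<Rightarrow> real) \<Rightarrow> bool" where
  "Ck_on 0 S f \<longleftrightarrow> continuous_on S f"
| "Ck_on (Suc k) S f \<longleftrightarrow>
     (\<forall>x\<in>S. f differentiable (at x)) \<and>
     (\<forall>h. Ck_on k S (\<lambda>x. frechet_derivative f (at x) h))"

text \<open>Only used for open sets \<open>S\<close>.\<close>

definition smooth_on :: "'a::real_normed_vector set \<Rightarrow> ('a \<Rightarrow> real) \<Rightarrow> bool" where
  "smooth_on S f \<longleftrightarrow> (\<forall>k. Ck_on k S f)"

definition time_deriv :: "(real \<times> (real ^ 'n) \<Rightarrow> real) \<Rightarrow> real \<times> (real ^ 'n) \<Rightarrow> real" where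
  "time_deriv w z = frechet_derivative w (at z) (1, 0)"

definition space_grad :: "(real \<times> (real ^ 'n) \<Rightarrow> real) \<Rightarrow> real \<times> (real ^ 'n) \<Rightarrow> real ^ 'n" where
  "space_grad w z = (\<chi> i. frechet_derivative w (at z) (0, axis i 1))"

text \<open>Locally bounded, up to null sets.\<close>

definition locally_bounded_on ::
    "(real \<times> (real ^ 'n)) set \<Rightarrow> (real \<times> (real ^ 'n) \<Rightarrow> real) \<Rightarrow> bool" where
  "locally_bounded_on S f \<longleftrightarrow>
     (\<forall>K. compact K \<and> K \<subseteq> S \<longrightarrow> (\<exists>M. AE z in lebesgue_on K. \<bar>f z\<bar> \<le> M))"

definition coeff_form ::
    "('n::finite \<Rightarrow> 'n \<Rightarrow> real \<times> (real ^ 'n) \<Rightarrow> real) \<Rightarrow> real \<times> (real ^ 'n) \<Rightarrow>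
       real ^ 'n \<Rightarrow> real ^ 'n \<Rightarrow> real" where
  "coeff_form a z \<xi> \<eta> = (\<Sum>i\<in>UNIV. \<Sum>j\<in>UNIV. a i j z * \<xi> $ i * \<eta> $ j)"

definition hat :: "real \<Rightarrow> real" where
  "hat q = max 1 q"

text \<open>The norm, as a function of the three components \<open>w\<close>, \<open>w\<^sub>t\<close> and \<open>\<nabla>\<^sub>x w\<close>; it is meaningful
  only when all three integrals are finite.\<close>

definition W_finite ::
    "('n::finite \<Rightarrow> 'n \<Rightarrow> real \<times> (real ^ 'n) \<Rightarrow> real) \<Rightarrow> real \<Rightarrow> (real \<times> (real ^ 'n)) set \<Rightarrow>
       (real \<times> (real ^ 'n) \<Rightarrow> real) \<Rightarrow> (real \<times> (real ^ 'n) \<Rightarrow> real) \<Rightarrow>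
       (real \<times> (real ^ 'n) \<Rightarrow> real ^ 'n) \<Rightarrow> bool" where
  "W_finite a q \<Omega> w p g \<longleftrightarrow>
     set_integrable lebesgue \<Omega> (\<lambda>z. \<bar>p z\<bar>) \<and>
     set_integrable lebesgue \<Omega> (\<lambda>z. coeff_form a z (g z) (g z)) \<and>
     set_integrable lebesgue \<Omega> (\<lambda>z. \<bar>w z\<bar> powr hat q)"

definition W_norm ::
    "('n::finite \<Rightarrow> 'n \<Rightarrow> real \<times> (real ^ 'n) \<Rightarrow> real) \<Rightarrow> real \<Rightarrow> (real \<times> (real ^ 'n)) set \<Rightarrow>
       (real \<times> (real ^ 'n) \<Rightarrow> real) \<Rightarrow> (real \<times> (real ^ 'n) \<Rightarrow> real) \<Rightarrow>
       (real \<times> (real ^ 'n) \<Rightarrow> real ^ 'n) \<Rightarrow> real" where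
  "W_norm a q \<Omega> w p g =
     (LINT z:\<Omega>|lebesgue. \<bar>p z\<bar>) +
     sqrt (LINT z:\<Omega>|lebesgue. coeff_form a z (g z) (g z)) +
     (LINT z:\<Omega>|lebesgue. \<bar>w z\<bar> powr hat q) powr (1 / hat q)"

text \<open>The completion, realised as the closure of the triples \<open>(w, w\<^sub>t, \<nabla>\<^sub>x w)\<close>, with \<open>w\<close> smooth and
  of finite norm, in the complete seminormed space of all measurable triples \<open>(w, p, g)\<close> of finite
  norm. As the coefficient form may degenerate, the function \<open>w\<close> alone need not determine an
  element of the completion, so the limits \<open>p\<close> of the time derivatives (in \<open>L\<^sup>1\<close>) and \<open>g\<close> of the
  spatial gradients (in the energy seminorm) along an approximating sequence are kept as part of
  the element; \<open>g\<close> matters only modulo the kernel of the form.\<close>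

definition W_space ::
    "('n::finite \<Rightarrow> 'n \<Rightarrow> real \<times> (real ^ 'n) \<Rightarrow> real) \<Rightarrow> real \<Rightarrow> (real \<times> (real ^ 'n)) set \<Rightarrow>
       ((real \<times> (real ^ 'n) \<Rightarrow> real) \<times> (real \<times> (real ^ 'n) \<Rightarrow> real) \<times>
        (real \<times> (real ^ 'n) \<Rightarrow> real ^ 'n)) set" where
  "W_space a q \<Omega> = {(w, p, g).
     w \<in> borel_measurable (lebesgue_on \<Omega>) \<and>
     p \<in> borel_measurable (lebesgue_on \<Omega>) \<and>
     g \<in> borel_measurable (lebesgue_on \<Omega>) \<and>
     W_finite a q \<Omega> w p g \<and>
     (\<exists>ws :: nat \<Rightarrow> real \<times> (real ^ 'n) \<Rightarrow> real.
        (\<forall>k. smooth_on \<Omega> (ws k) \<and>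
             W_finite a q \<Omega> (ws k) (time_deriv (ws k)) (space_grad (ws k))) \<and>
        (\<lambda>k. W_norm a q \<Omega> (\<lambda>z. ws k z - w z) (\<lambda>z. time_deriv (ws k) z - p z)
                        (\<lambda>z. space_grad (ws k) z - g z)) \<longlonglongrightarrow> 0)}"

definition W_loc ::
    "('n::finite \<Rightarrow> 'n \<Rightarrow> real \<times> (real ^ 'n) \<Rightarrow> real) \<Rightarrow> real \<Rightarrow>
       ((real \<times> (real ^ 'n) \<Rightarrow> real) \<times> (real \<times> (real ^ 'n) \<Rightarrow> real) \<times>
        (real \<times> (real ^ 'n) \<Rightarrow> real ^ 'n)) set" where
  "W_loc a q = {(w, p, g). \<forall>\<Omega>. bounded_domain \<Omega> \<longrightarrow> (w, p, g) \<in> W_space a q \<Omega>}"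

definition test_function :: "(real \<times> (real ^ 'n) \<Rightarrow> real) \<Rightarrow> bool" where
  "test_function \<phi> \<longleftrightarrow>
     smooth_on half_space \<phi> \<and>
     compact (closure {z \<in> half_space. \<phi> z \<noteq> 0}) \<and>
     closure {z \<in> half_space. \<phi> z \<noteq> 0} \<subseteq> half_space \<and>
     (\<forall>z\<in>half_space. 0 \<le> \<phi> z)"

definition weak_form ::
    "('n::finite \<Rightarrow> 'n \<Rightarrow> real \<times> (real ^ 'n) \<Rightarrow> real) \<Rightarrow> real \<Rightarrow>
       (real \<times> (real ^ 'n) \<Rightarrow> real) \<Rightarrow> (real \<times> (real ^ 'n) \<Rightarrow> real) \<Rightarrow>
       (real \<times> (real ^ 'n) \<Rightarrow> real ^ 'n) \<Rightarrow> (real \<times> (real ^ 'n) \<Rightarrow> real) \<Rightarrow> real" where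
  "weak_form a q w p g \<phi> =
     (LINT z:half_space|lebesgue.
        p z * \<phi> z + coeff_form a z (space_grad \<phi> z) (g z)
          - \<bar>w z\<bar> powr (q - 1) * w z * \<phi> z)"

text \<open>Entire weak solutions of \<open>w\<^sub>t \<ge> \<L> w + |w|\<^bsup>q-1\<^esup> w\<close> and \<open>w\<^sub>t \<le> \<L> w + |w|\<^bsup>q-1\<^esup> w\<close>.\<close>

definition weak_supersolution ::
    "('n::finite \<Rightarrow> 'n \<Rightarrow> real \<times> (real ^ 'n) \<Rightarrow> real) \<Rightarrow> real \<Rightarrow>
       (real \<times> (real ^ 'n) \<Rightarrow> real) \<Rightarrow> bool" where
  "weak_supersolution a q w \<longleftrightarrow>
     w \<in> borel_measurable (lebesgue_on half_space) \<and>
     (\<exists>p g. (w, p, g) \<in> W_loc a q \<and> (\<forall>\<phi>. test_function \<phi> \<longrightarrow> 0 \<le> weak_form a q w p g \<phi>))"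

definition weak_subsolution ::
    "('n::finite \<Rightarrow> 'n \<Rightarrow> real \<times> (real ^ 'n) \<Rightarrow> real) \<Rightarrow> real \<Rightarrow>
       (real \<times> (real ^ 'n) \<Rightarrow> real) \<Rightarrow> bool" where
  "weak_subsolution a q w \<longleftrightarrow>
     w \<in> borel_measurable (lebesgue_on half_space) \<and>
     (\<exists>p g. (w, p, g) \<in> W_loc a q \<and> (\<forall>\<phi>. test_function \<phi> \<longrightarrow> weak_form a q w p g \<phi> \<le> 0))"

text \<open>\<open>w(t, \<cdot>) \<rightarrow> w\<^sub>0\<close> in \<open>L\<^sup>1\<^sub>l\<^sub>o\<^sub>c\<close> as \<open>t \<rightarrow> 0+\<close>. Since \<open>w\<close> is given only up to null sets, null sets of
  times are disregarded.\<close>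

definition initial_data ::
    "(real \<times> (real ^ 'n) \<Rightarrow> real) \<Rightarrow> (real ^ 'n \<Rightarrow> real) \<Rightarrow> bool" where
  "initial_data w w\<^sub>0 \<longleftrightarrow>
     (\<forall>K. compact K \<longrightarrow> (\<forall>\<epsilon>>0. \<exists>\<delta>>0. AE t in lebesgue_on {0<..<\<delta>}.
        set_integrable lebesgue K (\<lambda>x. w (t, x) - w\<^sub>0 x) \<and>
        (LINT x:K|lebesgue. \<bar>w (t, x) - w\<^sub>0 x\<bar>) < \<epsilon>))"

end

theory Submission
  imports Defs
begin

text \<open>The difference
  \<open>w = u - v \<ge> 0\<close> satisfies \<open>w\<^sub>t \<ge> \<L> w + 2\<^bsup>-q\<^esup> w\<^sup>q\<close>. Fix \<open>R > 1\<close>, put \<open>\<delta> = \<kappa> R\<^bsup>-\<alpha>/(q-1)\<^esup>\<close> and test with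
  \<open>h (w / \<delta>) \<eta>\<^sup>s\<close>, where \<open>\<eta>\<close> is a cutoff at scale \<open>R\<close> in space and \<open>R\<^sup>\<alpha>\<close> in time, and
  \<open>h\<close> takes values in \<open>[1, 2]\<close> with \<open>- h' y \<ge> const (1 + y)\<^bsup>-\<nu>-1\<^esup>\<close>. Because \<open>h \<ge> 1\<close> the full
  term \<open>w\<^sup>q \<eta>\<^sup>s\<close> survives on the left; near \<open>t = 0\<close>, where \<open>\<eta>\<close> increases in time, the term
  with \<open>\<eta>\<^sub>t\<close> has the favourable sign, while \<open>h' \<le> 0\<close> supplies the energy that absorbs the cross term
  \<open>a(\<nabla>\<eta>, \<nabla>w)\<close>. What remains is controlled by \<open>R\<^bsup>-\<alpha>\<^esup> \<delta> (1 + w / \<delta>)\<^bsup>1+\<nu>\<^esup> \<eta>\<^bsup>s-2\<^esup>\<close>, integrated over the region \<open>E\<close> where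
  \<open>\<eta>\<close> decreases. Splitting at \<open>(1 + w / \<delta>) \<eta>\<^sup>\<beta> = K\<close> and using \<open>n \<le> \<alpha> / (q - 1)\<close> yields, with \<open>\<mu> = q - 1 - \<nu> > 0\<close>,
  \<open>\<integral> w\<^sup>q \<eta>\<^sup>s \<le> C (K\<^sup>2 \<kappa> + \<kappa>\<^bsup>1-q\<^esup> K\<^bsup>-\<mu>\<^esup> \<integral>\<^sub>E w\<^sup>q \<eta>\<^sup>s)\<close>.
  Taking \<open>\<kappa> = 1\<close> and \<open>K\<close> large shows \<open>w\<^sup>q\<close> to be integrable; then the last integral is a tail, and
  \<open>R \<rightarrow> \<infinity>\<close> followed by \<open>\<kappa> \<rightarrow> 0\<close> gives \<open>w = 0\<close>.\<close>

section \<open>Functions of class C^k\<close>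

text \<open>At the endpoint q = 1 + \<alpha> / n all powers of R cancel: R powr -\<alpha> times
  \<delta> powr (1 - q) is \<kappa> powr (1 - q), and R powr -\<alpha> times \<delta> times a volume
  of order R powr (\<alpha> + n) is of order \<kappa>. Nothing decays in R by itself, so smallness
  must come from \<kappa> and from the tail; as \<kappa> powr (1 - q) blows up, R has to grow before
  \<kappa> shrinks. A negative power of w as multiplier would weaken the source term and be singular
  at w = 0; h decreases but stays above 1, and the shift in 1 + w / \<delta> removes the
  singularity. The price is the weight \<delta> (1 + w / \<delta>) powr (1 + \<nu>), up to a
  constant the reciprocal of the decay rate of the multiplier; since 1 + \<nu> < q, the source term
  can dominate it. The multiplier is not itself an admissible test function, w being only a limit of
  smooth functions. So h is composed with approximants of u - v on a bounded domain, and the limit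
  is taken afterwards. Approximants may be negative, hence h is smooth, and bounded together with
  its derivative, on the whole line.\<close>

lemma frechet_derivative_cong_open:
  assumes "open S" "x \<in> S" "\<And>y. y \<in> S \<Longrightarrow> f y = g y"
  shows "frechet_derivative f (at x) = frechet_derivative g (at x)"
proof -
  have "(f has_derivative D) (at x) \<longleftrightarrow> (g has_derivative D) (at x)" for D
    using assms has_derivative_transform_within_open by metis
  then show ?thesis
    by (simp add: frechet_derivative_def)
qed

lemma differentiable_cong_open:
  assumes "open S" "x \<in> S" "\<And>y. y \<in> S \<Longrightarrow> f y = g y"
  shows "f differentiable (at x) \<longleftrightarrow> g differentiable (at x)"
  unfolding differentiable_def using assms has_derivative_transform_within_open by metis

lemma Ck_on_cong:
  assumes "open S" "\<And>y. y \<in> S \<Longrightarrow> f y = g y"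
  shows "Ck_on k S f \<longleftrightarrow> Ck_on k S g"
  using assms(2)
proof (induction k arbitrary: f g)
  case 0
  then show ?case by (auto cong: continuous_on_cong)
next
  case (Suc k)
  have "Ck_on k S (\<lambda>x. frechet_derivative f (at x) h) \<longleftrightarrow> Ck_on k S (\<lambda>x. frechet_derivative g (at x) h)" for h
    by (rule Suc.IH) (metis assms(1) Suc.prems frechet_derivative_cong_open)
  moreover have "f differentiable (at x) \<longleftrightarrow> g differentiable (at x)" if "x \<in> S" for x
    using differentiable_cong_open[OF assms(1) that] Suc.prems by blast
  ultimately show ?case by simp
qed

text \<open>Derivatives are unique, so any derivative \<open>D\<close> found by the usual rules may
  replace the \<open>frechet_derivative\<close> of the recursive definition; openness of
  \<open>S\<close> turns equality on \<open>S\<close> into equality of all higher derivatives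
  there.\<close>

lemma Ck_on_SucI:
  assumes "open S" "\<And>x. x \<in> S \<Longrightarrow> (f has_derivative D x) (at x)"
    and "\<And>h. Ck_on k S (\<lambda>x. D x h)"
  shows "Ck_on (Suc k) S f"
proof -
  have eq: "frechet_derivative f (at x) = D x" if "x \<in> S" for x
    using assms(2)[OF that] by (simp add: frechet_derivative_at[symmetric])
  have "Ck_on k S (\<lambda>x. frechet_derivative f (at x) h)" for h
    using assms(3)[of h] Ck_on_cong[OF assms(1), of "\<lambda>x. frechet_derivative f (at x) h" "\<lambda>x. D x h"] eq
    by simp
  then show ?thesis using assms(2) by (auto simp: differentiable_def)
qed

lemma Ck_on_SucD:
  assumes "Ck_on (Suc k) S f"
  shows "x \<in> S \<Longrightarrow> (f has_derivative frechet_derivative f (at x)) (at x)"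
    and "Ck_on k S (\<lambda>x. frechet_derivative f (at x) h)"
  using assms by (auto simp: frechet_derivative_works)

lemma Ck_on_Suc_imp: "Ck_on (Suc k) S f \<Longrightarrow> Ck_on k S f"
proof (induction k arbitrary: f)
  case 0
  then show ?case
    by (auto intro!: continuous_at_imp_continuous_on differentiable_imp_continuous_within)
next
  case (Suc k)
  then show ?case by (metis Ck_on.simps(2))
qed

lemma Ck_on_continuous: "Ck_on k S f \<Longrightarrow> continuous_on S f"
  by (induction k) (use Ck_on_Suc_imp in auto)

lemma Ck_on_subset: "Ck_on k S f \<Longrightarrow> T \<subseteq> S \<Longrightarrow> Ck_on k T f"
  by (induction k arbitrary: f) (auto intro: continuous_on_subset)

lemma Ck_on_Un:
  assumes "open S" "open T"
  shows "Ck_on k S f \<Longrightarrow> Ck_on k T f \<Longrightarrow> Ck_on k (S \<union> T) f"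
  by (induction k arbitrary: f) (auto intro: continuous_on_open_Un[OF assms])

lemma Ck_on_const [simp]: "Ck_on k S (\<lambda>x. c)"
  by (induction k arbitrary: c) (auto simp: frechet_derivative_const)

lemma Ck_on_linear:
  assumes "bounded_linear f"
  shows "Ck_on k S f"
proof (cases k)
  case 0
  then show ?thesis using assms by (simp add: linear_continuous_on)
next
  case (Suc k')
  have "frechet_derivative f (at x) = f" for x
    using assms by (metis bounded_linear_imp_has_derivative frechet_derivative_at)
  moreover have "f differentiable (at x)" for x
    using assms by (metis bounded_linear_imp_differentiable)
  ultimately show ?thesis using Suc by simp
qed

lemma Ck_on_add:
  assumes "open S"
  shows "Ck_on k S f \<Longrightarrow> Ck_on k S g \<Longrightarrow> Ck_on k S (\<lambda>x. f x + g x)"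
proof (induction k arbitrary: f g)
  case 0
  then show ?case by (auto intro: continuous_intros)
next
  case (Suc k)
  show ?case
    by (rule Ck_on_SucI[OF assms has_derivative_add])
       (auto intro: Ck_on_SucD[OF Suc.prems(1)] Ck_on_SucD[OF Suc.prems(2)] Suc.IH)
qed

lemma Ck_on_mult:
  assumes "open S"
  shows "Ck_on k S f \<Longrightarrow> Ck_on k S g \<Longrightarrow> Ck_on k S (\<lambda>x. f x * g x)"
proof (induction k arbitrary: f g)
  case 0
  then show ?case by (auto intro: continuous_intros)
next
  case (Suc k)
  show ?case
    by (rule Ck_on_SucI[OF assms has_derivative_mult])
       (auto intro!: Ck_on_SucD[OF Suc.prems(1)] Ck_on_SucD[OF Suc.prems(2)] Suc.IH Ck_on_add[OF assms] Ck_on_Suc_imp[OF Suc.prems(1)] Ck_on_Suc_imp[OF Suc.prems(2)])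
qed

text \<open>The induction keeps \<open>f\<close> fixed and generalises \<open>\<psi>\<close>: the
  chain rule gives the derivative of \<open>f\<close> times \<open>?D\<close>, and \<open>?D\<close>
  is again a composition with \<open>f\<close>, now of a derivative of
  \<open>\<psi>\<close>.\<close>

lemma Ck_on_compose:
  fixes \<psi> :: "real \<Rightarrow> real"
  assumes "open S" "open T" "\<And>x. x \<in> S \<Longrightarrow> f x \<in> T"
  shows "Ck_on k S f \<Longrightarrow> Ck_on k T \<psi> \<Longrightarrow> Ck_on k S (\<lambda>x. \<psi> (f x))"
proof (induction k arbitrary: \<psi>)
  case 0
  then show ?case using assms(3) by (auto intro: continuous_on_compose2)
next
  case (Suc k)
  let ?D = "\<lambda>x. frechet_derivative \<psi> (at (f x)) 1"
  show ?case
  proof (rule Ck_on_SucI[OF assms(1)])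
    fix x assume "x \<in> S"
    have 1: "(f has_derivative frechet_derivative f (at x)) (at x)"
      using Suc.prems(1) \<open>x \<in> S\<close> by (rule Ck_on_SucD)
    have 2: "(\<psi> has_derivative frechet_derivative \<psi> (at (f x))) (at (f x))"
      using Suc.prems(2) assms(3)[OF \<open>x \<in> S\<close>] by (rule Ck_on_SucD)
    \<comment> \<open>A linear map of the real line is multiplication by its value at 1.\<close>
    have "frechet_derivative \<psi> (at (f x)) h = h * ?D x" for h
      using linear_scale[OF bounded_linear.linear[OF has_derivative_bounded_linear[OF 2]], of h 1]
      by (simp only: real_scaleR_def mult_1_right)
    then have "(\<lambda>h. frechet_derivative \<psi> (at (f x)) (frechet_derivative f (at x) h)) =
        (\<lambda>h. frechet_derivative f (at x) h * ?D x)"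
      by blast
    from has_derivative_compose[OF 1 2, unfolded this]
    show "((\<lambda>x. \<psi> (f x)) has_derivative (\<lambda>h. frechet_derivative f (at x) h * ?D x)) (at x)" .
  next
    fix h
    have "Ck_on k S ?D"
      using Suc.IH Ck_on_SucD(2)[OF Suc.prems(2)] Ck_on_Suc_imp[OF Suc.prems(1)] by blast
    then show "Ck_on k S (\<lambda>x. frechet_derivative f (at x) h * ?D x)"
      using Ck_on_SucD(2)[OF Suc.prems(1)] Ck_on_mult[OF assms(1)] by blast
  qed
qed

section \<open>Closure properties and basic examples of smooth functions\<close>

lemma smooth_on_const [simp]: "smooth_on S (\<lambda>x. c)"
  and smooth_on_linear: "bounded_linear f \<Longrightarrow> smooth_on S f"
  and smooth_on_subset: "smooth_on S f \<Longrightarrow> T \<subseteq> S \<Longrightarrow> smooth_on T f"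
  and smooth_on_continuous: "smooth_on S f \<Longrightarrow> continuous_on S f"
  by (auto simp: smooth_on_def Ck_on_linear intro: Ck_on_subset Ck_on_continuous)

lemma smooth_on_add: "open S \<Longrightarrow> smooth_on S f \<Longrightarrow> smooth_on S g \<Longrightarrow> smooth_on S (\<lambda>x. f x + g x)"
  and smooth_on_mult: "open S \<Longrightarrow> smooth_on S f \<Longrightarrow> smooth_on S g \<Longrightarrow> smooth_on S (\<lambda>x. f x * g x)"
  and smooth_on_Un: "open S \<Longrightarrow> open T \<Longrightarrow> smooth_on S f \<Longrightarrow> smooth_on T f \<Longrightarrow> smooth_on (S \<union> T) f"
  by (auto simp: smooth_on_def intro: Ck_on_add Ck_on_mult Ck_on_Un)

lemma smooth_on_cong: "open S \<Longrightarrow> (\<And>y. y \<in> S \<Longrightarrow> f y = g y) \<Longrightarrow> smooth_on S f \<longleftrightarrow> smooth_on S g"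
  unfolding smooth_on_def using Ck_on_cong by blast

lemma smooth_on_diff:
  assumes "open S" "smooth_on S f" "smooth_on S g"
  shows "smooth_on S (\<lambda>x. f x - g x)"
  using smooth_on_add[OF assms(1,2) smooth_on_mult[OF assms(1) smooth_on_const[of S "-1"] assms(3)]]
  by simp

lemma smooth_on_power: "open S \<Longrightarrow> smooth_on S f \<Longrightarrow> smooth_on S (\<lambda>x. f x ^ m)"
  by (induction m) (auto intro: smooth_on_mult)

lemma smooth_on_compose:
  fixes \<psi> :: "real \<Rightarrow> real"
  assumes "open S" "open T" "\<And>x. x \<in> S \<Longrightarrow> f x \<in> T" "smooth_on S f" "smooth_on T \<psi>"
  shows "smooth_on S (\<lambda>x. \<psi> (f x))"
  using assms Ck_on_compose unfolding smooth_on_def by blast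

lemma smooth_on_has_derivative:
  "smooth_on S f \<Longrightarrow> x \<in> S \<Longrightarrow> (f has_derivative frechet_derivative f (at x)) (at x)"
  and smooth_on_frechet_derivative:
  "smooth_on S f \<Longrightarrow> smooth_on S (\<lambda>x. frechet_derivative f (at x) h)"
  unfolding smooth_on_def using Ck_on_SucD by blast+

text \<open>The exponent is left free in the induction, since differentiation only lowers it by 1 up
  to a constant factor.\<close>

lemma smooth_on_powr: "smooth_on {0<..} (\<lambda>x::real. x powr r)"
proof -
  have "Ck_on k {0<..} (\<lambda>x::real. x powr r)" for k
  proof (induction k arbitrary: r)
    case 0
    show ?case by (auto intro!: continuous_intros)
  next
    case (Suc k)
    show ?case
    proof (rule Ck_on_SucI)
      fix x :: real assume "x \<in> {0<..}"
      then have "((\<lambda>x. x powr r) has_real_derivative r * x powr (r - 1)) (at x)"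
        by (auto intro: has_real_derivative_powr)
      then show "((\<lambda>x. x powr r) has_derivative (\<lambda>h. r * x powr (r - 1) * h)) (at x)"
        by (simp add: has_field_derivative_def)
    next
      fix h
      show "Ck_on k {0<..} (\<lambda>x. r * x powr (r - 1) * h)"
        by (intro Ck_on_mult Suc Ck_on_const) auto
    qed simp
  qed
  then show ?thesis by (simp add: smooth_on_def)
qed

text \<open>The classical flat function exp(-1/t), times a power of 1/t. The power makes the family
  closed under differentiation up to linear combinations, so one induction shows all members to be
  smooth.\<close>

definition flat_exp :: "nat \<Rightarrow> real \<Rightarrow> real" where
  "flat_exp m t = (if 0 < t then (1 / t) ^ m * exp (- (1 / t)) else 0)"

lemma flat_exp_tendsto: "(flat_exp m \<longlongrightarrow> 0) (at 0)"
proof -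
  have "((\<lambda>t::real. (1 / t) ^ m * exp (- (1 / t))) \<longlongrightarrow> 0) (at_right 0)"
  proof -
    have "((\<lambda>x::real. x ^ m / exp x) \<longlongrightarrow> 0) at_top"
      by (rule tendsto_power_div_exp_0)
    then have "((\<lambda>t::real. (inverse t) ^ m / exp (inverse t)) \<longlongrightarrow> 0) (at_right 0)"
      by (rule filterlim_compose) (rule filterlim_inverse_at_top_right)
    then show ?thesis by (simp add: field_simps exp_minus)
  qed
  then have "(flat_exp m \<longlongrightarrow> 0) (at_right 0)"
    by (rule Lim_transform_eventually)
       (auto simp: flat_exp_def eventually_at_filter)
  moreover have "(flat_exp m \<longlongrightarrow> 0) (at_left 0)"
    by (rule Lim_transform_eventually[OF tendsto_const])
       (auto simp: flat_exp_def eventually_at_filter)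
  ultimately show ?thesis by (simp add: filterlim_at_split)
qed

lemma flat_exp_deriv:
  "(flat_exp m has_real_derivative flat_exp (m + 2) t - of_nat m * flat_exp (m + 1) t) (at t)"
proof (cases t "0::real" rule: linorder_cases)
  case less
  have "((\<lambda>t. 0) has_real_derivative 0) (at t)" by simp
  then have "(flat_exp m has_real_derivative 0) (at t)"
    by (rule has_field_derivative_transform_within_open[where S = "{..<0}"]) (use less in \<open>auto simp: flat_exp_def\<close>)
  then show ?thesis using less by (simp add: flat_exp_def)
next
  case equal
  \<comment> \<open>At 0 the difference quotient of \<open>flat_exp m\<close> is
    \<open>flat_exp (m + 1)\<close>.\<close>
  have "(\<lambda>h. (flat_exp m (0 + h) - flat_exp m 0) / h) \<midarrow>0\<rightarrow> 0"
    by (rule Lim_transform_eventually[OF flat_exp_tendsto[of "m + 1"]])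
       (auto simp: flat_exp_def eventually_at_filter)
  then show ?thesis using equal by (simp add: DERIV_def flat_exp_def)
next
  case greater
  have "((\<lambda>t. (1 / t) ^ m * exp (- (1 / t))) has_real_derivative
      flat_exp (m + 2) t - of_nat m * flat_exp (m + 1) t) (at t)"
  proof (cases m)
    case 0
    then show ?thesis using greater
      by (auto intro!: derivative_eq_intros simp: flat_exp_def power2_eq_square divide_simps)
  next
    case (Suc k)
    then show ?thesis using greater
      by (auto intro!: derivative_eq_intros simp: flat_exp_def power2_eq_square power_divide divide_simps)
         (cases k; simp add: algebra_simps)
  qed
  then show ?thesis
    by (rule has_field_derivative_transform_within_open[where S = "{0<..}"]) (use greater in \<open>auto simp: flat_exp_def\<close>)
qed

lemma smooth_on_flat_exp: "smooth_on UNIV (flat_exp m)"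
proof -
  have "Ck_on k UNIV (flat_exp m)" for k
  proof (induction k arbitrary: m)
    case 0
    show ?case
      using DERIV_isCont[OF flat_exp_deriv] by (auto intro!: continuous_at_imp_continuous_on)
  next
    case (Suc k)
    show ?case
    proof (rule Ck_on_SucI)
      fix x :: real
      show "(flat_exp m has_derivative (\<lambda>h. (flat_exp (m + 2) x + (- of_nat m) * flat_exp (m + 1) x) * h)) (at x)"
        using flat_exp_deriv[of m x] by (simp add: has_field_derivative_def)
    next
      fix h
      show "Ck_on k UNIV (\<lambda>x. (flat_exp (m + 2) x + (- of_nat m) * flat_exp (m + 1) x) * h)"
        by (intro Ck_on_mult Ck_on_add Suc Ck_on_const) auto
    qed simp
  qed
  then show ?thesis by (simp add: smooth_on_def)
qed

section \<open>Cutoff functions and the multiplier\<close>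

lemma smooth_step_exists:
  obtains \<sigma> \<sigma>' :: "real \<Rightarrow> real" and B :: real
  where "smooth_on UNIV \<sigma>" "\<And>y. (\<sigma> has_real_derivative \<sigma>' y) (at y)"
    "\<And>y. 0 \<le> \<sigma> y" "\<And>y. \<sigma> y \<le> 1" "\<And>y. y \<le> 0 \<Longrightarrow> \<sigma> y = 1" "\<And>y. 1 \<le> y \<Longrightarrow> \<sigma> y = 0"
    "\<And>y. \<sigma>' y \<le> 0" "\<And>y. - B \<le> \<sigma>' y" "\<And>y. y \<le> 0 \<or> 1 \<le> y \<Longrightarrow> \<sigma>' y = 0"
proof -
  define f where "f = flat_exp 0"
  define f' where "f' = flat_exp 2"
  \<comment> \<open>\<open>f\<close> vanishes on the left half-line and \<open>f 1 = 1 / e\<close>, so composing it with itself gives both plateaus.\<close>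
  define \<sigma> where "\<sigma> y = exp 1 * f (1 - exp 1 * f y)" for y
  define \<sigma>' where "\<sigma>' y = - (exp 1 * f' (1 - exp 1 * f y) * (exp 1 * f' y))" for y
  have f: "(f has_real_derivative f' y) (at y)" for y
    using flat_exp_deriv[of 0 y] by (simp add: f_def f'_def numeral_2_eq_2)
  have smf: "smooth_on UNIV f" "smooth_on UNIV f'"
    unfolding f_def f'_def by (rule smooth_on_flat_exp)+
  have f0: "f y = 0" "f' y = 0" if "y \<le> 0" for y
    using that by (auto simp: f_def f'_def flat_exp_def)
  have fpos: "0 \<le> f y" "0 \<le> f' y" for y
    by (auto simp: f_def f'_def flat_exp_def)
  have f1: "exp 1 * f y \<le> 1" if "y \<le> 1" for y
    using that by (auto simp: f_def flat_exp_def exp_add[symmetric] divide_simps)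
  have f2: "exp 1 * f y \<ge> 1" if "y \<ge> 1" for y
    using that by (auto simp: f_def flat_exp_def exp_add[symmetric] divide_simps)
  have der: "(\<sigma> has_real_derivative \<sigma>' y) (at y)" for y
    unfolding \<sigma>_def \<sigma>'_def
    by (auto intro!: derivative_eq_intros DERIV_chain2[OF f] f)
  have "smooth_on UNIV (\<lambda>y. 1 - exp 1 * f y)"
    by (intro smooth_on_mult smooth_on_diff smf smooth_on_const) auto
  then have "smooth_on UNIV (\<lambda>y. f (1 - exp 1 * f y))"
    using smf(1) by (rule smooth_on_compose[rotated 3]) auto
  then have sm: "smooth_on UNIV \<sigma>"
    unfolding \<sigma>_def by (intro smooth_on_mult smooth_on_const) auto
  have zero: "\<sigma>' y = 0" if "y \<le> 0 \<or> 1 \<le> y" for y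
    using that f0 f2[of y] by (auto simp: \<sigma>'_def)
  have cont: "continuous_on UNIV f" "continuous_on UNIV f'"
    using smf by (auto intro: smooth_on_continuous)
  have "continuous_on UNIV (\<lambda>y. 1 - exp 1 * f y)"
    by (intro continuous_on_diff continuous_on_mult continuous_on_const cont)
  then have "continuous_on UNIV (\<lambda>y. f' (1 - exp 1 * f y))"
    by (rule continuous_on_compose2[OF cont(2)]) simp
  then have "continuous_on UNIV \<sigma>'"
    unfolding \<sigma>'_def by (intro continuous_on_minus continuous_on_mult continuous_on_const cont)
  then have "continuous_on {0..1} \<sigma>'"
    by (rule continuous_on_subset) simp
  then have "bounded (\<sigma>' ` {0..1})"
    by (intro compact_imp_bounded compact_continuous_image) auto
  then obtain B where B: "\<And>y. y \<in> {0..1} \<Longrightarrow> \<bar>\<sigma>' y\<bar> \<le> B"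
    unfolding bounded_iff by (metis image_eqI real_norm_def)
  have "- B \<le> \<sigma>' y" for y
    using B[of y] B[of 0] zero[of y] by (cases "y \<in> {0..1}") force+
  moreover have "\<sigma>' y \<le> 0" for y
    by (simp add: \<sigma>'_def fpos)
  moreover have "0 \<le> \<sigma> y" "\<sigma> y \<le> 1" "y \<le> 0 \<Longrightarrow> \<sigma> y = 1" "1 \<le> y \<Longrightarrow> \<sigma> y = 0" for y
  proof -
    show "0 \<le> \<sigma> y" by (simp add: \<sigma>_def fpos)
    show "\<sigma> y \<le> 1" unfolding \<sigma>_def using fpos(1)[of y] by (intro f1) simp
    show "\<sigma> y = 1" if "y \<le> 0"
      using f0[OF that] by (simp add: \<sigma>_def) (simp add: f_def flat_exp_def exp_add[symmetric])
    show "\<sigma> y = 0" if "1 \<le> y"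
      using f0(1)[of "1 - exp 1 * f y"] f2[OF that] by (simp add: \<sigma>_def)
  qed
  ultimately show thesis
    using sm der zero that[of \<sigma> \<sigma>' B] by blast
qed

text \<open>Cutting off in the square of the spatial norm avoids the singularity of the norm at the
  origin. One derivative already leaves a linear function, for which \<open>Ck_on_linear\<close>
  settles all orders.\<close>

lemma smooth_on_inner_snd: "smooth_on UNIV (\<lambda>z::real \<times> (real ^ 'n). snd z \<bullet> snd z)"
proof -
  have "Ck_on k UNIV (\<lambda>z::real \<times> (real ^ 'n). snd z \<bullet> snd z)" for k
  proof (cases k)
    case 0
    then show ?thesis by (auto intro!: continuous_intros)
  next
    case (Suc k')
    show ?thesis unfolding Suc
    proof (rule Ck_on_SucI)
      fix z :: "real \<times> (real ^ 'n)"
      show "((\<lambda>z. snd z \<bullet> snd z) has_derivative (\<lambda>h. 2 * (snd z \<bullet> snd h))) (at z)"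
        by (auto intro!: derivative_eq_intros simp: inner_commute)
    next
      fix h :: "real \<times> (real ^ 'n)"
      show "Ck_on k' UNIV (\<lambda>z::real \<times> (real ^ 'n). 2 * (snd z \<bullet> snd h))"
        by (intro Ck_on_linear) 
           (auto intro!: bounded_linear_intros bounded_linear_compose[OF bounded_linear_mult_right]
              bounded_linear_compose[OF bounded_linear_inner_left] bounded_linear_snd)
    qed simp
  qed
  then show ?thesis by (simp add: smooth_on_def)
qed

text \<open>\<open>B\<close> must not depend on R, which tends to infinity later. The time bound is
  one-sided on purpose: the switch-on between times 1/(2R) and 1/R has a slope of order R, but there
  the cutoff increases, which only lowers \<open>- time_deriv \<eta>\<close>.\<close>

lemma space_time_cutoff:
  fixes \<alpha> :: real
  assumes "\<alpha> > 0"
  obtains B where "B > 0" "\<And>R::real. R > 1 \<Longrightarrow> \<exists>\<eta> :: real \<times> (real ^ 'n) \<Rightarrow> real.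
     smooth_on UNIV \<eta> \<and> (\<forall>z. 0 \<le> \<eta> z \<and> \<eta> z \<le> 1) \<and>
     (\<forall>t x. \<eta> (t, x) \<noteq> 0 \<longrightarrow> 1 / (2 * R) \<le> t \<and> t \<le> R powr \<alpha> \<and> norm x \<le> R) \<and>
     (\<forall>t x. 1 / R \<le> t \<and> t \<le> R powr \<alpha> / 2 \<and> norm x \<le> R / 2 \<longrightarrow> \<eta> (t, x) = 1) \<and>
     (\<forall>t x. - time_deriv \<eta> (t, x) \<le> (if t \<le> R powr \<alpha> / 2 then 0 else B * R powr - \<alpha>)) \<and>
     (\<forall>t x. norm (space_grad \<eta> (t, x)) \<le> (if R / 2 < norm x \<and> norm x < R then B / R else 0))"
proof -
  obtain \<sigma> \<sigma>' :: "real \<Rightarrow> real" and B0 :: real where sm: "smooth_on UNIV \<sigma>"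
    and der: "\<And>y. (\<sigma> has_real_derivative \<sigma>' y) (at y)"
    and \<sigma>: "\<And>y. 0 \<le> \<sigma> y" "\<And>y. \<sigma> y \<le> 1" "\<And>y. y \<le> 0 \<Longrightarrow> \<sigma> y = 1" "\<And>y. 1 \<le> y \<Longrightarrow> \<sigma> y = 0"
    and \<sigma>': "\<And>y. \<sigma>' y \<le> 0" "\<And>y. - B0 \<le> \<sigma>' y" "\<And>y. y \<le> 0 \<or> 1 \<le> y \<Longrightarrow> \<sigma>' y = 0"
    using smooth_step_exists by metis
  have B0: "B0 \<ge> 0" using \<sigma>'[of 0] by auto
  \<comment> \<open>The chain rule brings a factor 2 in time and 8/3 in space, both below 3; the 1
    makes \<open>B\<close> positive.\<close>
  define B where "B = 3 * B0 + 1"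
  show thesis
  proof
    show "B > 0" using B0 by (simp add: B_def)
    fix R :: real assume R: "R > 1"
    define T where "T = R powr \<alpha>"
    have T: "T > 0" using R by (simp add: T_def)
    \<comment> \<open>The argument of \<open>\<sigma>\<close> runs from 0 to 1 as t rises from T/2
      to T (\<open>\<eta>1\<close>), as t falls from 1/R to 1/(2R) (\<open>\<eta>2\<close>), and as
      the norm of x rises from R/2 to R (\<open>\<eta>3\<close>).\<close>
    define \<eta>1 where "\<eta>1 t = \<sigma> (2 * t / T - 1)" for t
    define \<eta>2 where "\<eta>2 t = \<sigma> (2 - 2 * R * t)" for t
    define \<eta>3 where "\<eta>3 x = \<sigma> ((4 * (x \<bullet> x) / R\<^sup>2 - 1) / 3)" for x :: "real ^ 'n"
    define \<eta> where "\<eta> z = \<eta>1 (fst z) * \<eta>2 (fst z) * \<eta>3 (snd z)" for z :: "real \<times> (real ^ 'n)"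
    define D where "D z h = (\<sigma>' (2 * fst z / T - 1) * (2 / T) * \<eta>2 (fst z) - \<eta>1 (fst z) * \<sigma>' (2 - 2 * R * fst z) * (2 * R)) * \<eta>3 (snd z) * fst h
       + \<eta>1 (fst z) * \<eta>2 (fst z) * \<sigma>' ((4 * (snd z \<bullet> snd z) / R\<^sup>2 - 1) / 3) * (8 / (3 * R\<^sup>2)) * (snd z \<bullet> snd h)"
      for z h :: "real \<times> (real ^ 'n)"
    have d\<sigma>: "((\<lambda>z. \<sigma> (g z)) has_derivative (\<lambda>h. \<sigma>' (g z) * g' h)) (at z)"
      if "(g has_derivative g') (at z)" for g g' and z :: "real \<times> (real ^ 'n)"
      using has_derivative_compose[OF that] der[of "g z"] by (simp add: has_field_derivative_def)
    have D: "(\<eta> has_derivative D z) (at z)" for z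
      unfolding \<eta>_def \<eta>1_def \<eta>2_def \<eta>3_def D_def using T R
      by (auto intro!: derivative_eq_intros d\<sigma> simp: fun_eq_iff inner_commute power2_eq_square field_simps)
    then have fd: "frechet_derivative \<eta> (at z) = D z" for z
      by (simp add: frechet_derivative_at[symmetric])
    have sm\<sigma>: "smooth_on UNIV (\<lambda>z. \<sigma> (g z))" if "smooth_on UNIV g" for g :: "real \<times> (real ^ 'n) \<Rightarrow> real"
      using that sm by (rule smooth_on_compose[rotated 3]) auto
    have "smooth_on UNIV (\<lambda>z :: real \<times> (real ^ 'n). 2 / T * fst z - 1)"
      by (intro smooth_on_diff smooth_on_mult smooth_on_const smooth_on_linear[OF bounded_linear_fst] open_UNIV)
    moreover have "smooth_on UNIV (\<lambda>z :: real \<times> (real ^ 'n). 2 - (2 * R) * fst z)"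
      by (intro smooth_on_diff smooth_on_mult smooth_on_const smooth_on_linear[OF bounded_linear_fst] open_UNIV)
    moreover have "smooth_on UNIV (\<lambda>z :: real \<times> (real ^ 'n). 4 / (3 * R\<^sup>2) * (snd z \<bullet> snd z) - 1 / 3)"
      by (intro smooth_on_diff smooth_on_mult smooth_on_const smooth_on_inner_snd open_UNIV)
    ultimately have "smooth_on UNIV (\<lambda>z :: real \<times> (real ^ 'n). \<eta>1 (fst z))"
      "smooth_on UNIV (\<lambda>z :: real \<times> (real ^ 'n). \<eta>2 (fst z))"
      "smooth_on UNIV (\<lambda>z :: real \<times> (real ^ 'n). \<eta>3 (snd z))"
      unfolding \<eta>1_def \<eta>2_def \<eta>3_def
      by (auto dest!: sm\<sigma> simp: diff_divide_distrib mult.commute)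
    then have 1: "smooth_on UNIV \<eta>"
      unfolding \<eta>_def by (intro smooth_on_mult open_UNIV)
    have 2: "0 \<le> \<eta> z \<and> \<eta> z \<le> 1" for z
      unfolding \<eta>_def \<eta>1_def \<eta>2_def \<eta>3_def by (simp add: \<sigma> mult_le_one)
    have 3: "1 / (2 * R) \<le> t \<and> t \<le> T \<and> norm x \<le> R" if "\<eta> (t, x) \<noteq> 0" for t x
    proof -
      from that have "\<eta>1 t \<noteq> 0" "\<eta>2 t \<noteq> 0" "\<eta>3 x \<noteq> 0" by (auto simp: \<eta>_def)
      then have *: "2 * t / T - 1 < 1" "2 - 2 * R * t < 1" "(4 * (x \<bullet> x) / R\<^sup>2 - 1) / 3 < 1"
        using \<sigma>(4) unfolding \<eta>1_def \<eta>2_def \<eta>3_def by (meson not_le)+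
      from *(3) have "(norm x)\<^sup>2 < R\<^sup>2" using R by (simp add: dot_square_norm divide_simps)
      then have "norm x < R" using R by (auto intro: power2_less_imp_less)
      then show ?thesis using *(1,2) T R by (simp add: field_simps)
    qed
    have norm_le: "(4 * (x \<bullet> x) / R\<^sup>2 - 1) / 3 \<le> 0" if "norm x \<le> R / 2" for x :: "real ^ 'n"
    proof -
      have "(norm x)\<^sup>2 \<le> (R / 2)\<^sup>2" using that by (intro power_mono) auto
      then show ?thesis using R by (simp add: dot_square_norm field_simps)
    qed
    have norm_ge: "1 \<le> (4 * (x \<bullet> x) / R\<^sup>2 - 1) / 3" if "R \<le> norm x" for x :: "real ^ 'n"
    proof -
      have "R\<^sup>2 \<le> (norm x)\<^sup>2" using that R by (intro power_mono) auto
      then show ?thesis using R by (simp add: dot_square_norm field_simps)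
    qed
    have 4: "\<eta> (t, x) = 1" if "1 / R \<le> t" "t \<le> T / 2" "norm x \<le> R / 2" for t x
    proof -
      have "\<eta>1 t = 1" "\<eta>2 t = 1" unfolding \<eta>1_def \<eta>2_def
        using that T R by (auto intro!: \<sigma>(3) simp: field_simps)
      moreover have "\<eta>3 x = 1" unfolding \<eta>3_def by (rule \<sigma>(3)[OF norm_le[OF that(3)]])
      ultimately show ?thesis by (simp add: \<eta>_def)
    qed
    have bound: "\<bar>a * b\<bar> \<le> B0" if "- B0 \<le> a" "a \<le> 0" "0 \<le> b" "b \<le> 1" for a b :: real
    proof -
      have "\<bar>a\<bar> * \<bar>b\<bar> \<le> B0 * 1" using that by (intro mult_mono) auto
      then show ?thesis by (simp add: abs_mult)
    qed
    have \<eta>i: "0 \<le> \<eta>1 t \<and> \<eta>1 t \<le> 1 \<and> 0 \<le> \<eta>2 t \<and> \<eta>2 t \<le> 1 \<and> 0 \<le> \<eta>3 x \<and> \<eta>3 x \<le> 1" for t x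
      by (auto simp: \<eta>1_def \<eta>2_def \<eta>3_def \<sigma>)
    have 5: "- time_deriv \<eta> (t, x) \<le> (if t \<le> T / 2 then 0 else B * R powr - \<alpha>)" for t x
    proof -
      \<comment> \<open>The contribution of the switch-on factor \<open>\<eta>2\<close>, the one
        with slope of order R, has a favourable sign and is dropped.\<close>
      have "\<eta>1 t * \<sigma>' (2 - 2 * R * t) * (2 * R) * \<eta>3 x \<le> 0"
        using \<eta>i[of t x] \<sigma>'(1)[of "2 - 2 * R * t"] R by (simp add: mult_nonneg_nonpos mult_nonpos_nonneg)
      moreover have "- time_deriv \<eta> (t, x) = - (\<sigma>' (2 * t / T - 1) * (\<eta>2 t * \<eta>3 x)) * (2 / T) + \<eta>1 t * \<sigma>' (2 - 2 * R * t) * (2 * R) * \<eta>3 x"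
        unfolding time_deriv_def fd D_def by (simp add: algebra_simps)
      ultimately have le: "- time_deriv \<eta> (t, x) \<le> - (\<sigma>' (2 * t / T - 1) * (\<eta>2 t * \<eta>3 x)) * (2 / T)" by simp
      show ?thesis
      proof (cases "t \<le> T / 2")
        case True
        then have "\<sigma>' (2 * t / T - 1) = 0" using T by (intro \<sigma>'(3)) (auto simp: field_simps)
        then show ?thesis using le True by simp
      next
        case False
        have "\<bar>\<sigma>' (2 * t / T - 1) * (\<eta>2 t * \<eta>3 x)\<bar> \<le> B0"
          using \<eta>i[of t x] \<sigma>' by (intro bound) (auto intro: mult_le_one)
        then have "- (\<sigma>' (2 * t / T - 1) * (\<eta>2 t * \<eta>3 x)) * (2 / T) \<le> B0 * (2 / T)"
          using T by (intro mult_right_mono) auto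
        also have "\<dots> = 2 * B0 * R powr - \<alpha>" using R by (simp add: T_def powr_minus divide_inverse)
        also have "\<dots> \<le> B * R powr - \<alpha>" using B0 by (intro mult_right_mono) (auto simp: B_def)
        finally show ?thesis using le False by simp
      qed
    qed
    have 6: "norm (space_grad \<eta> (t, x)) \<le> (if R / 2 < norm x \<and> norm x < R then B / R else 0)" for t x
    proof -
      let ?s = "\<sigma>' ((4 * (x \<bullet> x) / R\<^sup>2 - 1) / 3)"
      have grad: "space_grad \<eta> (t, x) = (?s * (\<eta>1 t * \<eta>2 t) * (8 / (3 * R\<^sup>2))) *\<^sub>R x"
        unfolding space_grad_def fd D_def by (simp add: vec_eq_iff inner_axis mult_ac)
      show ?thesis
      proof (cases "R / 2 < norm x \<and> norm x < R")
        case True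
        have "\<bar>?s * (\<eta>1 t * \<eta>2 t)\<bar> \<le> B0"
          using \<eta>i[of t x] \<sigma>' by (intro bound) (auto intro: mult_le_one)
        then have "norm (space_grad \<eta> (t, x)) \<le> B0 * (8 / (3 * R\<^sup>2)) * R"
          unfolding grad norm_scaleR abs_mult[of _ "8 / (3 * R\<^sup>2)"] using True R
          by (intro mult_mono) (auto simp: B0)
        also have "\<dots> = (8 / 3 * B0) / R" using R by (simp add: power2_eq_square)
        also have "\<dots> \<le> B / R" using R B0 by (intro divide_right_mono) (auto simp: B_def)
        finally show ?thesis using True by simp
      next
        case False
        then have "?s = 0" using norm_le[of x] norm_ge[of x] by (intro \<sigma>'(3)) auto
        then show ?thesis unfolding grad using False by auto
      qed
    qed
    show "\<exists>\<eta> :: real \<times> (real ^ 'n) \<Rightarrow> real.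
     smooth_on UNIV \<eta> \<and> (\<forall>z. 0 \<le> \<eta> z \<and> \<eta> z \<le> 1) \<and>
     (\<forall>t x. \<eta> (t, x) \<noteq> 0 \<longrightarrow> 1 / (2 * R) \<le> t \<and> t \<le> R powr \<alpha> \<and> norm x \<le> R) \<and>
     (\<forall>t x. 1 / R \<le> t \<and> t \<le> R powr \<alpha> / 2 \<and> norm x \<le> R / 2 \<longrightarrow> \<eta> (t, x) = 1) \<and>
     (\<forall>t x. - time_deriv \<eta> (t, x) \<le> (if t \<le> R powr \<alpha> / 2 then 0 else B * R powr - \<alpha>)) \<and>
     (\<forall>t x. norm (space_grad \<eta> (t, x)) \<le> (if R / 2 < norm x \<and> norm x < R then B / R else 0))"
      using 1 2 3 4 5 6 unfolding T_def by (intro exI[of _ \<eta>]) auto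
  qed
qed

text \<open>\<open>P\<close> is a smooth positive substitute for twice the positive part of s, with
  slope between 0 and 2. Hence 1 + (1 + P) powr -\<nu> is smooth and bounded also at negative
  arguments, which approximants of a non-negative function may take; the decay rate matters only for
  s \<ge> 0.\<close>

lemma decreasing_multiplier:
  fixes \<nu> :: real
  assumes "\<nu> > 0"
  obtains h h' :: "real \<Rightarrow> real" and B c :: real
  where "smooth_on UNIV h" "\<And>s. (h has_real_derivative h' s) (at s)"
    "\<And>s. 1 \<le> h s" "\<And>s. h s \<le> 2" "\<And>s. \<bar>h' s\<bar> \<le> B" "c > 0" "\<And>s. 0 \<le> s \<Longrightarrow> h' s \<le> - c * (1 + s) powr (- \<nu> - 1)"
proof -
  define P where "P s = s + (1 + s\<^sup>2) powr (1/2)" for s :: real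
  have sq: "(1 + s\<^sup>2) powr (1/2) = sqrt (1 + s\<^sup>2)" for s :: real
    by (simp add: powr_half_sqrt add_nonneg_nonneg)
  have gt: "\<bar>s\<bar> < sqrt (1 + s\<^sup>2)" for s :: real
    by (rule real_less_rsqrt) simp
  have P: "0 < P s" for s unfolding P_def sq using gt[of s] by linarith
  define P' where "P' s = 1 + s / sqrt (1 + s\<^sup>2)" for s :: real
  have nz: "1 + s\<^sup>2 > 0" for s :: real by (simp add: add_pos_nonneg)
  have dP: "(P has_real_derivative P' s) (at s)" for s
    unfolding P_def sq P'_def using nz[of s]
    by (auto intro!: derivative_eq_intros simp: field_simps)
  have P'b: "0 \<le> P' s" "P' s \<le> 2" for s
  proof -
    have "\<bar>s / sqrt (1 + s\<^sup>2)\<bar> \<le> 1" using gt[of s] nz[of s] by (auto simp: abs_div divide_simps)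
    then show "0 \<le> P' s" "P' s \<le> 2" unfolding P'_def by linarith+
  qed
  define h where "h s = 1 + (1 + P s) powr (- \<nu>)" for s
  define h' where "h' s = - \<nu> * (1 + P s) powr (- \<nu> - 1) * P' s" for s
  have "smooth_on UNIV (\<lambda>s :: real. 1 + s\<^sup>2)"
    by (intro smooth_on_add smooth_on_power smooth_on_const smooth_on_linear[OF bounded_linear_ident] open_UNIV)
  then have "smooth_on UNIV (\<lambda>s :: real. (1 + s\<^sup>2) powr (1/2))"
    using smooth_on_powr by (rule smooth_on_compose[rotated 3]) (auto simp: nz)
  then have "smooth_on UNIV (\<lambda>s. 1 + P s)"
    unfolding P_def by (intro smooth_on_add smooth_on_const smooth_on_linear[OF bounded_linear_ident] open_UNIV)
  then have smP: "smooth_on UNIV (\<lambda>s. (1 + P s) powr - \<nu>)"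
    using smooth_on_powr by (rule smooth_on_compose[rotated 3]) (auto simp: add_pos_pos P)
  show thesis
  proof
    show "smooth_on UNIV h"
      unfolding h_def by (intro smooth_on_add smP smooth_on_const open_UNIV)
    show "(h has_real_derivative h' s) (at s)" for s
      unfolding h_def h'_def using P[of s]
      by (auto intro!: derivative_eq_intros dP)
    show "1 \<le> h s" for s by (simp add: h_def)
    show "h s \<le> 2" for s
      using P[of s] assms powr_mono2'[of "-\<nu>" 1 "1 + P s"] by (simp add: h_def)
    show "\<bar>h' s\<bar> \<le> \<nu> * 1 * 2" for s
    proof -
      have "(1 + P s) powr (- \<nu> - 1) \<le> 1"
        using P[of s] assms powr_mono2'[of "-\<nu> - 1" 1 "1 + P s"] by simp
      then show ?thesis unfolding h'_def abs_mult using assms P'b[of s] by (intro mult_mono) auto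
    qed
    show "\<nu> * 2 powr (- \<nu> - 1) > 0" using assms by simp
    show "h' s \<le> - (\<nu> * 2 powr (- \<nu> - 1)) * (1 + s) powr (- \<nu> - 1)" if "0 \<le> s" for s
    proof -
      have "sqrt (1 + s\<^sup>2) \<le> 1 + s" using that by (intro real_le_lsqrt) (auto simp: power2_eq_square algebra_simps)
      \<comment> \<open>This comparison produces the factor 2 powr (-\<nu> - 1) of the
        constant.\<close>
      then have "1 + P s \<le> 2 * (1 + s)" unfolding P_def sq by simp
      then have "(2 * (1 + s)) powr (- \<nu> - 1) \<le> (1 + P s) powr (- \<nu> - 1)"
        using P[of s] assms powr_mono2'[of "-\<nu> - 1" "1 + P s" "2 * (1 + s)"] by simp
      moreover have "1 \<le> P' s" unfolding P'_def using that by simp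
      ultimately have "\<nu> * (2 * (1 + s)) powr (- \<nu> - 1) * 1 \<le> \<nu> * (1 + P s) powr (- \<nu> - 1) * P' s"
        using assms by (intro mult_mono) auto
      moreover have "(2 * (1 + s)) powr (- \<nu> - 1) = 2 powr (- \<nu> - 1) * (1 + s) powr (- \<nu> - 1)"
        by (rule powr_mult)
      ultimately show ?thesis unfolding h'_def by simp
    qed
  qed
qed

section \<open>Energy limits of smooth functions\<close>

lemma smooth_on_borel_measurable:
  "open S \<Longrightarrow> smooth_on S f \<Longrightarrow> f \<in> borel_measurable (lebesgue_on S)"
  for S :: "'a::euclidean_space set"
  by (intro continuous_imp_measurable_on_sets_lebesgue smooth_on_continuous) auto

lemma time_deriv_borel_measurable:
  "open S \<Longrightarrow> smooth_on S f \<Longrightarrow> time_deriv f \<in> borel_measurable (lebesgue_on S)"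
  unfolding time_deriv_def by (intro smooth_on_borel_measurable smooth_on_frechet_derivative)

lemma space_grad_borel_measurable:
  assumes "open S" "smooth_on S f"
  shows "space_grad f \<in> borel_measurable (lebesgue_on S)"
  unfolding space_grad_def
  by (intro continuous_imp_measurable_on_sets_lebesgue continuous_on_vec_lambda
      smooth_on_continuous smooth_on_frechet_derivative) (use assms in auto)

lemma time_deriv_diff:
  assumes "f differentiable (at z)" "g differentiable (at z)"
  shows "time_deriv (\<lambda>z. f z - g z) z = time_deriv f z - time_deriv g z"
  unfolding time_deriv_def using frechet_derivative_at[OF has_derivative_diff[OF
      assms[unfolded frechet_derivative_works]], symmetric]
  by simp

lemma space_grad_diff:
  assumes "f differentiable (at z)" "g differentiable (at z)"
  shows "space_grad (\<lambda>z. f z - g z) z = space_grad f z - space_grad g z"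
  unfolding space_grad_def using frechet_derivative_at[OF has_derivative_diff[OF
      assms[unfolded frechet_derivative_works]], symmetric]
  by (simp add: vec_eq_iff)

section \<open>Algebra of a symmetric non-negative form\<close>

lemma coeff_form_diff_left: "coeff_form a z (x - y) v = coeff_form a z x v - coeff_form a z y v"
  and coeff_form_add_left: "coeff_form a z (x + y) v = coeff_form a z x v + coeff_form a z y v"
  and coeff_form_diff_right: "coeff_form a z v (x - y) = coeff_form a z v x - coeff_form a z v y"
  and coeff_form_add_right: "coeff_form a z v (x + y) = coeff_form a z v x + coeff_form a z v y"
  and coeff_form_scaleR_left: "coeff_form a z (r *\<^sub>R x) v = r * coeff_form a z x v"
  and coeff_form_scaleR_right: "coeff_form a z v (r *\<^sub>R x) = r * coeff_form a z v x"
  unfolding coeff_form_def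
  by (simp_all add: algebra_simps sum.distrib sum_subtractf sum_distrib_left)

lemma coeff_form_zero [simp]: "coeff_form a z 0 v = 0" "coeff_form a z v 0 = 0"
  by (simp_all add: coeff_form_def)

lemma coeff_form_sym:
  assumes "\<And>i j. a i j z = a j i z"
  shows "coeff_form a z x y = coeff_form a z y x"
  unfolding coeff_form_def by (subst sum.swap) (simp add: assms mult_ac)

text \<open>Expanding the form at \<open>r *\<^sub>R x + y\<close> and at
  \<open>r *\<^sub>R x - y\<close> bounds the cross term with either sign. Only non-negativity
  enters, so the form may degenerate; the free weight r stands in for the Cauchy-Schwarz
  inequality.\<close>

lemma coeff_form_Young:
  assumes sym: "\<And>i j. a i j z = a j i z" and pos: "\<And>\<xi>. 0 \<le> coeff_form a z \<xi> \<xi>" and "r > 0"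
  shows "2 * \<bar>coeff_form a z x y\<bar> \<le> r * coeff_form a z x x + coeff_form a z y y / r"
proof -
  have "0 \<le> coeff_form a z (r *\<^sub>R x + y) (r *\<^sub>R x + y)" "0 \<le> coeff_form a z (r *\<^sub>R x - y) (r *\<^sub>R x - y)"
    by (rule pos)+
  then have "2 * r * \<bar>coeff_form a z x y\<bar> \<le> r * (r * coeff_form a z x x) + coeff_form a z y y"
    using coeff_form_sym[of a z y x, OF sym]
    by (simp add: coeff_form_diff_left coeff_form_add_left coeff_form_diff_right coeff_form_add_right
        coeff_form_scaleR_left coeff_form_scaleR_right algebra_simps abs_if)
  then show ?thesis using \<open>r > 0\<close> by (simp add: field_simps)
qed

text \<open>Parallelogram law: the two sides differ by the form at \<open>x + y\<close>, which is
  non-negative.\<close>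

lemma coeff_form_diff_le:
  assumes "\<And>i j. a i j z = a j i z" and pos: "\<And>\<xi>. 0 \<le> coeff_form a z \<xi> \<xi>"
  shows "coeff_form a z (x - y) (x - y) \<le> 2 * coeff_form a z x x + 2 * coeff_form a z y y"
  using pos[of "x + y"] coeff_form_sym[of a z y x, OF assms(1)]
  by (simp add: coeff_form_diff_left coeff_form_add_left coeff_form_diff_right coeff_form_add_right)

lemma powr_abs_diff_le:
  fixes x y q :: real
  assumes "0 \<le> q"
  shows "\<bar>x - y\<bar> powr q \<le> 2 powr q * (\<bar>x\<bar> powr q + \<bar>y\<bar> powr q)"
proof -
  have "\<bar>x - y\<bar> powr q \<le> (2 * max \<bar>x\<bar> \<bar>y\<bar>) powr q"
    using assms by (intro powr_mono2) auto
  also have "\<dots> = 2 powr q * max \<bar>x\<bar> \<bar>y\<bar> powr q" by (rule powr_mult)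
  also have "\<dots> \<le> 2 powr q * (\<bar>x\<bar> powr q + \<bar>y\<bar> powr q)"
    by (intro mult_left_mono) (auto simp: max_def)
  finally show ?thesis .
qed

text \<open>Beyond the threshold e, monotonicity gives
  \<open>\<bar>x\<bar> powr (1 - q) \<le> e powr (1 - q)\<close>. On a finite measure space this
  replaces the Hoelder inequality in passing from q-th powers to L1.\<close>

lemma abs_le_powr_split:
  fixes x e q :: real
  assumes "e > 0" "1 \<le> q"
  shows "\<bar>x\<bar> \<le> e + e powr (1 - q) * \<bar>x\<bar> powr q"
proof (cases "\<bar>x\<bar> \<le> e")
  case False
  then have "e powr (1 - q) * \<bar>x\<bar> powr q \<ge> \<bar>x\<bar> powr (1 - q) * \<bar>x\<bar> powr q"
    using assms by (intro mult_right_mono powr_mono2') auto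
  also have "\<bar>x\<bar> powr (1 - q) * \<bar>x\<bar> powr q = \<bar>x\<bar>"
    using False assms by (simp add: powr_add[symmetric])
  finally show ?thesis using assms by simp
qed (simp add: add_increasing2)

lemma tendsto_integral_abs_of_powr:
  fixes f :: "nat \<Rightarrow> 'a \<Rightarrow> real"
  assumes "finite_measure M" "1 \<le> q" and meas: "\<And>k. f k \<in> borel_measurable M"
    and int: "\<And>k. integrable M (\<lambda>x. \<bar>f k x\<bar> powr q)"
    and lim: "(\<lambda>k. \<integral>x. \<bar>f k x\<bar> powr q \<partial>M) \<longlonglongrightarrow> 0"
  shows "integrable M (f k)" "(\<lambda>k. \<integral>x. \<bar>f k x\<bar> \<partial>M) \<longlonglongrightarrow> 0"
proof -
  interpret finite_measure M by fact
  have split: "\<bar>x\<bar> \<le> e + e powr (1 - q) * \<bar>x\<bar> powr q" if "e > 0" for e x :: real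
    using abs_le_powr_split[OF that assms(2)] .
  have i: "integrable M (f k)" for k
  proof (rule Bochner_Integration.integrable_bound)
    show "integrable M (\<lambda>x. 1 + 1 powr (1 - q) * \<bar>f k x\<bar> powr q)"
      by (intro Bochner_Integration.integrable_add integrable_mult_right int) simp
    show "AE x in M. norm (f k x) \<le> norm (1 + 1 powr (1 - q) * \<bar>f k x\<bar> powr q)"
      using split[of 1] by (intro AE_I2) (simp add: abs_of_nonneg)
  qed (rule meas)
  then show "integrable M (f k)" .
  have bound: "(\<integral>x. \<bar>f k x\<bar> \<partial>M) \<le> e * measure M (space M) + e powr (1 - q) * (\<integral>x. \<bar>f k x\<bar> powr q \<partial>M)"
    if "e > 0" for e k
  proof -
    have "(\<integral>x. \<bar>f k x\<bar> \<partial>M) \<le> (\<integral>x. e + e powr (1 - q) * \<bar>f k x\<bar> powr q \<partial>M)"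
      using split[OF that] i int by (intro integral_mono) auto
    also have "\<dots> = e * measure M (space M) + e powr (1 - q) * (\<integral>x. \<bar>f k x\<bar> powr q \<partial>M)"
      using int by simp
    finally show ?thesis .
  qed
  show "(\<lambda>k. \<integral>x. \<bar>f k x\<bar> \<partial>M) \<longlonglongrightarrow> 0"
  proof (rule LIMSEQ_I)
    fix r :: real assume "r > 0"
    \<comment> \<open>Half of r is spent on the constant part; adding 1 avoids a division by
      zero.\<close>
    define m where "m = measure M (space M) + 1"
    have m: "m > 0" by (simp add: m_def add_nonneg_pos)
    define e where "e = r / (2 * m)"
    have e: "e > 0" using \<open>r > 0\<close> m by (simp add: e_def)
    have em: "e * measure M (space M) \<le> r / 2"
    proof -
      have "e * measure M (space M) \<le> e * m" using e by (intro mult_left_mono) (auto simp: m_def)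
      also have "\<dots> = r / 2" unfolding e_def using m by (simp add: field_simps)
      finally show ?thesis .
    qed
    have "(\<lambda>k. e powr (1 - q) * (\<integral>x. \<bar>f k x\<bar> powr q \<partial>M)) \<longlonglongrightarrow> e powr (1 - q) * 0"
      by (intro tendsto_intros lim)
    then have "eventually (\<lambda>k. e powr (1 - q) * (\<integral>x. \<bar>f k x\<bar> powr q \<partial>M) < r / 2) sequentially"
      using \<open>r > 0\<close> by (intro order_tendstoD(2)) auto
    then obtain N where N: "\<And>k. k \<ge> N \<Longrightarrow> e powr (1 - q) * (\<integral>x. \<bar>f k x\<bar> powr q \<partial>M) < r / 2"
      by (auto simp: eventually_sequentially)
    have "(\<integral>x. \<bar>f k x\<bar> \<partial>M) < r" if "k \<ge> N" for k
      using bound[OF e, of k] N[OF that] em by linarith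
    then show "\<exists>no. \<forall>n\<ge>no. norm ((\<integral>x. \<bar>f n x\<bar> \<partial>M) - 0) < r"
      by (intro exI[of _ N]) auto
  qed
qed

text \<open>Keeps from the norm what the nonlinear test needs: L1 convergence of \<open>w\<close> in
  place of q-th powers, because \<open>w\<close> enters there only through bounded or Lipschitz
  functions; the q-th powers return as an integrable source term. The three convergences are
  separate so that differences and subsequences inherit them.\<close>

definition energy_limit ::
    "('n::finite \<Rightarrow> 'n \<Rightarrow> real \<times> (real ^ 'n) \<Rightarrow> real) \<Rightarrow> (real \<times> (real ^ 'n)) set \<Rightarrow>
       (nat \<Rightarrow> real \<times> (real ^ 'n) \<Rightarrow> real) \<Rightarrow>
       (real \<times> (real ^ 'n) \<Rightarrow> real) \<Rightarrow> (real \<times> (real ^ 'n) \<Rightarrow> real) \<Rightarrow>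
       (real \<times> (real ^ 'n) \<Rightarrow> real ^ 'n) \<Rightarrow> bool" where
  "energy_limit a \<Omega> ws w p g \<longleftrightarrow>
     integrable (lebesgue_on \<Omega>) w \<and> integrable (lebesgue_on \<Omega>) p \<and>
     g \<in> borel_measurable (lebesgue_on \<Omega>) \<and>
     integrable (lebesgue_on \<Omega>) (\<lambda>z. coeff_form a z (g z) (g z)) \<and>
     (\<forall>k. smooth_on \<Omega> (ws k) \<and> integrable (lebesgue_on \<Omega>) (ws k) \<and>
        integrable (lebesgue_on \<Omega>) (time_deriv (ws k)) \<and>
        integrable (lebesgue_on \<Omega>) (\<lambda>z. coeff_form a z (space_grad (ws k) z) (space_grad (ws k) z))) \<and>
     (\<lambda>k. \<integral>z. \<bar>ws k z - w z\<bar> \<partial>lebesgue_on \<Omega>) \<longlonglongrightarrow> 0 \<and>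
     (\<lambda>k. \<integral>z. \<bar>time_deriv (ws k) z - p z\<bar> \<partial>lebesgue_on \<Omega>) \<longlonglongrightarrow> 0 \<and>
     (\<lambda>k. \<integral>z. coeff_form a z (space_grad (ws k) z - g z) (space_grad (ws k) z - g z) \<partial>lebesgue_on \<Omega>)
       \<longlonglongrightarrow> 0"

section \<open>Forms that may degenerate, on a bounded open set\<close>

locale degenerate_form =
  fixes a :: "'n::finite \<Rightarrow> 'n \<Rightarrow> real \<times> (real ^ 'n) \<Rightarrow> real"
    and \<Omega> :: "(real \<times> (real ^ 'n)) set"
  assumes open_domain: "open \<Omega>" and bounded_domain: "bounded \<Omega>"
    and coeff_measurable [measurable]: "\<And>i j. a i j \<in> borel_measurable (lebesgue_on \<Omega>)"
    and coeff_symmetric: "AE z in lebesgue_on \<Omega>. \<forall>i j. a i j z = a j i z"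
    and coeff_nonneg: "AE z in lebesgue_on \<Omega>. \<forall>\<xi>. 0 \<le> coeff_form a z \<xi> \<xi>"
begin

lemma finite_measure_domain: "finite_measure (lebesgue_on \<Omega>)"
proof
  have "emeasure lebesgue \<Omega> < \<infinity>"
    using bounded_domain open_domain lmeasurable_open fmeasurableD2 by (metis top.not_eq_extremum infinity_ennreal_def)
  then show "emeasure (lebesgue_on \<Omega>) (space (lebesgue_on \<Omega>)) \<noteq> \<infinity>"
    using open_domain by (simp add: emeasure_restrict_space)
qed

lemma coeff_form_measurable [measurable (raw)]:
  assumes [measurable]: "f \<in> borel_measurable (lebesgue_on \<Omega>)" "g \<in> borel_measurable (lebesgue_on \<Omega>)"
  shows "(\<lambda>z. coeff_form a z (f z) (g z)) \<in> borel_measurable (lebesgue_on \<Omega>)"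
proof -
  have "(\<lambda>z. f z \<bullet> axis i 1) \<in> borel_measurable (lebesgue_on \<Omega>)"
       "(\<lambda>z. g z \<bullet> axis i 1) \<in> borel_measurable (lebesgue_on \<Omega>)" for i
    by measurable
  then have [measurable]: "(\<lambda>z. f z $ i) \<in> borel_measurable (lebesgue_on \<Omega>)"
       "(\<lambda>z. g z $ i) \<in> borel_measurable (lebesgue_on \<Omega>)" for i
    by (simp_all add: inner_axis)
  show ?thesis unfolding coeff_form_def by measurable
qed

lemma integrable_coeff_form_diff:
  assumes meas [measurable]: "f \<in> borel_measurable (lebesgue_on \<Omega>)" "g \<in> borel_measurable (lebesgue_on \<Omega>)"
    and "integrable (lebesgue_on \<Omega>) (\<lambda>z. coeff_form a z (f z) (f z))"
    and "integrable (lebesgue_on \<Omega>) (\<lambda>z. coeff_form a z (g z) (g z))"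
  shows "integrable (lebesgue_on \<Omega>) (\<lambda>z. coeff_form a z (f z - g z) (f z - g z))"
proof (rule Bochner_Integration.integrable_bound)
  show "integrable (lebesgue_on \<Omega>) (\<lambda>z. 2 * coeff_form a z (f z) (f z) + 2 * coeff_form a z (g z) (g z))"
    using assms(3,4) by simp
  show "AE z in lebesgue_on \<Omega>. norm (coeff_form a z (f z - g z) (f z - g z))
      \<le> norm (2 * coeff_form a z (f z) (f z) + 2 * coeff_form a z (g z) (g z))"
    using coeff_symmetric coeff_nonneg
  proof eventually_elim
    case (elim z)
    then have "0 \<le> coeff_form a z (f z - g z) (f z - g z)" by blast
    moreover have "coeff_form a z (f z - g z) (f z - g z)
        \<le> 2 * coeff_form a z (f z) (f z) + 2 * coeff_form a z (g z) (g z)"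
      using elim by (intro coeff_form_diff_le) auto
    ultimately show ?case by simp
  qed
qed measurable

lemma integrable_coeff_form:
  assumes [measurable]: "f \<in> borel_measurable (lebesgue_on \<Omega>)" "g \<in> borel_measurable (lebesgue_on \<Omega>)"
    and "integrable (lebesgue_on \<Omega>) (\<lambda>z. coeff_form a z (f z) (f z))"
    and "integrable (lebesgue_on \<Omega>) (\<lambda>z. coeff_form a z (g z) (g z))"
  shows "integrable (lebesgue_on \<Omega>) (\<lambda>z. coeff_form a z (f z) (g z))"
proof (rule Bochner_Integration.integrable_bound)
  show "integrable (lebesgue_on \<Omega>) (\<lambda>z. coeff_form a z (f z) (f z) + coeff_form a z (g z) (g z))"
    using assms(3,4) by simp
  show "AE z in lebesgue_on \<Omega>. norm (coeff_form a z (f z) (g z))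
      \<le> norm (coeff_form a z (f z) (f z) + coeff_form a z (g z) (g z))"
    using coeff_symmetric coeff_nonneg
  proof eventually_elim
    case (elim z)
    then show ?case using coeff_form_Young[of a z 1 "f z" "g z"] by auto
  qed
qed measurable

text \<open>The three summands of the norm are non-negative, so each tends to 0 and its root can be
  undone. Boundedness of the domain then takes convergence of q-th powers down to L1.\<close>

lemma W_space_energy_limit:
  assumes W: "(w, p, g) \<in> W_space a q \<Omega>" and q: "1 < q"
  obtains ws where "energy_limit a \<Omega> ws w p g"
    and "integrable (lebesgue_on \<Omega>) (\<lambda>z. \<bar>w z\<bar> powr q)"
proof -
  let ?M = "lebesgue_on \<Omega>"
  interpret finite_measure ?M by (rule finite_measure_domain)
  have hat: "hat q = q" using q by (simp add: hat_def)
  have set_int: "set_integrable lebesgue \<Omega> f \<longleftrightarrow> integrable ?M f" for f :: "_ \<Rightarrow> real"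
    unfolding set_integrable_def using open_domain by (subst integrable_restrict_space) auto
  have set_lint: "(LINT z:\<Omega>|lebesgue. f z) = (\<integral>z. f z \<partial>?M)" for f :: "_ \<Rightarrow> real"
    unfolding set_lebesgue_integral_def using open_domain by (subst integral_restrict_space) auto
  from W obtain ws where
    meas [measurable]: "w \<in> borel_measurable ?M" "p \<in> borel_measurable ?M" "g \<in> borel_measurable ?M"
    and fin: "W_finite a q \<Omega> w p g"
    and ws: "\<And>k. smooth_on \<Omega> (ws k)"
      "\<And>k. W_finite a q \<Omega> (ws k) (time_deriv (ws k)) (space_grad (ws k))"
    and lim: "(\<lambda>k. W_norm a q \<Omega> (\<lambda>z. ws k z - w z) (\<lambda>z. time_deriv (ws k) z - p z)
                        (\<lambda>z. space_grad (ws k) z - g z)) \<longlonglongrightarrow> 0"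
    unfolding W_space_def by auto
  have meas_ws [measurable]: "ws k \<in> borel_measurable ?M" "time_deriv (ws k) \<in> borel_measurable ?M"
     "space_grad (ws k) \<in> borel_measurable ?M" for k
    using ws(1)[of k] open_domain
    by (auto intro: smooth_on_borel_measurable time_deriv_borel_measurable space_grad_borel_measurable)
  have fin': "integrable ?M p" "integrable ?M (\<lambda>z. coeff_form a z (g z) (g z))"
      "integrable ?M (\<lambda>z. \<bar>w z\<bar> powr q)"
    using fin unfolding W_finite_def set_int hat by (auto simp: integrable_abs_iff)
  have fin_ws: "integrable ?M (time_deriv (ws k))"
      "integrable ?M (\<lambda>z. coeff_form a z (space_grad (ws k) z) (space_grad (ws k) z))"
      "integrable ?M (\<lambda>z. \<bar>ws k z\<bar> powr q)" for k
    using ws(2)[of k] unfolding W_finite_def set_int hat by (auto simp: integrable_abs_iff)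
  have L1: "integrable ?M f" if "integrable ?M (\<lambda>z. \<bar>f z\<bar> powr q)" "f \<in> borel_measurable ?M" for f
  proof (rule Bochner_Integration.integrable_bound)
    show "integrable ?M (\<lambda>x. 1 + 1 powr (1 - q) * \<bar>f x\<bar> powr q)"
      by (intro Bochner_Integration.integrable_add integrable_mult_right that(1)) simp
    show "AE x in ?M. norm (f x) \<le> norm (1 + 1 powr (1 - q) * \<bar>f x\<bar> powr q)"
      using abs_le_powr_split[of 1 q] q by (intro AE_I2) (simp add: abs_of_nonneg)
  qed (rule that(2))
  define D where "D k = (\<integral>z. coeff_form a z (space_grad (ws k) z - g z) (space_grad (ws k) z - g z) \<partial>?M)" for k
  define P where "P k = (\<integral>z. \<bar>time_deriv (ws k) z - p z\<bar> \<partial>?M)" for k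
  define Q where "Q k = (\<integral>z. \<bar>ws k z - w z\<bar> powr q \<partial>?M)" for k
  have nn: "0 \<le> D k" "0 \<le> P k" "0 \<le> Q k" for k
    unfolding D_def P_def Q_def
    using coeff_nonneg by (auto intro!: integral_nonneg_AE)
  have N: "(\<lambda>k. P k + sqrt (D k) + Q k powr (1 / q)) \<longlonglongrightarrow> 0"
    using lim unfolding W_norm_def set_lint hat P_def D_def Q_def .
  have P: "P \<longlonglongrightarrow> 0"
    by (rule tendsto_sandwich[OF _ _ tendsto_const N]) (auto simp: nn)
  have "(\<lambda>k. sqrt (D k)) \<longlonglongrightarrow> 0"
    by (rule tendsto_sandwich[OF _ _ tendsto_const N]) (auto simp: nn)
  then have "(\<lambda>k. (sqrt (D k))\<^sup>2) \<longlonglongrightarrow> 0\<^sup>2" by (intro tendsto_power)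
  then have D: "D \<longlonglongrightarrow> 0" by (simp add: nn)
  have "(\<lambda>k. Q k powr (1 / q)) \<longlonglongrightarrow> 0"
    by (rule tendsto_sandwich[OF _ _ tendsto_const N]) (auto simp: nn)
  then have "(\<lambda>k. (Q k powr (1 / q)) powr q) \<longlonglongrightarrow> 0"
    by (rule tendsto_zero_powrI[OF _ tendsto_const]) (use q in auto)
  then have Q: "Q \<longlonglongrightarrow> 0" using q by (simp add: nn powr_powr)
  have intQ: "integrable ?M (\<lambda>z. \<bar>ws k z - w z\<bar> powr q)" for k
  proof (rule Bochner_Integration.integrable_bound)
    show "integrable ?M (\<lambda>z. 2 powr q * (\<bar>ws k z\<bar> powr q + \<bar>w z\<bar> powr q))"
      using fin' fin_ws by simp
    show "AE z in ?M. norm (\<bar>ws k z - w z\<bar> powr q) \<le> norm (2 powr q * (\<bar>ws k z\<bar> powr q + \<bar>w z\<bar> powr q))"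
      using powr_abs_diff_le[of q] q by (intro AE_I2) (simp add: abs_of_nonneg)
  qed measurable
  have "(\<lambda>k. \<integral>z. \<bar>ws k z - w z\<bar> \<partial>?M) \<longlonglongrightarrow> 0"
    by (rule tendsto_integral_abs_of_powr[OF finite_measure_domain, of q])
       (use q intQ Q in \<open>auto simp: Q_def[abs_def]\<close>)
  moreover have "integrable ?M w" "integrable ?M (ws k)" for k
    by (rule L1; use fin' fin_ws in simp)+
  ultimately have "energy_limit a \<Omega> ws w p g"
    unfolding energy_limit_def
    using P D unfolding P_def[abs_def] D_def[abs_def]
    by (intro conjI allI fin' fin_ws ws(1) meas meas_ws)
  then show thesis using fin'(3) by (rule that)
qed

lemma energy_limit_measurable:
  assumes "energy_limit a \<Omega> ws w p g"
  shows "w \<in> borel_measurable (lebesgue_on \<Omega>)" "p \<in> borel_measurable (lebesgue_on \<Omega>)"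
    "g \<in> borel_measurable (lebesgue_on \<Omega>)" "ws k \<in> borel_measurable (lebesgue_on \<Omega>)"
    "time_deriv (ws k) \<in> borel_measurable (lebesgue_on \<Omega>)"
    "space_grad (ws k) \<in> borel_measurable (lebesgue_on \<Omega>)"
  using assms open_domain unfolding energy_limit_def
  by (auto intro: smooth_on_borel_measurable time_deriv_borel_measurable space_grad_borel_measurable)

text \<open>The multiplier depends on u - v, which therefore needs approximants of its own: the
  differences of those of u and v. For the energy, \<open>coeff_form_diff_le\<close> serves as a
  triangle inequality with a factor 2.\<close>

lemma energy_limit_diff:
  assumes 1: "energy_limit a \<Omega> us u pu gu" and 2: "energy_limit a \<Omega> vs v pv gv"
  shows "energy_limit a \<Omega> (\<lambda>k z. us k z - vs k z) (\<lambda>z. u z - v z) (\<lambda>z. pu z - pv z) (\<lambda>z. gu z - gv z)"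
proof -
  let ?M = "lebesgue_on \<Omega>"
  note meas [measurable] = energy_limit_measurable[OF 1] energy_limit_measurable[OF 2]
  have smooth: "smooth_on \<Omega> (us k)" "smooth_on \<Omega> (vs k)" for k
    using 1 2 by (auto simp: energy_limit_def)
  have dif: "us k differentiable (at z)" "vs k differentiable (at z)" if "z \<in> \<Omega>" for k z
    using smooth_on_has_derivative[OF smooth(1)[of k] that] smooth_on_has_derivative[OF smooth(2)[of k] that]
    unfolding differentiable_def by blast+
  have td: "time_deriv (\<lambda>z. us k z - vs k z) z = time_deriv (us k) z - time_deriv (vs k) z"
    and sg: "space_grad (\<lambda>z. us k z - vs k z) z = space_grad (us k) z - space_grad (vs k) z"
    if "z \<in> space ?M" for k z
    using that dif by (auto simp: time_deriv_diff space_grad_diff)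
  note cong = Bochner_Integration.integrable_cong[OF refl] Bochner_Integration.integral_cong[OF refl]
  have sub: "(\<lambda>k. \<integral>z. \<bar>f k z - g k z\<bar> \<partial>?M) \<longlonglongrightarrow> 0"
    if "(\<lambda>k. \<integral>z. \<bar>f k z\<bar> \<partial>?M) \<longlonglongrightarrow> 0" "(\<lambda>k. \<integral>z. \<bar>g k z\<bar> \<partial>?M) \<longlonglongrightarrow> 0"
      "\<And>k. integrable ?M (f k)" "\<And>k. integrable ?M (g k)" for f g :: "nat \<Rightarrow> _ \<Rightarrow> real"
  proof (rule tendsto_sandwich[OF _ _ tendsto_const])
    show "(\<lambda>k. (\<integral>z. \<bar>f k z\<bar> \<partial>?M) + (\<integral>z. \<bar>g k z\<bar> \<partial>?M)) \<longlonglongrightarrow> 0"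
      using tendsto_add[OF that(1,2)] by simp
    have "(\<integral>z. \<bar>f k z - g k z\<bar> \<partial>?M) \<le> (\<integral>z. \<bar>f k z\<bar> + \<bar>g k z\<bar> \<partial>?M)" for k
      using that(3,4) by (intro integral_mono) auto
    then show "\<forall>\<^sub>F k in sequentially. (\<integral>z. \<bar>f k z - g k z\<bar> \<partial>?M) \<le> (\<integral>z. \<bar>f k z\<bar> \<partial>?M) + (\<integral>z. \<bar>g k z\<bar> \<partial>?M)"
      using that(3,4) by simp
  qed auto
  have E: "integrable ?M (\<lambda>z. coeff_form a z (space_grad (us k) z - gu z) (space_grad (us k) z - gu z))"
    "integrable ?M (\<lambda>z. coeff_form a z (space_grad (vs k) z - gv z) (space_grad (vs k) z - gv z))" for k
    using 1 2 by (auto intro!: integrable_coeff_form_diff simp: energy_limit_def)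
  have D: "(\<lambda>k. \<integral>z. coeff_form a z ((space_grad (us k) z - gu z) - (space_grad (vs k) z - gv z))
       ((space_grad (us k) z - gu z) - (space_grad (vs k) z - gv z)) \<partial>?M) \<longlonglongrightarrow> 0"
    (is "?D \<longlonglongrightarrow> 0")
  proof (rule tendsto_sandwich[OF _ _ tendsto_const])
    let ?E = "\<lambda>k. 2 * (\<integral>z. coeff_form a z (space_grad (us k) z - gu z) (space_grad (us k) z - gu z) \<partial>?M)
       + 2 * (\<integral>z. coeff_form a z (space_grad (vs k) z - gv z) (space_grad (vs k) z - gv z) \<partial>?M)"
    have "?E \<longlonglongrightarrow> 2 * 0 + 2 * 0"
      using 1 2 unfolding energy_limit_def by (intro tendsto_intros) auto
    then show "?E \<longlonglongrightarrow> 0" by simp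
    have "0 \<le> ?D k" for k
      by (rule integral_nonneg_AE, rule eventually_mono[OF coeff_nonneg]) blast
    then show "\<forall>\<^sub>F k in sequentially. 0 \<le> ?D k" by simp
    have "?D k \<le> (\<integral>z. 2 * coeff_form a z (space_grad (us k) z - gu z) (space_grad (us k) z - gu z)
        + 2 * coeff_form a z (space_grad (vs k) z - gv z) (space_grad (vs k) z - gv z) \<partial>?M)" for k
    proof (rule integral_mono_AE)
      show "AE z in ?M. coeff_form a z ((space_grad (us k) z - gu z) - (space_grad (vs k) z - gv z))
           ((space_grad (us k) z - gu z) - (space_grad (vs k) z - gv z))
         \<le> 2 * coeff_form a z (space_grad (us k) z - gu z) (space_grad (us k) z - gu z)
         + 2 * coeff_form a z (space_grad (vs k) z - gv z) (space_grad (vs k) z - gv z)"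
        using coeff_symmetric coeff_nonneg by eventually_elim (rule coeff_form_diff_le; blast)
    qed (use E in \<open>auto intro!: integrable_coeff_form_diff[OF _ _ E(1) E(2)]\<close>)
    then show "\<forall>\<^sub>F k in sequentially. ?D k \<le> ?E k"
      using E by simp
  qed
  show ?thesis
    unfolding energy_limit_def
  proof (intro conjI allI)
    show "smooth_on \<Omega> (\<lambda>z. us k z - vs k z)" for k
      by (intro smooth_on_diff open_domain smooth)
    show "integrable ?M (time_deriv (\<lambda>z. us k z - vs k z))" for k
      using 1 2 by (subst cong(1)[OF td]) (auto simp: energy_limit_def)
    show "integrable ?M (\<lambda>z. coeff_form a z (space_grad (\<lambda>z. us k z - vs k z) z) (space_grad (\<lambda>z. us k z - vs k z) z))" for k
      using 1 2 by (subst cong(1)[of _ _ "\<lambda>z. coeff_form a z (space_grad (us k) z - space_grad (vs k) z) (space_grad (us k) z - space_grad (vs k) z)"])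
        (auto simp: energy_limit_def sg intro!: integrable_coeff_form_diff)
    have "(\<lambda>k. \<integral>z. \<bar>(us k z - u z) - (vs k z - v z)\<bar> \<partial>?M) \<longlonglongrightarrow> 0"
      using 1 2 by - (rule sub; auto simp: energy_limit_def)
    then show "(\<lambda>k. \<integral>z. \<bar>us k z - vs k z - (u z - v z)\<bar> \<partial>?M) \<longlonglongrightarrow> 0"
      by (simp add: algebra_simps)
    have "(\<lambda>k. \<integral>z. \<bar>(time_deriv (us k) z - pu z) - (time_deriv (vs k) z - pv z)\<bar> \<partial>?M) \<longlonglongrightarrow> 0"
      using 1 2 by - (rule sub; auto simp: energy_limit_def)
    moreover have "(\<integral>z. \<bar>time_deriv (\<lambda>z. us k z - vs k z) z - (pu z - pv z)\<bar> \<partial>?M) =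
        (\<integral>z. \<bar>(time_deriv (us k) z - pu z) - (time_deriv (vs k) z - pv z)\<bar> \<partial>?M)" for k
      by (rule cong(2)) (simp add: td algebra_simps)
    ultimately show "(\<lambda>k. \<integral>z. \<bar>time_deriv (\<lambda>z. us k z - vs k z) z - (pu z - pv z)\<bar> \<partial>?M) \<longlonglongrightarrow> 0"
      by simp
    have "(\<integral>z. coeff_form a z (space_grad (\<lambda>z. us k z - vs k z) z - (gu z - gv z))
        (space_grad (\<lambda>z. us k z - vs k z) z - (gu z - gv z)) \<partial>?M) =
        (\<integral>z. coeff_form a z ((space_grad (us k) z - gu z) - (space_grad (vs k) z - gv z))
       ((space_grad (us k) z - gu z) - (space_grad (vs k) z - gv z)) \<partial>?M)" for k
      by (rule cong(2)) (simp add: sg algebra_simps)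
    then show "(\<lambda>k. \<integral>z. coeff_form a z (space_grad (\<lambda>z. us k z - vs k z) z - (gu z - gv z))
        (space_grad (\<lambda>z. us k z - vs k z) z - (gu z - gv z)) \<partial>?M) \<longlonglongrightarrow> 0"
      using D by simp
  qed (use 1 2 in \<open>auto simp: energy_limit_def intro!: integrable_coeff_form_diff\<close>)
qed

end

section \<open>Integration by parts and nonlinear test functions\<close>

text \<open>The open sets \<open>\<Omega>\<close> and \<open>- K\<close> cover the space, and
  smoothness is local. Approximants are known to be smooth only on \<open>\<Omega>\<close>, whereas
  test functions must be smooth on the whole half-space.\<close>

lemma smooth_on_extend_zero:
  assumes "open \<Omega>" "compact K" "K \<subseteq> \<Omega>" "smooth_on \<Omega> f" "\<And>z. z \<in> \<Omega> - K \<Longrightarrow> f z = 0"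
  shows "smooth_on UNIV (\<lambda>z. if z \<in> \<Omega> then f z else 0)"
proof -
  let ?f = "\<lambda>z. if z \<in> \<Omega> then f z else 0"
  have K: "open (- K)" using \<open>compact K\<close> by (simp add: compact_imp_closed open_Compl)
  have "smooth_on \<Omega> ?f" using smooth_on_cong[OF \<open>open \<Omega>\<close>, of ?f f] assms(4) by simp
  moreover have "smooth_on (- K) ?f"
    using smooth_on_cong[OF K, of ?f "\<lambda>z. 0"] assms(5) by simp
  ultimately have "smooth_on (\<Omega> \<union> - K) ?f" by (intro smooth_on_Un assms(1) K)
  moreover have "\<Omega> \<union> - K = UNIV" using assms(3) by auto
  ultimately show ?thesis by simp
qed

lemma frechet_derivative_zero_off:
  assumes "closed K" "\<And>z. z \<notin> K \<Longrightarrow> f z = 0" "z \<notin> K"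
  shows "frechet_derivative f (at z) = (\<lambda>v. 0)"
  using frechet_derivative_cong_open[of "- K" z f "\<lambda>z. 0"] assms by (auto simp: frechet_derivative_const)

lemma compactly_supported_bounded:
  fixes f :: "'a::topological_space \<Rightarrow> real"
  assumes "continuous_on UNIV f" "compact K" "\<And>z. z \<notin> K \<Longrightarrow> f z = 0"
  obtains C where "C > 0" "\<And>z. \<bar>f z\<bar> \<le> C"
proof -
  have "bounded (f ` K)"
    using assms by (intro compact_imp_bounded compact_continuous_image) (auto intro: continuous_on_subset)
  then obtain C where C: "C > 0" "\<forall>y\<in>f ` K. norm y \<le> C" unfolding bounded_pos by blast
  have "\<bar>f z\<bar> \<le> C" for z using C assms(3)[of z] by (cases "z \<in> K") auto
  then show thesis using that C by blast
qed

text \<open>Fubini, and the fundamental theorem of calculus on each line of constant x, where both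
  end values vanish.\<close>

lemma integral_time_deriv_eq_0:
  fixes F :: "real \<times> (real ^ 'n) \<Rightarrow> real"
  assumes sm: "smooth_on UNIV F" and K: "compact K" "\<And>z. z \<notin> K \<Longrightarrow> F z = 0"
  shows "(\<integral>z. time_deriv F z \<partial>lborel) = 0"
proof -
  have cont: "continuous_on UNIV (time_deriv F)"
    unfolding time_deriv_def by (intro smooth_on_continuous smooth_on_frechet_derivative sm)
  have off: "time_deriv F z = 0" if "z \<notin> K" for z
    unfolding time_deriv_def using frechet_derivative_zero_off[of K F z] K that by (simp add: compact_imp_closed)
  have "integrable lborel (\<lambda>z. indicator K z *\<^sub>R time_deriv F z)"
    using cont by (intro borel_integrable_compact K) (auto intro: continuous_on_subset)
  moreover have "(\<lambda>z. indicator K z *\<^sub>R time_deriv F z) = time_deriv F"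
  proof
    fix z show "indicator K z *\<^sub>R time_deriv F z = time_deriv F z"
      using off[of z] by (cases "z \<in> K") auto
  qed
  ultimately have int: "integrable lborel (time_deriv F)" by simp
  obtain M where M: "M > 0" "\<And>z. z \<in> K \<Longrightarrow> norm z \<le> M"
    using compact_imp_bounded[OF K(1)] unfolding bounded_pos by blast
  have slice: "(\<integral>t. time_deriv F (t, x) \<partial>lborel) = 0" for x
  proof -
    \<comment> \<open>One more than a norm bound for \<open>K\<close>, so both ends of the time
      interval lie outside \<open>K\<close>.\<close>
    define b where "b = M + 1"
    have out: "(t, x) \<notin> K" if "\<bar>t\<bar> \<ge> b" for t
      using M(2)[of "(t, x)"] norm_fst_le[of t x] that by (auto simp: b_def)
    have "((\<lambda>t. F (t, x)) has_vector_derivative time_deriv F (t, x)) (at t)" for t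
    proof -
      have 1: "((\<lambda>t. (t, x)) has_derivative (\<lambda>h. (h, 0))) (at t)"
        by (auto intro!: derivative_eq_intros)
      have 2: "(F has_derivative frechet_derivative F (at (t, x))) (at (t, x))"
        using smooth_on_has_derivative[OF sm] by simp
      have "linear (frechet_derivative F (at (t, x)))"
        using 2 by (rule has_derivative_linear)
      then have "frechet_derivative F (at (t, x)) (h, 0) = h *\<^sub>R time_deriv F (t, x)" for h
        using linear_scale[of "frechet_derivative F (at (t, x))" h "(1, 0)"] by (simp add: time_deriv_def)
      from has_derivative_compose[OF 1 2, unfolded this] show ?thesis
        unfolding has_vector_derivative_def .
    qed
    moreover have "continuous_on S (\<lambda>t. time_deriv F (t, x))" for S
      by (rule continuous_on_compose2[OF cont]) (auto intro!: continuous_intros)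
    ultimately have "(\<integral>t. indicator {-b..b} t *\<^sub>R time_deriv F (t, x) \<partial>lborel) = F (b, x) - F (-b, x)"
      using M by (intro integral_FTC_atLeastAtMost)
        (auto simp: b_def intro: has_vector_derivative_at_within)
    moreover have "(\<lambda>t. indicator {-b..b} t *\<^sub>R time_deriv F (t, x)) = (\<lambda>t. time_deriv F (t, x))"
    proof
      fix t show "indicator {-b..b} t *\<^sub>R time_deriv F (t, x) = time_deriv F (t, x)"
        using off[OF out[of t]] by (cases "t \<in> {-b..b}") auto
    qed
    moreover have "F (b, x) = 0" "F (-b, x) = 0" using K(2) out by auto
    ultimately show ?thesis by simp
  qed
  have "integrable (lborel \<Otimes>\<^sub>M lborel) (\<lambda>(t, x). time_deriv F (t, x))"
    using int by (simp add: lborel_prod)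
  then have "(\<integral>x. (\<integral>t. time_deriv F (t, x) \<partial>lborel) \<partial>lborel) = integral\<^sup>L (lborel \<Otimes>\<^sub>M lborel) (\<lambda>(t, x). time_deriv F (t, x))"
    by (intro lborel_pair.integral_snd)
  then show ?thesis by (simp add: slice lborel_prod)
qed

lemma integral_time_deriv_lebesgue_on_eq_0:
  fixes F :: "real \<times> (real ^ 'n) \<Rightarrow> real"
  assumes sm: "smooth_on UNIV F" and K: "compact K" "K \<subseteq> \<Omega>" "\<And>z. z \<notin> K \<Longrightarrow> F z = 0" and \<Omega>: "open \<Omega>"
  shows "(\<integral>z. time_deriv F z \<partial>lebesgue_on \<Omega>) = 0"
proof -
  have cont: "continuous_on UNIV (time_deriv F)"
    unfolding time_deriv_def by (intro smooth_on_continuous smooth_on_frechet_derivative sm)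
  have off: "time_deriv F z = 0" if "z \<notin> K" for z
    unfolding time_deriv_def using frechet_derivative_zero_off[of K F z] K that by (simp add: compact_imp_closed)
  have "(\<lambda>z. indicator \<Omega> z *\<^sub>R time_deriv F z) = time_deriv F"
  proof
    fix z show "indicator \<Omega> z *\<^sub>R time_deriv F z = time_deriv F z"
      using off[of z] K(2) by (cases "z \<in> \<Omega>") auto
  qed
  then have "(\<integral>z. time_deriv F z \<partial>lebesgue_on \<Omega>) = (\<integral>z. time_deriv F z \<partial>lebesgue)"
    using \<Omega> by (subst integral_restrict_space) auto
  also have "\<dots> = (\<integral>z. time_deriv F z \<partial>lborel)"
    by (intro integral_completion) (use borel_measurable_continuous_onI[OF cont] in simp)
  also have "\<dots> = 0" by (rule integral_time_deriv_eq_0[OF sm K(1,3)])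
  finally show ?thesis .
qed

lemma frechet_derivative_compose_mult:
  fixes h :: "real \<Rightarrow> real"
  assumes "(f has_derivative f') (at z)" "(\<zeta> has_derivative \<zeta>') (at z)" "(h has_real_derivative d) (at (f z))"
  shows "frechet_derivative (\<lambda>z. h (f z) * \<zeta> z) (at z) = (\<lambda>v. h (f z) * \<zeta>' v + d * f' v * \<zeta> z)"
proof -
  have "((\<lambda>z. h (f z)) has_derivative (\<lambda>v. d * f' v)) (at z)"
    using has_derivative_compose[OF assms(1)] assms(3) by (simp add: has_field_derivative_def)
  from has_derivative_mult[OF this assms(2)]
  show ?thesis by (simp add: frechet_derivative_at[symmetric])
qed

text \<open>Here the integrand is fixed and the multipliers converge almost everywhere; in
  \<open>tendsto_integral_bounded_mult_zero\<close> the multipliers are merely bounded and the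
  integrands tend to 0 in L1. The limits in the nonlinear test reduce to these two.\<close>

lemma tendsto_integral_bounded_mult:
  fixes f :: "'a \<Rightarrow> real" and b :: "nat \<Rightarrow> 'a \<Rightarrow> real"
  assumes f: "integrable M f" and [measurable]: "\<And>k. b k \<in> borel_measurable M" "b' \<in> borel_measurable M"
    and C: "\<And>k x. \<bar>b k x\<bar> \<le> C" and lim: "AE x in M. (\<lambda>k. b k x) \<longlonglongrightarrow> b' x"
  shows "(\<lambda>k. \<integral>x. b k x * f x \<partial>M) \<longlonglongrightarrow> (\<integral>x. b' x * f x \<partial>M)"
proof (rule integral_dominated_convergence[where w = "\<lambda>x. C * \<bar>f x\<bar>"])
  have [measurable]: "f \<in> borel_measurable M" using f by simp
  show "(\<lambda>x. b' x * f x) \<in> borel_measurable M" "(\<lambda>x. b k x * f x) \<in> borel_measurable M" for k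
    by measurable
  show "AE x in M. (\<lambda>k. b k x * f x) \<longlonglongrightarrow> b' x * f x"
    using lim by eventually_elim (intro tendsto_intros)
  show "AE x in M. norm (b k x * f x) \<le> C * \<bar>f x\<bar>" for k
    using C by (intro AE_I2) (simp add: abs_mult mult_right_mono)
qed (use f in simp)

lemma integrable_bounded_mult:
  fixes f b :: "'a \<Rightarrow> real"
  assumes f: "integrable M f" and [measurable]: "b \<in> borel_measurable M" and C: "\<And>x. \<bar>b x\<bar> \<le> C"
  shows "integrable M (\<lambda>x. b x * f x)"
proof (rule Bochner_Integration.integrable_bound)
  have [measurable]: "f \<in> borel_measurable M" using f by simp
  show "(\<lambda>x. b x * f x) \<in> borel_measurable M" by measurable
  have "\<bar>C\<bar> = C" using C[of undefined] by linarith
  then show "AE x in M. norm (b x * f x) \<le> norm (C * f x)"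
    using C by (intro AE_I2) (simp add: abs_mult mult_right_mono)
qed (use f in simp)

lemma tendsto_integral_bounded_mult_zero:
  fixes f b :: "nat \<Rightarrow> 'a \<Rightarrow> real"
  assumes f: "\<And>k. integrable M (f k)" and meas: "\<And>k. b k \<in> borel_measurable M" and C: "\<And>k x. \<bar>b k x\<bar> \<le> C"
    and lim: "(\<lambda>k. \<integral>x. \<bar>f k x\<bar> \<partial>M) \<longlonglongrightarrow> 0"
  shows "(\<lambda>k. \<integral>x. b k x * f k x \<partial>M) \<longlonglongrightarrow> 0"
proof (rule Lim_null_comparison)
  have "(\<lambda>k. C * (\<integral>x. \<bar>f k x\<bar> \<partial>M)) \<longlonglongrightarrow> C * 0" by (intro tendsto_intros lim)
  then show "(\<lambda>k. C * (\<integral>x. \<bar>f k x\<bar> \<partial>M)) \<longlonglongrightarrow> 0" by simp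
  have "norm (\<integral>x. b k x * f k x \<partial>M) \<le> C * (\<integral>x. \<bar>f k x\<bar> \<partial>M)" for k
  proof -
    have "norm (\<integral>x. b k x * f k x \<partial>M) \<le> (\<integral>x. \<bar>b k x * f k x\<bar> \<partial>M)"
      using integral_norm_bound[of M "\<lambda>x. b k x * f k x"] by simp
    also have "\<dots> \<le> (\<integral>x. C * \<bar>f k x\<bar> \<partial>M)"
      using C f by (intro integral_mono integrable_abs integrable_bounded_mult[OF f meas C])
        (auto simp: abs_mult intro: mult_right_mono)
    finally show ?thesis using f by simp
  qed
  then show "\<forall>\<^sub>F k in sequentially. norm (\<integral>x. b k x * f k x \<partial>M) \<le> C * (\<integral>x. \<bar>f k x\<bar> \<partial>M)" by simp
qed

section \<open>Testing with functions of the approximants\<close>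

context degenerate_form
begin

text \<open>Convergence in L1 yields a subsequence converging almost everywhere, as needed to pass
  to the limit inside continuous functions; the other convergences survive on it.\<close>

lemma energy_limit_AE:
  assumes lim: "energy_limit a \<Omega> ws w p g"
  obtains ws' where "energy_limit a \<Omega> ws' w p g" "AE z in lebesgue_on \<Omega>. (\<lambda>k. ws' k z) \<longlonglongrightarrow> w z"
proof -
  have "\<exists>r::nat\<Rightarrow>nat. strict_mono r \<and> (AE z in lebesgue_on \<Omega>. (\<lambda>n. ws (r n) z - w z) \<longlonglongrightarrow> 0)"
    using lim by (intro tendsto_L1_AE_subseq) (auto simp: energy_limit_def)
  then obtain r :: "nat \<Rightarrow> nat" where r: "strict_mono r" "AE z in lebesgue_on \<Omega>. (\<lambda>n. ws (r n) z - w z) \<longlonglongrightarrow> 0"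
    by blast
  have "AE z in lebesgue_on \<Omega>. (\<lambda>n. ws (r n) z) \<longlonglongrightarrow> w z"
    using r(2) by eventually_elim (simp add: LIM_zero_cancel)
  moreover have "energy_limit a \<Omega> (\<lambda>k. ws (r k)) w p g"
  proof -
    have "(\<lambda>k. \<integral>z. \<bar>ws k z - w z\<bar> \<partial>lebesgue_on \<Omega>) \<longlonglongrightarrow> 0"
      "(\<lambda>k. \<integral>z. \<bar>time_deriv (ws k) z - p z\<bar> \<partial>lebesgue_on \<Omega>) \<longlonglongrightarrow> 0"
      "(\<lambda>k. \<integral>z. coeff_form a z (space_grad (ws k) z - g z) (space_grad (ws k) z - g z) \<partial>lebesgue_on \<Omega>) \<longlonglongrightarrow> 0"
      using lim by (simp_all add: energy_limit_def)
    from this[THEN LIMSEQ_subseq_LIMSEQ, OF r(1), unfolded o_def] show ?thesis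
      using lim by (simp add: energy_limit_def)
  qed
  ultimately show thesis by (rule that[rotated])
qed

text \<open>A test function built from an approximant pairs the approximant's own gradient with
  \<open>g\<close>. The error of replacing that gradient by \<open>g\<close> vanishes in L1, hence
  also after multiplication by uniformly bounded factors.\<close>

lemma energy_limit_cross_term:
  assumes lim: "energy_limit a \<Omega> ws w p g"
  shows "integrable (lebesgue_on \<Omega>) (\<lambda>z. coeff_form a z (space_grad (ws k) z - g z) (g z))"
    and "(\<lambda>k. \<integral>z. \<bar>coeff_form a z (space_grad (ws k) z - g z) (g z)\<bar> \<partial>lebesgue_on \<Omega>) \<longlonglongrightarrow> 0"
proof -
  let ?M = "lebesgue_on \<Omega>"
  note meas [measurable] = energy_limit_measurable[OF lim]
  define E where "E k z = coeff_form a z (space_grad (ws k) z - g z) (space_grad (ws k) z - g z)" for k z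
  define G where "G z = coeff_form a z (g z) (g z)" for z
  define X where "X k z = coeff_form a z (space_grad (ws k) z - g z) (g z)" for k z
  have iG: "integrable ?M G" using lim by (simp add: energy_limit_def G_def[abs_def])
  have iE: "integrable ?M (E k)" for k
    using lim unfolding E_def[abs_def] by (intro integrable_coeff_form_diff) (auto simp: energy_limit_def)
  have iX: "integrable ?M (X k)" for k
    unfolding X_def[abs_def]
  proof (rule integrable_coeff_form[where f = "\<lambda>z. space_grad (ws k) z - g z" and g = g])
    show "(\<lambda>z. space_grad (ws k) z - g z) \<in> borel_measurable ?M" by measurable
  qed (use iE[of k] iG in \<open>simp_all add: E_def[abs_def] G_def[abs_def] meas\<close>)
  then show "integrable ?M (\<lambda>z. coeff_form a z (space_grad (ws k) z - g z) (g z))"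
    by (simp add: X_def[abs_def])
  have E0: "0 \<le> integral\<^sup>L ?M (E k)" for k
    unfolding E_def[abs_def] by (rule integral_nonneg_AE, rule eventually_mono[OF coeff_nonneg]) blast
  have limE: "(\<lambda>k. integral\<^sup>L ?M (E k)) \<longlonglongrightarrow> 0"
    using lim by (simp add: energy_limit_def E_def[abs_def])
  \<comment> \<open>Young's inequality with weight \<open>1 / s k\<close> replaces the integral Cauchy-Schwarz inequality; the summand
    \<open>1 / Suc k\<close> only keeps \<open>s k\<close> positive.\<close>
  define s where "s k = sqrt (integral\<^sup>L ?M (E k) + 1 / real (Suc k))" for k
  have s: "s k > 0" "integral\<^sup>L ?M (E k) \<le> s k * s k" for k
    using E0[of k] by (auto simp: s_def add_nonneg_pos)
  have "(\<lambda>k. sqrt (integral\<^sup>L ?M (E k) + 1 / real (Suc k))) \<longlonglongrightarrow> sqrt (0 + 0)"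
    by (intro tendsto_intros limE LIMSEQ_Suc[OF lim_1_over_n])
  then have s0: "s \<longlonglongrightarrow> 0" by (simp add: s_def[abs_def])
  show "(\<lambda>k. \<integral>z. \<bar>coeff_form a z (space_grad (ws k) z - g z) (g z)\<bar> \<partial>?M) \<longlonglongrightarrow> 0"
  proof (rule tendsto_sandwich[OF _ _ tendsto_const])
    have "(\<lambda>k. s k * (1 + integral\<^sup>L ?M G) / 2) \<longlonglongrightarrow> 0 * (1 + integral\<^sup>L ?M G) / 2"
      by (intro tendsto_intros s0) auto
    then show "(\<lambda>k. s k * (1 + integral\<^sup>L ?M G) / 2) \<longlonglongrightarrow> 0" by simp
    have "(\<integral>z. \<bar>X k z\<bar> \<partial>?M) \<le> s k * (1 + integral\<^sup>L ?M G) / 2" for k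
    proof -
      have "(\<integral>z. \<bar>X k z\<bar> \<partial>?M) \<le> (\<integral>z. (1 / s k * E k z + s k * G z) / 2 \<partial>?M)"
      proof (rule integral_mono_AE)
        show "AE z in ?M. \<bar>X k z\<bar> \<le> (1 / s k * E k z + s k * G z) / 2"
          using coeff_symmetric coeff_nonneg
        proof eventually_elim
          case (elim z)
          then have "2 * \<bar>X k z\<bar> \<le> (1 / s k) * E k z + G z / (1 / s k)"
            unfolding X_def E_def G_def using s(1)[of k] by (intro coeff_form_Young) auto
          then show ?case by (simp add: mult.commute)
        qed
      qed (use iX iE iG in auto)
      also have "\<dots> = (integral\<^sup>L ?M (E k) / s k + s k * integral\<^sup>L ?M G) / 2"
        using iE iG by simp
      also have "\<dots> \<le> s k * (1 + integral\<^sup>L ?M G) / 2"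
        using s(1)[of k] s(2)[of k] by (simp add: algebra_simps divide_le_eq)
      finally show ?thesis .
    qed
    then show "\<forall>\<^sub>F k in sequentially. (\<integral>z. \<bar>coeff_form a z (space_grad (ws k) z - g z) (g z)\<bar> \<partial>?M) \<le> s k * (1 + integral\<^sup>L ?M G) / 2"
      by (simp add: X_def)
  qed simp
qed

end

context degenerate_form
begin

text \<open>The inequality is tested with \<open>h (us k z) * \<zeta> z\<close> for approximants
  \<open>us k\<close>, and the limit is taken term by term. The delicate term is the one in time: p
  is only an L1 limit of time derivatives, so the chain rule for H(w) is reached in integrated form,
  through the approximants. Non-negativity of \<open>h\<close> and \<open>\<zeta>\<close> makes the
  test functions admissible.\<close>

lemma nonlinear_test:
  fixes h h' H :: "real \<Rightarrow> real"
  assumes lim: "energy_limit a \<Omega> ws w p g"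
    and half: "\<Omega> \<subseteq> half_space"
    and smh: "smooth_on UNIV h" and dh: "\<And>s. (h has_real_derivative h' s) (at s)"
    and hb: "\<And>s. 0 \<le> h s" "\<And>s. h s \<le> B" "\<And>s. \<bar>h' s\<bar> \<le> B"
    and dH: "\<And>s. (H has_real_derivative h s) (at s)"
    and sm\<zeta>: "smooth_on UNIV \<zeta>" and \<zeta>0: "\<And>z. 0 \<le> \<zeta> z"
    and K: "compact K" "K \<subseteq> \<Omega>" "\<And>z. z \<notin> K \<Longrightarrow> \<zeta> z = 0"
    and \<zeta>form: "integrable (lebesgue_on \<Omega>) (\<lambda>z. coeff_form a z (space_grad \<zeta> z) (space_grad \<zeta> z))"
    and F: "integrable (lebesgue_on \<Omega>) F"
    and weak: "\<And>\<phi>. test_function \<phi> \<Longrightarrow> (\<And>z. z \<notin> K \<Longrightarrow> \<phi> z = 0) \<Longrightarrow>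
      0 \<le> (\<integral>z. p z * \<phi> z + coeff_form a z (space_grad \<phi> z) (g z) - F z * \<phi> z \<partial>lebesgue_on \<Omega>)"
  shows "integrable (lebesgue_on \<Omega>) (\<lambda>z. H (w z) * time_deriv \<zeta> z)"
    and "integrable (lebesgue_on \<Omega>) (\<lambda>z. h (w z) * coeff_form a z (space_grad \<zeta> z) (g z))"
    and "integrable (lebesgue_on \<Omega>) (\<lambda>z. h' (w z) * \<zeta> z * coeff_form a z (g z) (g z))"
    and "integrable (lebesgue_on \<Omega>) (\<lambda>z. h (w z) * \<zeta> z * F z)"
    and "(\<integral>z. h (w z) * \<zeta> z * F z \<partial>lebesgue_on \<Omega>) \<le>
       - (\<integral>z. H (w z) * time_deriv \<zeta> z \<partial>lebesgue_on \<Omega>)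
       + (\<integral>z. h (w z) * coeff_form a z (space_grad \<zeta> z) (g z) \<partial>lebesgue_on \<Omega>)
       + (\<integral>z. h' (w z) * \<zeta> z * coeff_form a z (g z) (g z) \<partial>lebesgue_on \<Omega>)"
proof -
  let ?M = "lebesgue_on \<Omega>"
  obtain us where lim': "energy_limit a \<Omega> us w p g" and ae: "AE z in ?M. (\<lambda>k. us k z) \<longlonglongrightarrow> w z"
    by (rule energy_limit_AE[OF lim])
  note [measurable] = energy_limit_measurable[OF lim']
  have int: "integrable ?M w" "integrable ?M p" "integrable ?M (\<lambda>z. coeff_form a z (g z) (g z))"
    "\<And>k. integrable ?M (us k)" "\<And>k. integrable ?M (time_deriv (us k))"
    and smu: "\<And>k. smooth_on \<Omega> (us k)"
    and lim1: "(\<lambda>k. \<integral>z. \<bar>us k z - w z\<bar> \<partial>?M) \<longlonglongrightarrow> 0"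
    and lim2: "(\<lambda>k. \<integral>z. \<bar>time_deriv (us k) z - p z\<bar> \<partial>?M) \<longlonglongrightarrow> 0"
    using lim' by (simp_all add: energy_limit_def)
  have B0: "0 \<le> B" using hb(1,2)[of 0] by linarith
  have ch: "continuous_on UNIV h" "continuous_on UNIV H"
    using DERIV_isCont[OF dh] DERIV_isCont[OF dH] by (auto intro!: continuous_at_imp_continuous_on)
  have fdh: "frechet_derivative h (at s) 1 = h' s" for s
    using dh[of s] by (simp add: has_field_derivative_def frechet_derivative_at[symmetric])
  have ch': "continuous_on UNIV h'"
    using smooth_on_continuous[OF smooth_on_frechet_derivative[OF smh, of 1]] by (simp add: fdh)
  have [measurable]: "h \<in> borel_measurable borel" "h' \<in> borel_measurable borel" "H \<in> borel_measurable borel"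
    using ch ch' by (auto intro: borel_measurable_continuous_onI)
  have smH: "smooth_on UNIV H"
    unfolding smooth_on_def
  proof
    fix k show "Ck_on k UNIV H"
    proof (cases k)
      case (Suc m)
      show ?thesis unfolding Suc
      proof (rule Ck_on_SucI)
        show "(H has_derivative (\<lambda>v. h x * v)) (at x)" for x
          using dH[of x] by (simp add: has_field_derivative_def)
        show "Ck_on m UNIV (\<lambda>x. h x * v)" for v
          using smh by (intro Ck_on_mult Ck_on_const) (auto simp: smooth_on_def)
      qed simp
    qed (use ch in simp)
  qed
  have sm\<zeta>\<Omega>: "smooth_on \<Omega> \<zeta>" using smooth_on_subset[OF sm\<zeta>] by simp
  have [measurable]: "\<zeta> \<in> borel_measurable ?M" "time_deriv \<zeta> \<in> borel_measurable ?M" "space_grad \<zeta> \<in> borel_measurable ?M"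
    using open_domain sm\<zeta>\<Omega>
    by (auto intro: smooth_on_borel_measurable time_deriv_borel_measurable space_grad_borel_measurable)
  have clK: "closed K" using K(1) by (rule compact_imp_closed)
  obtain C1 where C1: "C1 > 0" "\<And>z. \<bar>\<zeta> z\<bar> \<le> C1"
    using compactly_supported_bounded[OF smooth_on_continuous[OF sm\<zeta>] K(1,3)] by metis
  have "time_deriv \<zeta> z = 0" if "z \<notin> K" for z
    unfolding time_deriv_def using frechet_derivative_zero_off[OF clK, of \<zeta> z] K(3) that by simp
  then obtain C2 where C2: "C2 > 0" "\<And>z. \<bar>time_deriv \<zeta> z\<bar> \<le> C2"
    using compactly_supported_bounded[OF _ K(1), of "time_deriv \<zeta>"]
      smooth_on_continuous[OF smooth_on_frechet_derivative[OF sm\<zeta>, of "(1,0)"]]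
    unfolding time_deriv_def by metis
  have b1: "\<bar>h s * \<zeta> z\<bar> \<le> B * C1" for s z
    unfolding abs_mult using hb[of s] C1 B0 by (intro mult_mono) auto
  have b2: "\<bar>h' s * \<zeta> z\<bar> \<le> B * C1" for s z
    unfolding abs_mult using hb[of s] C1 B0 by (intro mult_mono) auto
  have b3: "\<bar>h s\<bar> \<le> B" for s using hb[of s] by auto
  have Hlip: "\<bar>H s - H r\<bar> \<le> B * \<bar>s - r\<bar>" for s r
    using field_differentiable_bound[of UNIV H h B s r] dH b3
    by (auto simp: has_field_derivative_at_within)
  have der: "(us k has_derivative frechet_derivative (us k) (at z)) (at z)"
     "(\<zeta> has_derivative frechet_derivative \<zeta> (at z)) (at z)" if "z \<in> \<Omega>" for k z
    using smooth_on_has_derivative[OF smu that] smooth_on_has_derivative[OF sm\<zeta>\<Omega> that] by auto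
  have lin: "(\<lambda>k. f (us k z)) \<longlonglongrightarrow> f (w z)" if "continuous_on UNIV f" "(\<lambda>k. us k z) \<longlonglongrightarrow> w z" for f :: "real \<Rightarrow> real" and z
    using that by (auto intro: isCont_tendsto_compose simp: continuous_on_eq_continuous_at)
  have mult_form: "coeff_form a z (r *\<^sub>R x + s *\<^sub>R y) v = r * coeff_form a z x v + s * coeff_form a z y v" for z r s x y v
    by (simp add: coeff_form_add_left coeff_form_scaleR_left)

  \<comment> \<open>\<open>T\<close>, \<open>X\<close>, \<open>Y\<close> and \<open>R\<close> are
    the time, cutoff-gradient, energy and source terms of the tested inequality; \<open>Z\<close> is
    the error from splitting \<open>space_grad (us k)\<close> into \<open>g\<close> and a
    remainder.\<close>
  define T where "T k = (\<integral>z. h (us k z) * \<zeta> z * p z \<partial>?M)" for k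
  define X where "X k = (\<integral>z. h (us k z) * coeff_form a z (space_grad \<zeta> z) (g z) \<partial>?M)" for k
  define Y where "Y k = (\<integral>z. h' (us k z) * \<zeta> z * coeff_form a z (g z) (g z) \<partial>?M)" for k
  define Z where "Z k = (\<integral>z. h' (us k z) * \<zeta> z * coeff_form a z (space_grad (us k) z - g z) (g z) \<partial>?M)" for k
  define R where "R k = (\<integral>z. h (us k z) * \<zeta> z * F z \<partial>?M)" for k
  have i\<zeta>g: "integrable ?M (\<lambda>z. coeff_form a z (space_grad \<zeta> z) (g z))"
    by (rule integrable_coeff_form[OF _ _ \<zeta>form int(3)]) measurable
  have Tlim: "T \<longlonglongrightarrow> (\<integral>z. h (w z) * \<zeta> z * p z \<partial>?M)"
    unfolding T_def[abs_def]
  proof (rule tendsto_integral_bounded_mult[OF int(2) _ _ b1])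
    show "AE z in ?M. (\<lambda>k. h (us k z) * \<zeta> z) \<longlonglongrightarrow> h (w z) * \<zeta> z"
      using ae by eventually_elim (rule tendsto_mult[OF lin[OF ch(1)] tendsto_const])
  qed measurable
  have Rlim: "R \<longlonglongrightarrow> (\<integral>z. h (w z) * \<zeta> z * F z \<partial>?M)"
    unfolding R_def[abs_def]
  proof (rule tendsto_integral_bounded_mult[OF F _ _ b1])
    show "AE z in ?M. (\<lambda>k. h (us k z) * \<zeta> z) \<longlonglongrightarrow> h (w z) * \<zeta> z"
      using ae by eventually_elim (rule tendsto_mult[OF lin[OF ch(1)] tendsto_const])
  qed measurable
  have Ylim: "Y \<longlonglongrightarrow> (\<integral>z. h' (w z) * \<zeta> z * coeff_form a z (g z) (g z) \<partial>?M)"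
    unfolding Y_def[abs_def]
  proof (rule tendsto_integral_bounded_mult[OF int(3) _ _ b2])
    show "AE z in ?M. (\<lambda>k. h' (us k z) * \<zeta> z) \<longlonglongrightarrow> h' (w z) * \<zeta> z"
      using ae by eventually_elim (rule tendsto_mult[OF lin[OF ch'] tendsto_const])
  qed measurable
  have Xlim: "X \<longlonglongrightarrow> (\<integral>z. h (w z) * coeff_form a z (space_grad \<zeta> z) (g z) \<partial>?M)"
    unfolding X_def[abs_def]
  proof (rule tendsto_integral_bounded_mult[OF i\<zeta>g _ _ b3])
    show "AE z in ?M. (\<lambda>k. h (us k z)) \<longlonglongrightarrow> h (w z)"
      using ae by eventually_elim (rule lin[OF ch(1)])
  qed measurable
  have Zlim: "Z \<longlonglongrightarrow> 0"
    unfolding Z_def[abs_def]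
    by (rule tendsto_integral_bounded_mult_zero[OF energy_limit_cross_term(1)[OF lim'] _ b2
          energy_limit_cross_term(2)[OF lim']]) measurable

  have pos: "0 \<le> T k + X k + Y k + Z k - R k" for k
  proof -
    \<comment> \<open>Outside \<open>\<Omega>\<close> nothing is known of \<open>us k\<close>, so
      the product is extended by zero.\<close>
    define \<phi> where "\<phi> z = (if z \<in> \<Omega> then h (us k z) * \<zeta> z else 0)" for z
    have off: "\<phi> z = 0" if "z \<notin> K" for z using K(3)[OF that] by (simp add: \<phi>_def)
    have "smooth_on \<Omega> (\<lambda>z. h (us k z))"
      using smu smh by (rule smooth_on_compose[OF open_domain open_UNIV, rotated]) simp
    then have "smooth_on UNIV \<phi>"
      unfolding \<phi>_def[abs_def] using K(3)
      by (intro smooth_on_extend_zero[OF open_domain K(1,2)] smooth_on_mult open_domain sm\<zeta>\<Omega>) auto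
    then have "smooth_on half_space \<phi>" by (rule smooth_on_subset) simp
    moreover have sub: "{z \<in> half_space. \<phi> z \<noteq> 0} \<subseteq> K" using off by auto
    then have "closure {z \<in> half_space. \<phi> z \<noteq> 0} \<subseteq> K" by (intro closure_minimal clK)
    then have "closure {z \<in> half_space. \<phi> z \<noteq> 0} \<subseteq> half_space" using K(2) half by auto
    moreover have "compact (closure {z \<in> half_space. \<phi> z \<noteq> 0})"
      using bounded_subset[OF compact_imp_bounded[OF K(1)] sub] by simp
    ultimately have "test_function \<phi>"
      unfolding test_function_def by (auto simp: \<phi>_def hb \<zeta>0)
    from weak[OF this off]
    have "0 \<le> (\<integral>z. p z * \<phi> z + coeff_form a z (space_grad \<phi> z) (g z) - F z * \<phi> z \<partial>?M)" .
    also have "\<dots> = (\<integral>z. h (us k z) * \<zeta> z * p z + h (us k z) * coeff_form a z (space_grad \<zeta> z) (g z)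
       + h' (us k z) * \<zeta> z * coeff_form a z (g z) (g z) + h' (us k z) * \<zeta> z * coeff_form a z (space_grad (us k) z - g z) (g z)
       - h (us k z) * \<zeta> z * F z \<partial>?M)"
    proof (rule Bochner_Integration.integral_cong[OF refl])
      fix z assume "z \<in> space ?M"
      then have z: "z \<in> \<Omega>" by simp
      have "frechet_derivative \<phi> (at z) = frechet_derivative (\<lambda>z. h (us k z) * \<zeta> z) (at z)"
        by (rule frechet_derivative_cong_open[OF open_domain z]) (simp add: \<phi>_def)
      also have "\<dots> = (\<lambda>v. h (us k z) * frechet_derivative \<zeta> (at z) v + h' (us k z) * frechet_derivative (us k) (at z) v * \<zeta> z)"
        by (rule frechet_derivative_compose_mult[OF der[OF z] dh])
      finally have "space_grad \<phi> z = h (us k z) *\<^sub>R space_grad \<zeta> z + (h' (us k z) * \<zeta> z) *\<^sub>R space_grad (us k) z"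
        unfolding space_grad_def by (simp add: vec_eq_iff)
      then show "p z * \<phi> z + coeff_form a z (space_grad \<phi> z) (g z) - F z * \<phi> z =
         h (us k z) * \<zeta> z * p z + h (us k z) * coeff_form a z (space_grad \<zeta> z) (g z)
       + h' (us k z) * \<zeta> z * coeff_form a z (g z) (g z) + h' (us k z) * \<zeta> z * coeff_form a z (space_grad (us k) z - g z) (g z)
       - h (us k z) * \<zeta> z * F z"
        using z by (simp add: mult_form \<phi>_def coeff_form_diff_left algebra_simps)
    qed
    also have "\<dots> = T k + X k + Y k + Z k - R k"
    proof -
      have "integrable ?M (\<lambda>z. h (us k z) * \<zeta> z * p z)"
        by (rule integrable_bounded_mult[OF int(2) _ b1]) measurable
      moreover have "integrable ?M (\<lambda>z. h (us k z) * coeff_form a z (space_grad \<zeta> z) (g z))"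
        by (rule integrable_bounded_mult[OF i\<zeta>g _ b3]) measurable
      moreover have "integrable ?M (\<lambda>z. h' (us k z) * \<zeta> z * coeff_form a z (g z) (g z))"
        by (rule integrable_bounded_mult[OF int(3) _ b2]) measurable
      moreover have "integrable ?M (\<lambda>z. h' (us k z) * \<zeta> z * coeff_form a z (space_grad (us k) z - g z) (g z))"
        by (rule integrable_bounded_mult[OF energy_limit_cross_term(1)[OF lim'] _ b2]) measurable
      moreover have "integrable ?M (\<lambda>z. h (us k z) * \<zeta> z * F z)"
        by (rule integrable_bounded_mult[OF F _ b1]) measurable
      ultimately show ?thesis unfolding T_def X_def Y_def Z_def R_def by simp
    qed
    finally show ?thesis .
  qed

  have iH: "integrable ?M (\<lambda>z. H (f z))" if "integrable ?M f" for f
  proof (rule Bochner_Integration.integrable_bound)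
    interpret finite_measure ?M by (rule finite_measure_domain)
    have [measurable]: "f \<in> borel_measurable ?M" using that by simp
    show "(\<lambda>z. H (f z)) \<in> borel_measurable ?M" by measurable
    show "integrable ?M (\<lambda>z. \<bar>H 0\<bar> + B * \<bar>f z\<bar>)" using that by simp
    have "\<bar>H s\<bar> \<le> \<bar>H 0\<bar> + B * \<bar>s\<bar>" for s using Hlip[of s 0] by simp
    then show "AE z in ?M. norm (H (f z)) \<le> norm (\<bar>H 0\<bar> + B * \<bar>f z\<bar>)" by (intro AE_I2) (simp add: B0)
  qed
  have iH\<zeta>: "integrable ?M (\<lambda>z. time_deriv \<zeta> z * H (f z))" if "integrable ?M f" for f
    by (rule integrable_bounded_mult[OF iH[OF that] _ C2(2)]) measurable
  \<comment> \<open>For the smooth approximant the classical chain rule holds, and the time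
    derivative of H(us k) times the cutoff integrates to 0.\<close>
  have parts: "(\<integral>z. h (us k z) * \<zeta> z * time_deriv (us k) z \<partial>?M) = - (\<integral>z. time_deriv \<zeta> z * H (us k z) \<partial>?M)" for k
  proof -
    define G where "G z = (if z \<in> \<Omega> then H (us k z) * \<zeta> z else 0)" for z
    have "smooth_on \<Omega> (\<lambda>z. H (us k z))"
      using smu smH by (rule smooth_on_compose[OF open_domain open_UNIV, rotated]) simp
    then have "smooth_on UNIV G"
      unfolding G_def[abs_def] using K(3)
      by (intro smooth_on_extend_zero[OF open_domain K(1,2)] smooth_on_mult open_domain sm\<zeta>\<Omega>) auto
    then have "(\<integral>z. time_deriv G z \<partial>?M) = 0"
      by (rule integral_time_deriv_lebesgue_on_eq_0[OF _ K(1,2) _ open_domain]) (simp add: G_def K(3))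
    also have "(\<integral>z. time_deriv G z \<partial>?M) = (\<integral>z. h (us k z) * \<zeta> z * time_deriv (us k) z + time_deriv \<zeta> z * H (us k z) \<partial>?M)"
    proof (rule Bochner_Integration.integral_cong[OF refl])
      fix z assume "z \<in> space ?M"
      then have z: "z \<in> \<Omega>" by simp
      have "frechet_derivative G (at z) = frechet_derivative (\<lambda>z. H (us k z) * \<zeta> z) (at z)"
        by (rule frechet_derivative_cong_open[OF open_domain z]) (simp add: G_def)
      also have "\<dots> = (\<lambda>v. H (us k z) * frechet_derivative \<zeta> (at z) v + h (us k z) * frechet_derivative (us k) (at z) v * \<zeta> z)"
        by (rule frechet_derivative_compose_mult[OF der[OF z] dH])
      finally show "time_deriv G z = h (us k z) * \<zeta> z * time_deriv (us k) z + time_deriv \<zeta> z * H (us k z)"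
        unfolding time_deriv_def by simp
    qed
    also have "\<dots> = (\<integral>z. h (us k z) * \<zeta> z * time_deriv (us k) z \<partial>?M) + (\<integral>z. time_deriv \<zeta> z * H (us k z) \<partial>?M)"
    proof (rule Bochner_Integration.integral_add)
      show "integrable ?M (\<lambda>z. h (us k z) * \<zeta> z * time_deriv (us k) z)"
        by (rule integrable_bounded_mult[OF int(5) _ b1]) measurable
    qed (rule iH\<zeta>[OF int(4)])
    finally show ?thesis by simp
  qed
  have Plim: "(\<lambda>k. \<integral>z. h (us k z) * \<zeta> z * time_deriv (us k) z \<partial>?M) \<longlonglongrightarrow> (\<integral>z. h (w z) * \<zeta> z * p z \<partial>?M)"
  proof -
    have "(\<lambda>k. \<integral>z. h (us k z) * \<zeta> z * (time_deriv (us k) z - p z) \<partial>?M) \<longlonglongrightarrow> 0"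
      by (rule tendsto_integral_bounded_mult_zero[OF _ _ b1 lim2]) (use int in \<open>auto, measurable\<close>)
    from tendsto_add[OF this Tlim]
    have "(\<lambda>k. (\<integral>z. h (us k z) * \<zeta> z * (time_deriv (us k) z - p z) \<partial>?M) + T k) \<longlonglongrightarrow> (\<integral>z. h (w z) * \<zeta> z * p z \<partial>?M)"
      by simp
    moreover have "(\<integral>z. h (us k z) * \<zeta> z * (time_deriv (us k) z - p z) \<partial>?M) + T k = (\<integral>z. h (us k z) * \<zeta> z * time_deriv (us k) z \<partial>?M)" for k
    proof -
      have "integrable ?M (\<lambda>z. h (us k z) * \<zeta> z * p z)"
        by (rule integrable_bounded_mult[OF int(2) _ b1]) measurable
      moreover have "integrable ?M (\<lambda>z. h (us k z) * \<zeta> z * time_deriv (us k) z)"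
        by (rule integrable_bounded_mult[OF int(5) _ b1]) measurable
      ultimately show ?thesis unfolding T_def by (simp add: right_diff_distrib)
    qed
    ultimately show ?thesis by simp
  qed
  \<comment> \<open>\<open>H\<close> is Lipschitz with constant \<open>B\<close>, so L1 convergence
    of the approximants suffices.\<close>
  have Hlim: "(\<lambda>k. \<integral>z. time_deriv \<zeta> z * H (us k z) \<partial>?M) \<longlonglongrightarrow> (\<integral>z. time_deriv \<zeta> z * H (w z) \<partial>?M)"
  proof -
    have "(\<lambda>k. \<integral>z. \<bar>H (us k z) - H (w z)\<bar> \<partial>?M) \<longlonglongrightarrow> 0"
    proof (rule tendsto_sandwich[OF _ _ tendsto_const])
      have "(\<lambda>k. B * (\<integral>z. \<bar>us k z - w z\<bar> \<partial>?M)) \<longlonglongrightarrow> B * 0" by (intro tendsto_intros lim1)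
      then show "(\<lambda>k. B * (\<integral>z. \<bar>us k z - w z\<bar> \<partial>?M)) \<longlonglongrightarrow> 0" by simp
      have "(\<integral>z. \<bar>H (us k z) - H (w z)\<bar> \<partial>?M) \<le> (\<integral>z. B * \<bar>us k z - w z\<bar> \<partial>?M)" for k
        using iH[OF int(4)] iH[OF int(1)] int by (intro integral_mono Hlip) auto
      then show "\<forall>\<^sub>F k in sequentially. (\<integral>z. \<bar>H (us k z) - H (w z)\<bar> \<partial>?M) \<le> B * (\<integral>z. \<bar>us k z - w z\<bar> \<partial>?M)"
        by simp
    qed simp
    then have "(\<lambda>k. \<integral>z. time_deriv \<zeta> z * (H (us k z) - H (w z)) \<partial>?M) \<longlonglongrightarrow> 0"
      by (rule tendsto_integral_bounded_mult_zero[OF _ _ C2(2), rotated 2])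
         (use iH[OF int(4)] iH[OF int(1)] in auto)
    moreover have "(\<integral>z. time_deriv \<zeta> z * (H (us k z) - H (w z)) \<partial>?M) =
        (\<integral>z. time_deriv \<zeta> z * H (us k z) \<partial>?M) - (\<integral>z. time_deriv \<zeta> z * H (w z) \<partial>?M)" for k
      using iH\<zeta>[OF int(4)] iH\<zeta>[OF int(1)] by (simp add: right_diff_distrib)
    ultimately show ?thesis by (simp add: LIM_zero_iff)
  qed
  \<comment> \<open>Two limits of one sequence are equated; this is the weak chain rule in time for
    the non-smooth \<open>w\<close>.\<close>
  have eqT: "(\<integral>z. h (w z) * \<zeta> z * p z \<partial>?M) = - (\<integral>z. time_deriv \<zeta> z * H (w z) \<partial>?M)"
    using LIMSEQ_unique[OF Plim[unfolded parts] tendsto_minus[OF Hlim]] .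
  show "integrable ?M (\<lambda>z. H (w z) * time_deriv \<zeta> z)"
    using iH\<zeta>[OF int(1)] by (simp add: mult.commute)
  show "integrable ?M (\<lambda>z. h (w z) * coeff_form a z (space_grad \<zeta> z) (g z))"
    by (rule integrable_bounded_mult[OF i\<zeta>g _ b3]) measurable
  show "integrable ?M (\<lambda>z. h' (w z) * \<zeta> z * coeff_form a z (g z) (g z))"
    by (rule integrable_bounded_mult[OF int(3) _ b2]) measurable
  show "integrable ?M (\<lambda>z. h (w z) * \<zeta> z * F z)"
    by (rule integrable_bounded_mult[OF F _ b1]) measurable
  have "0 \<le> (\<integral>z. h (w z) * \<zeta> z * p z \<partial>?M) + (\<integral>z. h (w z) * coeff_form a z (space_grad \<zeta> z) (g z) \<partial>?M)
      + (\<integral>z. h' (w z) * \<zeta> z * coeff_form a z (g z) (g z) \<partial>?M) + 0 - (\<integral>z. h (w z) * \<zeta> z * F z \<partial>?M)"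
    by (rule LIMSEQ_le_const[OF tendsto_diff[OF tendsto_add[OF tendsto_add[OF tendsto_add[OF Tlim Xlim] Ylim] Zlim] Rlim]])
       (use pos in auto)
  then show "(\<integral>z. h (w z) * \<zeta> z * F z \<partial>?M) \<le>
       - (\<integral>z. H (w z) * time_deriv \<zeta> z \<partial>?M)
       + (\<integral>z. h (w z) * coeff_form a z (space_grad \<zeta> z) (g z) \<partial>?M)
       + (\<integral>z. h' (w z) * \<zeta> z * coeff_form a z (g z) (g z) \<partial>?M)"
    unfolding eqT by (simp add: mult.commute)
qed

end

section \<open>Elementary estimates\<close>

text \<open>Each power is split as its base times a (q - 1)-th power; the latter is at most that of
  \<open>x + y\<close>, which then factors out.\<close>

lemma powr_superadditive:
  fixes x y q :: real
  assumes "0 \<le> x" "0 \<le> y" "1 \<le> q"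
  shows "x powr q + y powr q \<le> (x + y) powr q"
proof -
  have split: "z powr q = z powr (q - 1) * z" if "0 \<le> z" for z
    using that powr_add[of z "q - 1" 1] by (cases "z = 0") auto
  have "x powr q + y powr q \<le> (x + y) powr (q - 1) * x + (x + y) powr (q - 1) * y"
    unfolding split[OF assms(1)] split[OF assms(2)]
    using assms by (intro add_mono mult_right_mono powr_mono2) auto
  also have "\<dots> = (x + y) powr q" using split[of "x + y"] assms by (simp add: distrib_left)
  finally show ?thesis .
qed

text \<open>For arguments of equal sign superadditivity gives the bound with constant 1; opposite
  signs cost the factor 2 powr (-q), through \<open>u - v \<le> 2 * max u (- v)\<close>.\<close>

lemma power_nonlinearity_diff_ge:
  fixes u v q :: real
  assumes "v \<le> u" "1 \<le> q"
  shows "2 powr (- q) * (u - v) powr q \<le> \<bar>u\<bar> powr (q - 1) * u - \<bar>v\<bar> powr (q - 1) * v"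
proof -
  have split: "z powr (q - 1) * z = z powr q" if "0 \<le> z" for z
    using that powr_add[of z "q - 1" 1] by (cases "z = 0") auto
  have one: "2 powr (- q) * (u - v) powr q \<le> 1 * (u - v) powr q"
    using assms powr_mono[of "- q" 0 2] by (intro mult_right_mono) auto
  show ?thesis
  proof (cases "0 \<le> v")
    case True
    have "v powr q + (u - v) powr q \<le> u powr q"
      using powr_superadditive[of v "u - v" q] True assms by simp
    then show ?thesis using one True assms split[of u] split[of v] by simp
  next
    case v: False
    show ?thesis
    proof (cases "u \<le> 0")
      case True
      have "(- u) powr q + (u - v) powr q \<le> (- v) powr q"
        using powr_superadditive[of "- u" "u - v" q] True assms by simp
      then show ?thesis using one True v assms split[of "- u"] split[of "- v"] by simp
    next
      case False
      have "(u - v) powr q \<le> (2 * max u (- v)) powr q"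
        using False v assms by (intro powr_mono2) auto
      also have "\<dots> = 2 powr q * max u (- v) powr q"
        by (rule powr_mult)
      also have "\<dots> \<le> 2 powr q * (u powr q + (- v) powr q)"
        by (intro mult_left_mono) (auto simp: max_def)
      finally have "2 powr (- q) * (u - v) powr q \<le> u powr q + (- v) powr q"
        by (simp add: powr_minus field_simps)
      then show ?thesis using False v split[of u] split[of "- v"] by simp
    qed
  qed
qed

text \<open>Let Y = 1 + w / \<delta>. Below the threshold, \<nu> \<le> 1 bounds the product of Y
  powr (1 + \<nu>) and the cutoff power by K squared. Above it, Y powr (1 + \<nu>) is Y powr q times
  Y powr (-\<mu>), and the last factor is at most K powr (-\<mu>) times \<eta> powr (\<beta> \<mu>),
  the latter at most \<eta> squared. These two powers of \<eta> lift 2 \<beta>, the exponent left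
  after differentiating the cutoff, back to the full 2 \<beta> + 2.\<close>

lemma multiplier_threshold:
  fixes \<delta> w \<eta> \<nu> \<mu> q K :: real and \<beta> :: nat
  assumes "0 < \<delta>" "0 \<le> w" "0 \<le> \<eta>" "\<eta> \<le> 1" "2 \<le> K" "0 < \<nu>" "\<nu> \<le> 1" "0 < \<mu>" "q = 1 + \<nu> + \<mu>" "2 \<le> real \<beta> * \<mu>"
  shows "\<delta> * (1 + w / \<delta>) powr (1 + \<nu>) * \<eta> ^ (2 * \<beta>)
     \<le> \<delta> * K\<^sup>2 + 2 powr q * \<delta> powr (1 - q) * K powr (- \<mu>) * (w powr q * \<eta> ^ (2 * \<beta> + 2))"
proof (cases "\<eta> = 0")
  case True
  have "\<beta> \<noteq> 0" using assms by (intro notI) simp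
  then show ?thesis using True assms by (simp add: power_0_left)
next
  case False
  then have \<eta>: "0 < \<eta>" using assms by simp
  define Y where "Y = 1 + w / \<delta>"
  have Y: "1 \<le> Y" using assms by (simp add: Y_def)
  have rhs: "0 \<le> 2 powr q * \<delta> powr (1 - q) * K powr (- \<mu>) * (w powr q * \<eta> ^ (2 * \<beta> + 2))"
    using \<eta> by simp
  show ?thesis
  proof (cases "Y * \<eta> ^ \<beta> \<le> K")
    case True
    have "Y powr (1 + \<nu>) \<le> Y powr 2" using Y assms by (intro powr_mono) auto
    then have "Y powr (1 + \<nu>) * \<eta> ^ (2 * \<beta>) \<le> Y powr 2 * \<eta> ^ (2 * \<beta>)"
      using \<eta> by (intro mult_right_mono) auto
    also have "\<dots> = (Y * \<eta> ^ \<beta>)\<^sup>2"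
      using Y by (simp add: powr_numeral power_mult_distrib power_mult[symmetric] mult.commute)
    also have "\<dots> \<le> K\<^sup>2" using True Y \<eta> by (intro power_mono) auto
    finally have "\<delta> * Y powr (1 + \<nu>) * \<eta> ^ (2 * \<beta>) \<le> \<delta> * K\<^sup>2"
      using assms(1) by (simp add: mult.assoc)
    then show ?thesis using rhs unfolding Y_def by linarith
  next
    case large: False
    have "\<eta> ^ \<beta> \<le> 1" using \<eta> assms by (simp add: power_le_one)
    then have "Y * \<eta> ^ \<beta> \<le> Y" using Y by (simp add: mult_left_le)
    \<comment> \<open>Here \<open>2 \<le> K\<close> pays off: it forces
      \<open>\<delta> \<le> w\<close>, so the 1 in \<open>Y\<close> is absorbed into w /
      \<delta>.\<close>
    then have "2 \<le> Y" using large assms by linarith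
    then have w: "\<delta> \<le> w" using assms unfolding Y_def by (simp add: field_simps)
    then have Yw: "Y \<le> 2 * w / \<delta>" using assms unfolding Y_def by (simp add: field_simps)
    have "K * \<eta> powr - real \<beta> \<le> Y"
      using large \<eta> by (simp add: powr_minus powr_realpow field_simps)
    then have "Y powr (- \<mu>) \<le> (K * \<eta> powr - real \<beta>) powr (- \<mu>)"
      using assms \<eta> by (intro powr_mono2') auto
    also have "\<dots> = K powr (- \<mu>) * \<eta> powr (real \<beta> * \<mu>)"
      by (simp add: powr_mult powr_powr)
    also have "\<dots> \<le> K powr (- \<mu>) * \<eta> powr 2"
      using assms \<eta> by (intro mult_left_mono powr_mono') auto
    finally have 1: "Y powr (- \<mu>) \<le> K powr (- \<mu>) * \<eta>\<^sup>2" using \<eta> by (simp add: powr_numeral)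
    have 2: "Y powr q \<le> (2 * w / \<delta>) powr q" using Yw Y assms by (intro powr_mono2) auto
    have "Y powr (1 + \<nu>) = Y powr q * Y powr (- \<mu>)" using assms(9) by (simp add: powr_add[symmetric])
    also have "\<dots> \<le> (2 * w / \<delta>) powr q * (K powr (- \<mu>) * \<eta>\<^sup>2)"
      using 1 2 by (intro mult_mono) auto
    finally have "\<delta> * Y powr (1 + \<nu>) * \<eta> ^ (2 * \<beta>) \<le> \<delta> * ((2 * w / \<delta>) powr q * (K powr (- \<mu>) * \<eta>\<^sup>2)) * \<eta> ^ (2 * \<beta>)"
      using assms(1) \<eta> by (intro mult_right_mono mult_left_mono) auto
    also have "\<dots> = (\<delta> * (2 * w / \<delta>) powr q) * (K powr (- \<mu>) * \<eta> ^ (2 * \<beta> + 2))"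
      by (simp add: power_add power2_eq_square)
    also have "\<delta> * (2 * w / \<delta>) powr q = 2 powr q * \<delta> powr (1 - q) * w powr q"
      using assms(1,2) by (simp add: powr_divide powr_mult powr_diff)
    finally show ?thesis using assms(1) unfolding Y_def
      by (simp add: mult_ac add_increasing)
  qed
qed

text \<open>The weight \<open>r\<close> in Young's inequality is chosen so that the \<open>G\<close>
  part equals \<open>k * \<eta> ^ s * G\<close> exactly; what is left carries the factor
  \<open>h\<^sup>2 / 4\<close>, at most 1 because \<open>h \<le> 2\<close>.\<close>

lemma absorb_cross_term:
  fixes x X G h k \<eta> S :: real and s :: nat
  assumes Young: "\<And>r. r > 0 \<Longrightarrow> 2 * \<bar>x\<bar> \<le> r * X + G / r"
    and "0 \<le> X" "1 \<le> h" "h \<le> 2" "0 < k" "0 \<le> \<eta>" "2 \<le> s"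
  shows "h * (real s * \<eta> ^ (s - 1) * x) - k * \<eta> ^ s * G \<le> (real s)\<^sup>2 / k * \<eta> ^ (s - 2) * X"
proof (cases "\<eta> = 0")
  case True
  then show ?thesis using assms by (auto simp: zero_power power_0_left)
next
  case False
  then have \<eta>: "0 < \<eta>" using assms by simp
  obtain m where m: "s = m + 2" using assms by (metis le_add_diff_inverse2)
  define S where "S = real s"
  have S: "S > 0" using assms by (simp add: S_def)
  define N where "N = \<eta> ^ m"
  have pows: "\<eta> ^ (s - 1) = N * \<eta>" "\<eta> ^ s = N * \<eta> * \<eta>" "\<eta> ^ (s - 2) = N"
    by (simp_all add: m N_def)
  have N: "N > 0" using \<eta> by (simp add: N_def)
  define r where "r = h * S / (2 * k * \<eta>)"
  have r: "r > 0" using assms \<eta> S by (simp add: r_def)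
  have "x \<le> (r * X + G / r) / 2" using Young[OF r] by simp
  then have "h * (real s * \<eta> ^ (s - 1) * x) \<le> h * (S * (N * \<eta>) * ((r * X + G / r) / 2))"
    using assms \<eta> S N unfolding pows S_def[symmetric] by (intro mult_left_mono) auto
  also have "\<dots> = (h\<^sup>2 / 4) * (S\<^sup>2 / k * N * X) + k * (N * \<eta> * \<eta>) * G"
    using assms \<eta> S N unfolding r_def by (simp add: field_simps power2_eq_square)
  also have "\<dots> = (h\<^sup>2 / 4) * ((real s)\<^sup>2 / k * \<eta> ^ (s - 2) * X) + k * \<eta> ^ s * G"
    by (simp add: pows S_def)
  also have "(h\<^sup>2 / 4) * ((real s)\<^sup>2 / k * \<eta> ^ (s - 2) * X) \<le> 1 * ((real s)\<^sup>2 / k * \<eta> ^ (s - 2) * X)"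
  proof (rule mult_right_mono)
    have "h\<^sup>2 \<le> 2\<^sup>2" using assms by (intro power_mono) auto
    then show "h\<^sup>2 / 4 \<le> 1" by simp
  qed (use assms in auto)
  finally show ?thesis by simp
qed

lemma frechet_derivative_power:
  fixes \<eta> :: "'a::real_normed_vector \<Rightarrow> real"
  assumes "\<eta> differentiable (at z)"
  shows "frechet_derivative (\<lambda>z. \<eta> z ^ s) (at z) = (\<lambda>v. real s * \<eta> z ^ (s - 1) * frechet_derivative \<eta> (at z) v)"
proof -
  have "((\<lambda>z. \<eta> z ^ s) has_derivative (\<lambda>v. real s * frechet_derivative \<eta> (at z) v * \<eta> z ^ (s - 1))) (at z)"
    by (rule has_derivative_power) (use assms frechet_derivative_works in blast)
  then show ?thesis by (simp add: frechet_derivative_at[symmetric] mult_ac)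
qed

text \<open>Wider by factors of 2 than the support of the cutoff, so that this support is a compact
  subset of a bounded open set staying away from t = 0.\<close>

definition cylinder :: "real \<Rightarrow> real \<Rightarrow> (real \<times> (real ^ 'n)) set" where
  "cylinder \<alpha> R = {1 / (4 * R)<..<2 * R powr \<alpha>} \<times> ball 0 (2 * R)"

lemma bounded_domain_cylinder:
  assumes "R > 1" "\<alpha> > 0"
  shows "bounded_domain (cylinder \<alpha> R :: (real \<times> (real ^ 'n)) set)"
proof -
  have "1 \<le> R powr \<alpha>" using assms by (simp add: ge_one_powr_ge_zero)
  moreover have "1 / (4 * R) < 1" using assms by simp
  ultimately have "1 / (4 * R) < 2 * R powr \<alpha>" by linarith
  moreover have "{1 / (4 * R)<..<2 * R powr \<alpha>} \<subseteq> {0<..}"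
    using assms by (auto intro: less_trans[rotated])
  ultimately show ?thesis
    using assms unfolding bounded_domain_def cylinder_def half_space_def
    by (intro conjI open_Times connected_Times bounded_Times Sigma_mono) auto
qed

text \<open>Comparison with a box of time length 2 R powr \<alpha> and spatial sides 4 R. The
  resulting exponent \<alpha> + n is what the upper bound on q is weighed against.\<close>

lemma measure_cylinder_le:
  assumes "R > 1" "\<alpha> > 0"
  shows "measure (lebesgue_on (cylinder \<alpha> R)) (space (lebesgue_on (cylinder \<alpha> R :: (real \<times> (real ^ 'n)) set)))
     \<le> 2 * 4 ^ CARD('n) * R powr (\<alpha> + real CARD('n))"
proof -
  let ?\<Omega> = "cylinder \<alpha> R :: (real \<times> (real ^ 'n)) set"
  let ?Q = "cbox (0, \<chi> i. - 2 * R) (2 * R powr \<alpha>, \<chi> i. 2 * R) :: (real \<times> (real ^ 'n)) set"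
  have op: "open ?\<Omega>" unfolding cylinder_def by (intro open_Times) auto
  have "?\<Omega> \<subseteq> ?Q"
  proof
    fix z assume "z \<in> ?\<Omega>"
    then obtain t x where z: "z = (t, x)" "1 / (4 * R) < t" "t < 2 * R powr \<alpha>" "norm x < 2 * R"
      by (auto simp: cylinder_def)
    have "0 < 1 / (4 * R)" using assms by simp
    then have "0 \<le> t" using z by linarith
    moreover have "\<bar>x $ i\<bar> \<le> 2 * R" for i
      using component_le_norm_cart[of x i] z by linarith
    ultimately show "z \<in> ?Q"
      using z by (auto simp: cbox_Pair_eq mem_box_cart abs_le_iff) (smt (verit, best))+
  qed
  have "measure (lebesgue_on ?\<Omega>) (space (lebesgue_on ?\<Omega>)) = measure lebesgue ?\<Omega>"
    using op by (simp add: measure_restrict_space)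
  also have "\<dots> \<le> measure lebesgue ?Q"
    using \<open>?\<Omega> \<subseteq> ?Q\<close> op by (intro measure_mono_fmeasurable) auto
  also have "\<dots> = measure lborel {0..2 * R powr \<alpha>} * measure lborel (cbox (\<chi> i. - 2 * R) (\<chi> i. 2 * R) :: (real ^ 'n) set)"
    using content_Pair[of 0 "\<chi> i. - 2 * R" "2 * R powr \<alpha>" "\<chi> i. 2 * R :: real ^ 'n"] by (simp add: cbox_interval)
  also have "\<dots> = 2 * R powr \<alpha> * (4 * R) ^ CARD('n)"
    using assms by (subst content_cbox_cart) (auto simp: interval_ne_empty_cart)
  also have "\<dots> = 2 * 4 ^ CARD('n) * R powr (\<alpha> + real CARD('n))"
    using assms by (simp add: power_mult_distrib powr_add powr_realpow)
  finally show ?thesis .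
qed

section \<open>The difference of a supersolution and a subsolution\<close>

lemma AE_lebesgue_on_subset:
  assumes "AE z in lebesgue_on S. P z" "T \<subseteq> S" "S \<in> sets lebesgue" "T \<in> sets lebesgue"
  shows "AE z in lebesgue_on T. P z"
  using assms by (auto simp: AE_restrict_space_iff elim!: eventually_mono)

lemma open_half_space: "open (half_space :: (real \<times> (real ^ 'n)) set)"
  unfolding half_space_def by (intro open_Times) auto

lemma half_space_measurable [simp]: "half_space \<in> sets lebesgue"
  by (rule sets_completionI_sets) (simp add: borel_open open_half_space)

lemma antiderivative_exists:
  fixes h :: "real \<Rightarrow> real"
  assumes "continuous_on UNIV h"
  obtains H where "\<And>s. (H has_real_derivative h s) (at s)" "H 0 = 0"
proof -
  have "\<exists>F. \<forall>x. -\<infinity> < ereal x \<longrightarrow> ereal x < \<infinity> \<longrightarrow> (F has_vector_derivative h x) (at x)"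
    by (rule einterval_antiderivative) (use assms in \<open>auto simp: continuous_on_eq_continuous_at\<close>)
  then obtain F where F: "\<And>x. (F has_real_derivative h x) (at x)"
    by (auto simp: has_real_derivative_iff_has_vector_derivative)
  have "((\<lambda>s. F s - F 0) has_real_derivative h s) (at s)" for s
    using F[of s] by (auto intro!: derivative_eq_intros)
  then show thesis by (rule that) simp
qed

text \<open>The limits \<open>pu\<close>, \<open>gu\<close>, \<open>pv\<close>, \<open>gv\<close> of
  the derivatives are fixed together with \<open>u\<close> and \<open>v\<close>, because with a
  degenerate form the functions alone need not determine them.\<close>

locale super_sub_pair =
  fixes a :: "'n::finite \<Rightarrow> 'n \<Rightarrow> real \<times> (real ^ 'n) \<Rightarrow> real"
    and A u v pu pv :: "real \<times> (real ^ 'n) \<Rightarrow> real"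
    and gu gv :: "real \<times> (real ^ 'n) \<Rightarrow> real ^ 'n"
    and \<alpha> q c :: real
  assumes alpha_pos: "\<alpha> > 0" and q_gt_1: "1 < q" and q_le: "q \<le> 1 + \<alpha> / real CARD('n)"
    and a_measurable: "\<And>i j. a i j \<in> borel_measurable (lebesgue_on half_space)"
    and a_symmetric: "\<And>i j. AE z in lebesgue_on half_space. a i j z = a j i z"
    and A_locally_bounded: "locally_bounded_on half_space A"
    and a_form: "AE z in lebesgue_on half_space.
        \<forall>\<xi>. 0 \<le> coeff_form a z \<xi> \<xi> \<and> coeff_form a z \<xi> \<xi> \<le> A z * (norm \<xi>)\<^sup>2"
    and c_pos: "c > 0"
    and growth: "\<And>R. R > 1 \<Longrightarrow>
        esssup (lebesgue_on ({0<..} \<times> {x. R / 2 < norm x \<and> norm x < R})) (\<lambda>z. ereal (A z))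
          \<le> ereal (c * R powr (2 - \<alpha>))"
    and u_W: "(u, pu, gu) \<in> W_loc a q" and v_W: "(v, pv, gv) \<in> W_loc a q"
    and u_weak: "\<And>\<phi>. test_function \<phi> \<Longrightarrow> 0 \<le> weak_form a q u pu gu \<phi>"
    and v_weak: "\<And>\<phi>. test_function \<phi> \<Longrightarrow> weak_form a q v pv gv \<phi> \<le> 0"
    and v_le_u: "AE z in lebesgue_on half_space. v z \<le> u z"
begin

definition w :: "real \<times> (real ^ 'n) \<Rightarrow> real" where "w z = u z - v z"

definition F :: "real \<times> (real ^ 'n) \<Rightarrow> real" where
  "F z = \<bar>u z\<bar> powr (q - 1) * u z - \<bar>v z\<bar> powr (q - 1) * v z"

lemma degenerate_form_domain:
  assumes "bounded_domain \<Omega>"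
  shows "degenerate_form a \<Omega>"
proof
  have sub: "\<Omega> \<subseteq> half_space" using assms by (simp add: bounded_domain_def)
  show op: "open \<Omega>" "bounded \<Omega>" using assms by (auto simp: bounded_domain_def)
  show "a i j \<in> borel_measurable (lebesgue_on \<Omega>)" for i j
    by (rule measurable_restrict_mono[OF a_measurable sub])
  have "AE z in lebesgue_on half_space. \<forall>i\<in>UNIV. \<forall>j\<in>UNIV. a i j z = a j i z"
    using a_symmetric by (intro AE_finite_allI) auto
  then show "AE z in lebesgue_on \<Omega>. \<forall>i j. a i j z = a j i z"
    using AE_lebesgue_on_subset[OF _ sub] op by auto
  have "AE z in lebesgue_on half_space. \<forall>\<xi>. 0 \<le> coeff_form a z \<xi> \<xi>"
    using a_form by eventually_elim blast
  then show "AE z in lebesgue_on \<Omega>. \<forall>\<xi>. 0 \<le> coeff_form a z \<xi> \<xi>"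
    using AE_lebesgue_on_subset[OF _ sub] op by auto
qed

lemma growth_AE:
  assumes "R > 1"
  shows "AE z in lebesgue_on half_space. R / 2 < norm (snd z) \<and> norm (snd z) < R \<longrightarrow> A z \<le> c * R powr (2 - \<alpha>)"
proof -
  let ?S = "{0::real<..} \<times> {x :: real ^ 'n. R / 2 < norm x \<and> norm x < R}"
  have "open {x :: real ^ 'n. R / 2 < norm x \<and> norm x < R}"
    by (intro open_Collect_conj open_Collect_less continuous_intros)
  then have "open ?S" by (intro open_Times open_greaterThan)
  then have S: "?S \<in> sets lebesgue" by auto
  have "AE z in lebesgue_on ?S. ereal (A z) \<le> esssup (lebesgue_on ?S) (\<lambda>z. ereal (A z))"
    by (rule esssup_AE)
  then have "AE z in lebesgue_on ?S. A z \<le> c * R powr (2 - \<alpha>)"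
  proof eventually_elim
    case (elim z)
    then show ?case using order_trans[OF elim growth[OF assms]] by simp
  qed
  then have "AE z in lebesgue. z \<in> ?S \<longrightarrow> A z \<le> c * R powr (2 - \<alpha>)"
    using S by (simp add: AE_restrict_space_iff)
  then have "AE z in lebesgue. z \<in> half_space \<longrightarrow> (R / 2 < norm (snd z) \<and> norm (snd z) < R \<longrightarrow> A z \<le> c * R powr (2 - \<alpha>))"
    by eventually_elim (auto simp: half_space_def)
  then show ?thesis by (simp add: AE_restrict_space_iff)
qed

lemma energy_limits:
  assumes "bounded_domain \<Omega>"
  obtains us vs where "energy_limit a \<Omega> us u pu gu" "energy_limit a \<Omega> vs v pv gv"
    "integrable (lebesgue_on \<Omega>) (\<lambda>z. \<bar>u z\<bar> powr q)" "integrable (lebesgue_on \<Omega>) (\<lambda>z. \<bar>v z\<bar> powr q)"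
proof -
  interpret degenerate_form a \<Omega> by (rule degenerate_form_domain[OF assms])
  have "(u, pu, gu) \<in> W_space a q \<Omega>" "(v, pv, gv) \<in> W_space a q \<Omega>"
    using u_W v_W assms by (auto simp: W_loc_def)
  then show thesis using W_space_energy_limit[OF _ q_gt_1] that by metis
qed

lemma integrable_power_nonlinearity:
  assumes "integrable M (\<lambda>z. \<bar>f z\<bar> powr q)" and [measurable]: "f \<in> borel_measurable M"
  shows "integrable M (\<lambda>z. \<bar>f z\<bar> powr (q - 1) * f z)"
proof (rule Bochner_Integration.integrable_bound[OF assms(1)])
  have "\<bar>y\<bar> powr (q - 1) * \<bar>y\<bar> = \<bar>y\<bar> powr q" for y :: real
    using powr_add[of "\<bar>y\<bar>" "q - 1" 1] by (cases "y = 0") auto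
  then show "AE z in M. norm (\<bar>f z\<bar> powr (q - 1) * f z) \<le> norm (\<bar>f z\<bar> powr q)"
    by (intro AE_I2) (simp add: abs_mult)
qed measurable

lemma integrable_F:
  assumes "bounded_domain \<Omega>"
  shows "integrable (lebesgue_on \<Omega>) F"
proof -
  obtain us vs where lim: "energy_limit a \<Omega> us u pu gu" "energy_limit a \<Omega> vs v pv gv"
    "integrable (lebesgue_on \<Omega>) (\<lambda>z. \<bar>u z\<bar> powr q)" "integrable (lebesgue_on \<Omega>) (\<lambda>z. \<bar>v z\<bar> powr q)"
    by (rule energy_limits[OF assms])
  then show ?thesis
    unfolding F_def[abs_def]
    by (intro Bochner_Integration.integrable_diff integrable_power_nonlinearity
        degenerate_form.energy_limit_measurable(1)[OF degenerate_form_domain[OF assms]]) auto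
qed

text \<open>On the compact set \<open>K\<close> the gradient is bounded and \<open>A\<close> is
  bounded almost everywhere, and the form is at most \<open>A\<close> times the squared
  norm.\<close>

lemma integrable_gradient_form:
  assumes dom: "bounded_domain \<Omega>" and sm: "smooth_on \<Omega> \<phi>"
    and K: "compact K" "K \<subseteq> \<Omega>" "\<And>z. z \<notin> K \<Longrightarrow> \<phi> z = 0"
  shows "integrable (lebesgue_on \<Omega>) (\<lambda>z. coeff_form a z (space_grad \<phi> z) (space_grad \<phi> z))"
proof -
  interpret degenerate_form a \<Omega> by (rule degenerate_form_domain[OF dom])
  interpret finite_measure "lebesgue_on \<Omega>" by (rule finite_measure_domain)
  have sub: "\<Omega> \<subseteq> half_space" using dom by (simp add: bounded_domain_def)
  obtain M where M: "AE z in lebesgue_on K. \<bar>A z\<bar> \<le> M"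
    using A_locally_bounded K sub unfolding locally_bounded_on_def by blast
  have meas [measurable]: "space_grad \<phi> \<in> borel_measurable (lebesgue_on \<Omega>)"
    by (rule space_grad_borel_measurable[OF open_domain sm])
  have "continuous_on K (space_grad \<phi>)"
    unfolding space_grad_def
    by (intro continuous_on_vec_lambda continuous_on_subset[OF smooth_on_continuous[OF smooth_on_frechet_derivative[OF sm]]] K)
  then have "bounded (space_grad \<phi> ` K)"
    using K by (intro compact_imp_bounded compact_continuous_image)
  then obtain C where C: "C > 0" "\<And>z. z \<in> K \<Longrightarrow> norm (space_grad \<phi> z) \<le> C"
    unfolding bounded_pos by blast
  have off: "space_grad \<phi> z = 0" if "z \<notin> K" for z
    unfolding space_grad_def using frechet_derivative_zero_off[of K \<phi> z] K that
    by (simp add: compact_imp_closed vec_eq_iff)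
  show ?thesis
  proof (rule Bochner_Integration.integrable_bound)
    show "integrable (lebesgue_on \<Omega>) (\<lambda>z. \<bar>M\<bar> * C\<^sup>2)" by simp
    have "AE z in lebesgue. z \<in> K \<longrightarrow> \<bar>A z\<bar> \<le> M"
      using M K(1) by (simp add: AE_restrict_space_iff compact_imp_closed)
    then have "AE z in lebesgue_on \<Omega>. z \<in> K \<longrightarrow> \<bar>A z\<bar> \<le> M"
      using open_domain by (auto simp: AE_restrict_space_iff elim: eventually_mono)
    moreover have "AE z in lebesgue_on \<Omega>. \<forall>\<xi>. 0 \<le> coeff_form a z \<xi> \<xi> \<and> coeff_form a z \<xi> \<xi> \<le> A z * (norm \<xi>)\<^sup>2"
      using AE_lebesgue_on_subset[OF a_form sub] open_domain by auto
    ultimately show "AE z in lebesgue_on \<Omega>. norm (coeff_form a z (space_grad \<phi> z) (space_grad \<phi> z)) \<le> norm (\<bar>M\<bar> * C\<^sup>2)"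
    proof eventually_elim
      case (elim z)
      show ?case
      proof (cases "z \<in> K")
        case True
        have "coeff_form a z (space_grad \<phi> z) (space_grad \<phi> z) \<le> A z * (norm (space_grad \<phi> z))\<^sup>2"
          using elim by blast
        also have "\<dots> \<le> \<bar>M\<bar> * C\<^sup>2"
          using elim(1) True C(2)[OF True] by (intro mult_mono power_mono) auto
        finally show ?thesis using elim(2) by auto
      qed (simp add: off)
    qed
  qed measurable
qed

text \<open>Approximants live on bounded domains, so the integral over the half-space must first be
  restricted to a domain around the support; both integrands vanish off \<open>K\<close>.\<close>

lemma weak_form_on_domain:
  assumes "bounded_domain \<Omega>" "compact K" "K \<subseteq> \<Omega>" "\<And>z. z \<notin> K \<Longrightarrow> \<phi> z = 0"
  shows "weak_form a q f p g \<phi> =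
    (\<integral>z. p z * \<phi> z + coeff_form a z (space_grad \<phi> z) (g z) - \<bar>f z\<bar> powr (q - 1) * f z * \<phi> z \<partial>lebesgue_on \<Omega>)"
proof -
  have \<Omega>: "open \<Omega>" "\<Omega> \<subseteq> half_space" using assms(1) by (auto simp: bounded_domain_def)
  have off: "\<phi> z = 0" "space_grad \<phi> z = 0" if "z \<notin> K" for z
    using assms(4) that frechet_derivative_zero_off[of K \<phi> z] assms(2)
    by (simp_all add: compact_imp_closed vec_eq_iff space_grad_def)
  show ?thesis
    unfolding weak_form_def set_lebesgue_integral_def
  proof (subst integral_restrict_space)
    show "\<Omega> \<inter> space lebesgue \<in> sets lebesgue" using \<Omega>(1) by simp
    let ?f = "\<lambda>z. p z * \<phi> z + coeff_form a z (space_grad \<phi> z) (g z) - \<bar>f z\<bar> powr (q - 1) * f z * \<phi> z"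
    show "(\<integral>z. indicator half_space z *\<^sub>R ?f z \<partial>lebesgue) = (\<integral>z. indicator \<Omega> z *\<^sub>R ?f z \<partial>lebesgue)"
    proof (rule Bochner_Integration.integral_cong[OF refl])
      fix z
      show "indicator half_space z *\<^sub>R ?f z = indicator \<Omega> z *\<^sub>R ?f z"
        using off[of z] \<Omega>(2) assms(3) by (cases "z \<in> K") (auto simp: indicator_def)
    qed
  qed
qed

text \<open>Both weak inequalities are tested with the same function and subtracted. Merging the two
  integrals requires each integrand to be integrable, which is most of the work.\<close>

lemma weak_difference:
  assumes dom: "bounded_domain \<Omega>" and K: "compact K" "K \<subseteq> \<Omega>" and test: "test_function \<phi>"
    and off: "\<And>z. z \<notin> K \<Longrightarrow> \<phi> z = 0"
  shows "0 \<le> (\<integral>z. (pu z - pv z) * \<phi> z + coeff_form a z (space_grad \<phi> z) (gu z - gv z) - F z * \<phi> z \<partial>lebesgue_on \<Omega>)"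
proof -
  interpret degenerate_form a \<Omega> by (rule degenerate_form_domain[OF dom])
  let ?M = "lebesgue_on \<Omega>"
  obtain us vs where 1: "energy_limit a \<Omega> us u pu gu" and 2: "energy_limit a \<Omega> vs v pv gv"
    and q: "integrable ?M (\<lambda>z. \<bar>u z\<bar> powr q)" "integrable ?M (\<lambda>z. \<bar>v z\<bar> powr q)"
    by (rule energy_limits[OF dom])
  note [measurable] = energy_limit_measurable[OF 1] energy_limit_measurable[OF 2]
  have sub: "\<Omega> \<subseteq> half_space" using dom by (simp add: bounded_domain_def)
  have sm: "smooth_on \<Omega> \<phi>" using test smooth_on_subset[OF _ sub] by (auto simp: test_function_def)
  have meas [measurable]: "space_grad \<phi> \<in> borel_measurable ?M" "\<phi> \<in> borel_measurable ?M"
    by (rule space_grad_borel_measurable[OF open_domain sm] smooth_on_borel_measurable[OF open_domain sm])+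
  have "smooth_on UNIV (\<lambda>z. if z \<in> \<Omega> then \<phi> z else 0)"
    using off by (intro smooth_on_extend_zero[OF open_domain K sm]) auto
  also have "(\<lambda>z. if z \<in> \<Omega> then \<phi> z else 0) = \<phi>" using off K(2) by fastforce
  finally have sm\<phi>: "smooth_on UNIV \<phi>" .
  obtain C where "C > 0" and C: "\<And>z. \<bar>\<phi> z\<bar> \<le> C"
    using compactly_supported_bounded[OF smooth_on_continuous[OF sm\<phi>] K(1) off] by blast
  have grad: "integrable ?M (\<lambda>z. coeff_form a z (space_grad \<phi> z) (space_grad \<phi> z))"
    by (rule integrable_gradient_form[OF dom sm K off])
  have i: "integrable ?M (\<lambda>z. p z * \<phi> z + coeff_form a z (space_grad \<phi> z) (g z) - \<bar>f z\<bar> powr (q - 1) * f z * \<phi> z)"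
    if "energy_limit a \<Omega> fs f p g" "integrable ?M (\<lambda>z. \<bar>f z\<bar> powr q)" for fs f p g
  proof -
    note [measurable] = energy_limit_measurable[OF that(1)]
    have "integrable ?M (\<lambda>z. \<phi> z * p z)"
      by (rule integrable_bounded_mult[OF _ _ C]) (use that(1) in \<open>auto simp: energy_limit_def\<close>)
    moreover have "integrable ?M (\<lambda>z. \<phi> z * (\<bar>f z\<bar> powr (q - 1) * f z))"
      by (rule integrable_bounded_mult[OF integrable_power_nonlinearity[OF that(2)] _ C]) measurable
    moreover have "integrable ?M (\<lambda>z. coeff_form a z (space_grad \<phi> z) (g z))"
      by (rule integrable_coeff_form[OF _ _ grad]) (use that(1) in \<open>auto simp: energy_limit_def\<close>)
    ultimately show ?thesis by (simp add: mult.commute)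
  qed
  have wf: "weak_form a q f p g \<phi> =
    (\<integral>z. p z * \<phi> z + coeff_form a z (space_grad \<phi> z) (g z) - \<bar>f z\<bar> powr (q - 1) * f z * \<phi> z \<partial>?M)" for f p g
    by (rule weak_form_on_domain[OF dom K]) (rule off)
  have "0 \<le> weak_form a q u pu gu \<phi> - weak_form a q v pv gv \<phi>"
    using u_weak[OF test] v_weak[OF test] by simp
  also have "\<dots> = (\<integral>z. (pu z * \<phi> z + coeff_form a z (space_grad \<phi> z) (gu z) - \<bar>u z\<bar> powr (q - 1) * u z * \<phi> z)
      - (pv z * \<phi> z + coeff_form a z (space_grad \<phi> z) (gv z) - \<bar>v z\<bar> powr (q - 1) * v z * \<phi> z) \<partial>?M)"
    using i[OF 1 q(1)] i[OF 2 q(2)]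
    by (simp only: wf Bochner_Integration.integral_diff)
  also have "\<dots> = (\<integral>z. (pu z - pv z) * \<phi> z + coeff_form a z (space_grad \<phi> z) (gu z - gv z) - F z * \<phi> z \<partial>?M)"
    by (rule Bochner_Integration.integral_cong[OF refl]) (simp add: F_def coeff_form_diff_right algebra_simps)
  finally show ?thesis .
qed

end

section \<open>The inequality for the difference, tested with the nonlinear multiplier\<close>

context super_sub_pair
begin

lemma w_nonneg: "AE z in lebesgue_on half_space. 0 \<le> w z"
  using v_le_u by eventually_elim (simp add: w_def)

lemma integrable_w_powr:
  assumes "bounded_domain \<Omega>"
  shows "integrable (lebesgue_on \<Omega>) (\<lambda>z. \<bar>w z\<bar> powr q)"
proof -
  obtain us vs where lim: "energy_limit a \<Omega> us u pu gu" "energy_limit a \<Omega> vs v pv gv"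
    and q: "integrable (lebesgue_on \<Omega>) (\<lambda>z. \<bar>u z\<bar> powr q)" "integrable (lebesgue_on \<Omega>) (\<lambda>z. \<bar>v z\<bar> powr q)"
    by (rule energy_limits[OF assms])
  note [measurable] = lim[THEN degenerate_form.energy_limit_measurable(1)[OF degenerate_form_domain[OF assms]]]
  show ?thesis
  proof (rule Bochner_Integration.integrable_bound)
    show "integrable (lebesgue_on \<Omega>) (\<lambda>z. 2 powr q * (\<bar>u z\<bar> powr q + \<bar>v z\<bar> powr q))"
      using q by simp
    show "AE z in lebesgue_on \<Omega>. norm (\<bar>w z\<bar> powr q) \<le> norm (2 powr q * (\<bar>u z\<bar> powr q + \<bar>v z\<bar> powr q))"
      using powr_abs_diff_le[of q] q_gt_1 by (intro AE_I2) (simp add: w_def abs_of_nonneg)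
  qed (unfold w_def, measurable)
qed

text \<open>On the left, \<open>1 \<le> h\<close> and the coercivity of the nonlinearity keep 2 powr
  (-q) times the source term. On the right, the time and space errors carry the same factor R powr
  -\<alpha> and the same weight \<open>Z\<close>, so one pointwise inequality, \<open>upper\<close>,
  controls the whole integrand. \<open>E\<close> contains the places where the cutoff decreases in
  time or varies in space; \<open>P\<close> and \<open>Q\<close> keep the threshold estimate
  abstract.\<close>

lemma tested_inequality:
  fixes h h' H :: "real \<Rightarrow> real" and \<eta> :: "real \<times> (real ^ 'n) \<Rightarrow> real"
  assumes R: "R > 1" and dom: "bounded_domain \<Omega>"
    and K: "compact K" "K \<subseteq> \<Omega>" "\<And>z. z \<notin> K \<Longrightarrow> \<eta> z = 0"
    and \<eta>: "smooth_on UNIV \<eta>" "\<And>z. 0 \<le> \<eta> z" "\<And>z. \<eta> z \<le> 1"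
    and \<eta>_time: "\<And>z. - time_deriv \<eta> z \<le> (if z \<in> E then b * R powr - \<alpha> else 0)"
    and \<eta>_space: "\<And>z. norm (space_grad \<eta> z) \<le> (if R / 2 < norm (snd z) \<and> norm (snd z) < R then b / R else 0)"
    and E: "\<And>z. R / 2 < norm (snd z) \<Longrightarrow> z \<in> E" and b: "0 < b"
    and h: "smooth_on UNIV h" "\<And>s. (h has_real_derivative h' s) (at s)"
      "\<And>s. 1 \<le> h s" "\<And>s. h s \<le> 2" "\<And>s. \<bar>h' s\<bar> \<le> B"
    and c0: "c0 > 0" and h'_le: "\<And>s. 0 \<le> s \<Longrightarrow> h' s \<le> - c0 * (1 + s) powr (- \<nu> - 1)" and \<nu>: "\<nu> > 0"
    and \<delta>: "\<delta> > 0" and s: "s = 2 * \<beta> + 2"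
    and bound: "\<And>y e. 0 \<le> y \<Longrightarrow> 0 \<le> e \<Longrightarrow> e \<le> 1 \<Longrightarrow> \<delta> * (1 + y / \<delta>) powr (1 + \<nu>) * e ^ (2 * \<beta>) \<le> P + Q * (y powr q * e ^ s)"
    and P: "0 \<le> P" and Q: "0 \<le> Q" and Em: "E \<in> sets borel"
  shows "2 powr (- q) * (\<integral>z. \<bar>w z\<bar> powr q * \<eta> z ^ s \<partial>lebesgue_on \<Omega>) \<le>
    (2 * real s * b + (real s)\<^sup>2 * c * b\<^sup>2 / c0) * R powr - \<alpha> *
    (P * measure (lebesgue_on \<Omega>) (space (lebesgue_on \<Omega>)) + Q * (\<integral>z. indicator E z * (\<bar>w z\<bar> powr q * \<eta> z ^ s) \<partial>lebesgue_on \<Omega>))"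
proof -
  let ?M = "lebesgue_on \<Omega>"
  interpret degenerate_form a \<Omega> by (rule degenerate_form_domain[OF dom])
  interpret finite_measure ?M by (rule finite_measure_domain)
  obtain us vs where lim: "energy_limit a \<Omega> us u pu gu" "energy_limit a \<Omega> vs v pv gv"
    by (rule energy_limits[OF dom])
  define p where "p z = pu z - pv z" for z
  define g where "g z = gu z - gv z" for z
  have limw: "energy_limit a \<Omega> (\<lambda>k z. us k z - vs k z) w p g"
    unfolding w_def[abs_def] p_def[abs_def] g_def[abs_def] by (rule energy_limit_diff[OF lim])
  have weak: "0 \<le> (\<integral>z. p z * \<phi> z + coeff_form a z (space_grad \<phi> z) (g z) - F z * \<phi> z \<partial>?M)"
    if "test_function \<phi>" "\<And>z. z \<notin> K \<Longrightarrow> \<phi> z = 0" for \<phi>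
    unfolding p_def g_def by (rule weak_difference[OF dom K(1,2) that])
  have sub: "\<Omega> \<subseteq> half_space" using dom by (simp add: bounded_domain_def)
  define \<zeta> where "\<zeta> z = \<eta> z ^ s" for z
  have s2: "2 \<le> s" using s by simp
  have sm\<zeta>: "smooth_on UNIV \<zeta>" unfolding \<zeta>_def[abs_def] by (intro smooth_on_power \<eta>) simp
  have \<zeta>K: "\<zeta> z = 0" if "z \<notin> K" for z using K(3)[OF that] s2 by (simp add: \<zeta>_def)
  have \<zeta>0: "0 \<le> \<zeta> z" "\<zeta> z \<le> 1" for z using \<eta> by (auto simp: \<zeta>_def power_le_one)
  have sm\<zeta>\<Omega>: "smooth_on \<Omega> \<zeta>" using smooth_on_subset[OF sm\<zeta>] by simp
  have \<zeta>form: "integrable ?M (\<lambda>z. coeff_form a z (space_grad \<zeta> z) (space_grad \<zeta> z))"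
    by (rule integrable_gradient_form[OF dom sm\<zeta>\<Omega> K(1,2) \<zeta>K])
  have \<zeta>meas: "\<zeta> \<in> borel_measurable ?M" by (rule smooth_on_borel_measurable[OF open_domain sm\<zeta>\<Omega>])
  have fd\<zeta>: "frechet_derivative \<zeta> (at z) = (\<lambda>v. real s * \<eta> z ^ (s - 1) * frechet_derivative \<eta> (at z) v)" for z
    unfolding \<zeta>_def[abs_def]
    by (rule frechet_derivative_power) (use smooth_on_has_derivative[OF \<eta>(1) UNIV_I, of z] in \<open>unfold differentiable_def, blast\<close>)
  have td\<zeta>: "time_deriv \<zeta> z = real s * \<eta> z ^ (s - 1) * time_deriv \<eta> z" for z
    by (simp add: time_deriv_def fd\<zeta>)
  have sg\<zeta>: "space_grad \<zeta> z = (real s * \<eta> z ^ (s - 1)) *\<^sub>R space_grad \<eta> z" for z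
    by (simp add: space_grad_def fd\<zeta> vec_eq_iff)
  define h1 where "h1 y = h (y / \<delta>)" for y
  define h1' where "h1' y = h' (y / \<delta>) / \<delta>" for y
  have "smooth_on UNIV (\<lambda>y :: real. y / \<delta>)"
    by (rule smooth_on_linear[OF bounded_linear_divide])
  then have smh1: "smooth_on UNIV h1"
    unfolding h1_def[abs_def] using h(1) by (rule smooth_on_compose[OF open_UNIV open_UNIV, rotated]) simp
  have dh1: "(h1 has_real_derivative h1' y) (at y)" for y
    using DERIV_chain2[OF h(2) DERIV_cdivide[OF DERIV_ident, of \<delta>]] by (simp add: h1_def[abs_def] h1'_def)
  obtain H where dH: "\<And>y. (H has_real_derivative h1 y) (at y)" and H0: "H 0 = 0"
    using antiderivative_exists[OF smooth_on_continuous[OF smh1]] by blast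
  \<comment> \<open>With \<open>h1\<close> between 1 and 2, H(w) is comparable to w, so the time
    error is of first order in w.\<close>
  have Hb: "0 \<le> H y \<and> H y \<le> 2 * y" if "0 \<le> y" for y
  proof (cases "y = 0")
    case False
    then have "0 < y" using that by simp
    then obtain z where "H y - H 0 = (y - 0) * h1 z"
      using MVT2[of 0 y H h1] dH by blast
    moreover have "1 \<le> h1 z" "h1 z \<le> 2" by (auto simp: h1_def h)
    ultimately show ?thesis using that H0 mult_left_mono[of "h1 z" 2 y] by simp
  qed (simp add: H0)
  have Fint: "integrable ?M F" by (rule integrable_F[OF dom])
  \<comment> \<open>\<open>nonlinear_test\<close> asks for one constant that bounds both the
    multiplier and its derivative.\<close>
  define B' where "B' = max 2 (B / \<delta>)"
  have h1b: "0 \<le> h1 y" "h1 y \<le> B'" "\<bar>h1' y\<bar> \<le> B'" for y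
  proof -
    have "1 \<le> h1 y" "h1 y \<le> 2" by (auto simp: h1_def h)
    then show "0 \<le> h1 y" "h1 y \<le> B'" by (auto simp: B'_def)
    have "\<bar>h1' y\<bar> \<le> B / \<delta>" unfolding h1'_def using h(5)[of "y / \<delta>"] \<delta> by (simp add: divide_right_mono)
    then show "\<bar>h1' y\<bar> \<le> B'" by (simp add: B'_def)
  qed
  note test = nonlinear_test[OF limw sub smh1 dh1 h1b dH sm\<zeta> \<zeta>0(1) K(1,2) \<zeta>K \<zeta>form Fint weak]
  have int: "integrable ?M (\<lambda>z. H (w z) * time_deriv \<zeta> z)"
    "integrable ?M (\<lambda>z. h1 (w z) * coeff_form a z (space_grad \<zeta> z) (g z))"
    "integrable ?M (\<lambda>z. h1' (w z) * \<zeta> z * coeff_form a z (g z) (g z))"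
    "integrable ?M (\<lambda>z. h1 (w z) * \<zeta> z * F z)"
    and main: "(\<integral>z. h1 (w z) * \<zeta> z * F z \<partial>?M) \<le> - (\<integral>z. H (w z) * time_deriv \<zeta> z \<partial>?M)
       + (\<integral>z. h1 (w z) * coeff_form a z (space_grad \<zeta> z) (g z) \<partial>?M)
       + (\<integral>z. h1' (w z) * \<zeta> z * coeff_form a z (g z) (g z) \<partial>?M)"
    by (rule test; blast)+
  define \<Phi> where "\<Phi> z = - (H (w z) * time_deriv \<zeta> z) + h1 (w z) * coeff_form a z (space_grad \<zeta> z) (g z)
     + h1' (w z) * \<zeta> z * coeff_form a z (g z) (g z)" for z
  have \<Phi>int: "integrable ?M \<Phi>" unfolding \<Phi>_def[abs_def] using int by simp
  have main': "(\<integral>z. h1 (w z) * \<zeta> z * F z \<partial>?M) \<le> (\<integral>z. \<Phi> z \<partial>?M)"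
    using main int unfolding \<Phi>_def by simp
  define C0 where "C0 = 2 * real s * b + (real s)\<^sup>2 * c * b\<^sup>2 / c0"
  have C0: "0 \<le> C0" unfolding C0_def using b c0 c_pos by simp
  define f where "f z = \<bar>w z\<bar> powr q * \<zeta> z" for z
  have fint: "integrable ?M f"
    unfolding f_def[abs_def] using integrable_bounded_mult[OF integrable_w_powr[OF dom] \<zeta>meas, of 1] \<zeta>0
    by (simp add: mult.commute)
  have "indicator E \<in> borel_measurable ?M"
    using Em by (intro measurable_restrict_space1 measurable_completion) auto
  then have fEint: "integrable ?M (\<lambda>z. indicator E z * f z)"
    by (rule integrable_bounded_mult[OF fint, of _ 1]) (simp add: indicator_def)
  have aeA: "AE z in ?M. R / 2 < norm (snd z) \<and> norm (snd z) < R \<longrightarrow> A z \<le> c * R powr (2 - \<alpha>)"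
    using AE_lebesgue_on_subset[OF growth_AE[OF R] sub] open_domain by simp
  have aeform: "AE z in ?M. \<forall>\<xi>. 0 \<le> coeff_form a z \<xi> \<xi> \<and> coeff_form a z \<xi> \<xi> \<le> A z * (norm \<xi>)\<^sup>2"
    using AE_lebesgue_on_subset[OF a_form sub] open_domain by simp
  have aew: "AE z in ?M. 0 \<le> w z" using AE_lebesgue_on_subset[OF w_nonneg sub] open_domain by simp
  have lower: "AE z in ?M. 2 powr (- q) * f z \<le> h1 (w z) * \<zeta> z * F z"
    using aew
  proof eventually_elim
    case (elim z)
    have 1: "2 powr (- q) * w z powr q \<le> F z"
      unfolding F_def w_def using elim q_gt_1 by (intro power_nonlinearity_diff_ge) (auto simp: w_def)
    then have "0 \<le> F z" by (rule order_trans[rotated]) simp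
    have "2 powr (- q) * f z = (2 powr (- q) * w z powr q) * (1 * \<zeta> z)"
      using elim by (simp add: f_def)
    also have "\<dots> \<le> F z * (h1 (w z) * \<zeta> z)"
      using 1 \<open>0 \<le> F z\<close> \<zeta>0 h(3) h1b(1) by (intro mult_mono mult_nonneg_nonneg) (auto simp: h1_def)
    finally show ?case by (simp add: mult_ac)
  qed
  have upper: "AE z in ?M. \<Phi> z \<le> C0 * R powr - \<alpha> * (P + Q * (indicator E z * f z))"
    using aew aeform aeA coeff_symmetric
  proof eventually_elim
    case (elim z)
    define Y where "Y = 1 + w z / \<delta>"
    have Y: "1 \<le> Y" using elim \<delta> by (simp add: Y_def)
    define k where "k = - h1' (w z)"
    \<comment> \<open>The weight \<delta> Y powr (1 + \<nu>) originates here: it bounds 1 / k, the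
      price of absorbing the cross term.\<close>
    have "k \<ge> c0 / \<delta> * Y powr (- \<nu> - 1)"
      unfolding k_def h1'_def Y_def using h'_le[of "w z / \<delta>"] elim(1) \<delta> by (simp add: field_simps)
    moreover have ypos: "c0 / \<delta> * Y powr (- \<nu> - 1) > 0" using c0 \<delta> Y by simp
    ultimately have k: "k > 0" "1 / k \<le> 1 / (c0 / \<delta> * Y powr (- \<nu> - 1))"
      by (linarith, intro frac_le) linarith+
    have "1 / (c0 / \<delta> * Y powr (- \<nu> - 1)) = \<delta> * Y powr (1 + \<nu>) / c0"
      using Y \<delta> c0 powr_add[of Y "- \<nu> - 1" "1 + \<nu>"] by (simp add: field_simps)
    with k(2) have k2: "1 / k \<le> \<delta> * Y powr (1 + \<nu>) / c0" by simp
    define X where "X = coeff_form a z (space_grad \<eta> z) (space_grad \<eta> z)"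
    define G where "G = coeff_form a z (g z) (g z)"
    define x where "x = coeff_form a z (space_grad \<eta> z) (g z)"
    have X0: "0 \<le> X" using elim by (simp add: X_def)
    define Z where "Z = \<delta> * Y powr (1 + \<nu>) * \<eta> z ^ (2 * \<beta>)"
    have T0: "0 \<le> Z" using \<delta> \<eta> by (simp add: Z_def)
    define I where "I = (indicator E z :: real)"
    \<comment> \<open>The growth bound contributes R powr (2 - \<alpha>) and the squared gradient of
      the cutoff R powr (-2); the product has the same order R powr -\<alpha> as the time
      derivative.\<close>
    have Xle: "X \<le> c * b\<^sup>2 * R powr - \<alpha> * I"
    proof (cases "R / 2 < norm (snd z) \<and> norm (snd z) < R")
      case True
      then have I1: "I = 1" using E by (simp add: I_def)
      have A: "A z \<le> c * R powr (2 - \<alpha>)" using elim(3) True by blast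
      have "X \<le> A z * (norm (space_grad \<eta> z))\<^sup>2" using elim(2) unfolding X_def by blast
      also have "\<dots> \<le> c * R powr (2 - \<alpha>) * (b / R)\<^sup>2"
        using A \<eta>_space[of z] True c_pos by (intro mult_mono power_mono) auto
      also have "\<dots> = c * b\<^sup>2 * R powr - \<alpha> * I"
        using R I1 by (simp add: powr_diff powr_minus power_divide powr_numeral field_simps)
      finally show ?thesis .
    next
      case False
      then have "space_grad \<eta> z = 0" using \<eta>_space[of z] by auto
      then show ?thesis using c_pos by (simp add: X_def I_def)
    qed
    have "h1 (w z) * (real s * \<eta> z ^ (s - 1) * x) - k * \<eta> z ^ s * G \<le> (real s)\<^sup>2 / k * \<eta> z ^ (s - 2) * X"
    proof (rule absorb_cross_term)
      show "2 * \<bar>x\<bar> \<le> r * X + G / r" if "r > 0" for r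
        unfolding x_def X_def G_def using elim that by (intro coeff_form_Young) auto
    qed (use h X0 k \<eta> s2 in \<open>auto simp: h1_def\<close>)
    also have "\<dots> = (real s)\<^sup>2 * \<eta> z ^ (2 * \<beta>) * X * (1 / k)" by (simp add: s)
    also have "\<dots> \<le> (real s)\<^sup>2 * \<eta> z ^ (2 * \<beta>) * X * (\<delta> * Y powr (1 + \<nu>) / c0)"
      using k2 X0 \<eta> by (intro mult_left_mono) auto
    also have "\<dots> = (real s)\<^sup>2 / c0 * Z * X" by (simp add: Z_def)
    also have "\<dots> \<le> (real s)\<^sup>2 / c0 * Z * (c * b\<^sup>2 * R powr - \<alpha> * I)"
      using Xle T0 c0 by (intro mult_left_mono) auto
    finally have space: "h1 (w z) * coeff_form a z (space_grad \<zeta> z) (g z) + h1' (w z) * \<zeta> z * G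
        \<le> (real s)\<^sup>2 / c0 * Z * (c * b\<^sup>2 * R powr - \<alpha> * I)"
      by (simp add: sg\<zeta> coeff_form_scaleR_left x_def k_def \<zeta>_def)
    have "- (H (w z) * time_deriv \<zeta> z) = H (w z) * (real s * \<eta> z ^ (s - 1)) * (- time_deriv \<eta> z)"
      by (simp add: td\<zeta>)
    also have "\<dots> \<le> H (w z) * (real s * \<eta> z ^ (s - 1)) * (b * R powr - \<alpha> * I)"
      using \<eta>_time[of z] Hb[OF elim(1)] \<eta> by (intro mult_left_mono) (auto simp: I_def indicator_def)
    also have "\<dots> \<le> (2 * (\<delta> * Y powr (1 + \<nu>))) * (real s * \<eta> z ^ (2 * \<beta>)) * (b * R powr - \<alpha> * I)"
    proof (intro mult_right_mono mult_mono)
      \<comment> \<open>As \<open>1 \<le> Y\<close>, the first-order time error fits under the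
        weight already required by the space error.\<close>
      have "w z \<le> \<delta> * Y" using \<delta> by (simp add: Y_def field_simps)
      also have "\<dots> \<le> \<delta> * Y powr (1 + \<nu>)"
        using Y \<delta> \<nu> powr_mono[of 1 "1 + \<nu>" Y] by (intro mult_left_mono) auto
      finally show "H (w z) \<le> 2 * (\<delta> * Y powr (1 + \<nu>))" using Hb[OF elim(1)] by simp
      show "\<eta> z ^ (s - 1) \<le> \<eta> z ^ (2 * \<beta>)"
        using \<eta> s by (intro power_decreasing) auto
    qed (use \<delta> \<eta> b in \<open>auto simp: I_def\<close>)
    also have "\<dots> = 2 * real s * b * R powr - \<alpha> * I * Z" by (simp add: Z_def)
    finally have "\<Phi> z \<le> C0 * R powr - \<alpha> * (I * Z)"
      using space unfolding \<Phi>_def C0_def G_def by (simp add: algebra_simps)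
    also have "\<dots> \<le> C0 * R powr - \<alpha> * (P + Q * (I * f z))"
    proof (rule mult_left_mono)
      have "Z \<le> P + Q * f z"
        unfolding Z_def Y_def f_def \<zeta>_def using bound[OF elim(1) \<eta>(2,3)] elim(1) by simp
      then show "I * Z \<le> P + Q * (I * f z)" using P by (auto simp: I_def indicator_def)
    qed (use C0 in simp)
    finally show ?case by (simp add: I_def)
  qed
  have "2 powr (- q) * (\<integral>z. f z \<partial>?M) = (\<integral>z. 2 powr (- q) * f z \<partial>?M)" by simp
  also have "\<dots> \<le> (\<integral>z. h1 (w z) * \<zeta> z * F z \<partial>?M)"
    using fint int lower by (intro integral_mono_AE) auto
  also have "\<dots> \<le> (\<integral>z. \<Phi> z \<partial>?M)" by (rule main')
  also have "\<dots> \<le> (\<integral>z. C0 * R powr - \<alpha> * (P + Q * (indicator E z * f z)) \<partial>?M)"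
    using \<Phi>int fEint upper by (intro integral_mono_AE) auto
  also have "\<dots> = C0 * R powr - \<alpha> * (P * measure ?M (space ?M) + Q * (\<integral>z. indicator E z * f z \<partial>?M))"
    using fEint by simp
  finally show ?thesis unfolding C0_def f_def \<zeta>_def .
qed

end

section \<open>The capacity estimate and the vanishing of the difference\<close>

lemma lebesgue_on_support:
  fixes f :: "'a::euclidean_space \<Rightarrow> real"
  assumes "\<Omega> \<subseteq> S" "\<Omega> \<in> sets lebesgue" "S \<in> sets lebesgue" "\<And>z. z \<notin> \<Omega> \<Longrightarrow> f z = 0"
  shows "integrable (lebesgue_on S) f \<longleftrightarrow> integrable (lebesgue_on \<Omega>) f"
    and "(\<integral>z. f z \<partial>lebesgue_on S) = (\<integral>z. f z \<partial>lebesgue_on \<Omega>)"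
proof -
  have eq: "(\<lambda>z. indicator S z *\<^sub>R f z) = (\<lambda>z. indicator \<Omega> z *\<^sub>R f z)"
  proof
    fix z show "indicator S z *\<^sub>R f z = indicator \<Omega> z *\<^sub>R f z"
      using assms(1) assms(4)[of z] by (cases "z \<in> \<Omega>") auto
  qed
  show "integrable (lebesgue_on S) f \<longleftrightarrow> integrable (lebesgue_on \<Omega>) f"
    using assms(2,3) by (simp only: integrable_restrict_space eq sets.Int_space_eq2)
  show "(\<integral>z. f z \<partial>lebesgue_on S) = (\<integral>z. f z \<partial>lebesgue_on \<Omega>)"
    using assms(2,3) by (simp only: integral_restrict_space eq sets.Int_space_eq2)
qed

text \<open>The set on which the cutoff at scale R is known to equal 1.\<close>

definition inner_cylinder :: "real \<Rightarrow> real \<Rightarrow> (real \<times> (real ^ 'n)) set" where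
  "inner_cylinder \<alpha> R = {1 / R..R powr \<alpha> / 2} \<times> cball 0 (R / 2)"

text \<open>Not the complement of \<open>inner_cylinder\<close>: for large R, the times before 1/R
  over the central ball belong to neither set, since the increase of the cutoff there causes no
  error.\<close>

definition outer_region :: "real \<Rightarrow> real \<Rightarrow> (real \<times> (real ^ 'n)) set" where
  "outer_region \<alpha> R = - ({..R powr \<alpha> / 2} \<times> cball 0 (R / 2))"

lemma inner_cylinder_mono:
  assumes "0 < R" "R \<le> R'" "0 < \<alpha>"
  shows "inner_cylinder \<alpha> R \<subseteq> inner_cylinder \<alpha> R'"
proof -
  have "1 / R' \<le> 1 / R" "R powr \<alpha> \<le> R' powr \<alpha>"
    using assms by (auto intro: divide_left_mono powr_mono2)
  then show ?thesis using assms unfolding inner_cylinder_def by (intro Sigma_mono) auto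
qed

lemma inner_cylinder_exhaustion:
  fixes z :: "real \<times> (real ^ 'n)"
  assumes "z \<in> half_space" "0 < \<alpha>"
  shows "\<forall>\<^sub>F k in sequentially. z \<in> inner_cylinder \<alpha> (real (k + 2))"
proof -
  obtain t x where z: "z = (t, x)" "0 < t" using assms by (auto simp: half_space_def)
  define B where "B = max (1 / t) (max ((2 * t) powr (1 / \<alpha>)) (2 * norm x))"
  obtain N where N: "B \<le> real N" using real_arch_simple by blast
  have "z \<in> inner_cylinder \<alpha> (real (k + 2))" if "k \<ge> N" for k
  proof -
    have B: "B \<le> real (k + 2)" using that N by simp
    then have "1 / t \<le> real (k + 2)" "2 * norm x \<le> real (k + 2)" "(2 * t) powr (1 / \<alpha>) \<le> real (k + 2)"
      by (auto simp: B_def)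
    moreover from this(3) have "((2 * t) powr (1 / \<alpha>)) powr \<alpha> \<le> real (k + 2) powr \<alpha>"
      using assms(2) by (intro powr_mono2) auto
    ultimately show ?thesis
      using z assms(2) by (auto simp: inner_cylinder_def powr_powr field_simps)
  qed
  then show ?thesis by (auto simp: eventually_sequentially)
qed

context super_sub_pair
begin

text \<open>\<open>f\<close> is the q-th power of the difference times the cutoff power, hidden
  behind an existential because only its bounds matter later. \<open>C\<close> and
  \<open>\<mu>\<close> are chosen before R, \<kappa> and K, which stay free for the limits.\<close>

lemma capacity_estimate:
  obtains C \<mu> where "0 < C" "0 < \<mu>"
    "\<And>R \<kappa> K. 1 < R \<Longrightarrow> 0 < \<kappa> \<Longrightarrow> 2 \<le> K \<Longrightarrow> \<exists>f. integrable (lebesgue_on half_space) f \<and>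
      (\<forall>z. 0 \<le> f z \<and> f z \<le> \<bar>w z\<bar> powr q) \<and> (\<forall>z\<in>inner_cylinder \<alpha> R. f z = \<bar>w z\<bar> powr q) \<and>
      (\<integral>z. f z \<partial>lebesgue_on half_space) \<le> C * (K\<^sup>2 * \<kappa> + \<kappa> powr (1 - q) * K powr - \<mu> *
         (\<integral>z. indicator (outer_region \<alpha> R) z * f z \<partial>lebesgue_on half_space))"
proof -
  obtain b where b: "b > 0" and cutoff: "\<And>R::real. R > 1 \<Longrightarrow> \<exists>\<eta> :: real \<times> (real ^ 'n) \<Rightarrow> real.
     smooth_on UNIV \<eta> \<and> (\<forall>z. 0 \<le> \<eta> z \<and> \<eta> z \<le> 1) \<and>
     (\<forall>t x. \<eta> (t, x) \<noteq> 0 \<longrightarrow> 1 / (2 * R) \<le> t \<and> t \<le> R powr \<alpha> \<and> norm x \<le> R) \<and>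
     (\<forall>t x. 1 / R \<le> t \<and> t \<le> R powr \<alpha> / 2 \<and> norm x \<le> R / 2 \<longrightarrow> \<eta> (t, x) = 1) \<and>
     (\<forall>t x. - time_deriv \<eta> (t, x) \<le> (if t \<le> R powr \<alpha> / 2 then 0 else b * R powr - \<alpha>)) \<and>
     (\<forall>t x. norm (space_grad \<eta> (t, x)) \<le> (if R / 2 < norm x \<and> norm x < R then b / R else 0))"
    using space_time_cutoff[OF alpha_pos] by blast
  \<comment> \<open>\<open>\<nu> \<le> 1\<close> is needed below the threshold, and \<nu> < q - 1
    leaves \<open>\<mu>\<close> positive.\<close>
  define \<nu> where "\<nu> = min 1 ((q - 1) / 2)"
  define \<mu> where "\<mu> = q - 1 - \<nu>"
  have \<nu>: "0 < \<nu>" "\<nu> \<le> 1" and \<mu>: "0 < \<mu>" and q_eq: "q = 1 + \<nu> + \<mu>"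
    using q_gt_1 by (auto simp: \<nu>_def \<mu>_def min_def field_simps)
  obtain h h' :: "real \<Rightarrow> real" and B c0 where h: "smooth_on UNIV h" "\<And>s. (h has_real_derivative h' s) (at s)"
    "\<And>s. 1 \<le> h s" "\<And>s. h s \<le> 2" "\<And>s. \<bar>h' s\<bar> \<le> B" and c0: "c0 > 0"
    and h'_le: "\<And>s. 0 \<le> s \<Longrightarrow> h' s \<le> - c0 * (1 + s) powr (- \<nu> - 1)"
    using decreasing_multiplier[OF \<nu>(1)] by blast
  \<comment> \<open>The least natural number with 2 \<le> \<beta> \<mu>, as the threshold estimate
    demands.\<close>
  define \<beta> where "\<beta> = nat \<lceil>2 / \<mu>\<rceil>"
  have \<beta>: "2 \<le> real \<beta> * \<mu>"
  proof -
    have "2 / \<mu> \<le> real \<beta>" unfolding \<beta>_def by linarith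
    then show ?thesis using \<mu> by (simp add: field_simps)
  qed
  define s where "s = 2 * \<beta> + 2"
  define C0 where "C0 = 2 * real s * b + (real s)\<^sup>2 * c * b\<^sup>2 / c0"
  have C0: "0 \<le> C0" unfolding C0_def using b c0 c_pos by simp
  let ?n = "real CARD('n)"
  define C where "C = 2 powr q * C0 * (2 * 4 ^ CARD('n) + 2 powr q) + 1"
  \<comment> \<open>This is where the upper bound on q enters.\<close>
  have n_le: "?n \<le> \<alpha> / (q - 1)"
    using q_le q_gt_1 by (simp add: field_simps)
  show thesis
  proof
    show "0 < C" unfolding C_def using C0 by (intro add_nonneg_pos mult_nonneg_nonneg) auto
    show "0 < \<mu>" by fact
    fix R \<kappa> K :: real assume R: "1 < R" and \<kappa>: "0 < \<kappa>" and K: "2 \<le> K"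
    obtain \<eta> :: "real \<times> (real ^ 'n) \<Rightarrow> real" where \<eta>: "smooth_on UNIV \<eta>" "\<And>z. 0 \<le> \<eta> z" "\<And>z. \<eta> z \<le> 1"
     and \<eta>_supp: "\<And>t x. \<eta> (t, x) \<noteq> 0 \<Longrightarrow> 1 / (2 * R) \<le> t \<and> t \<le> R powr \<alpha> \<and> norm x \<le> R"
     and \<eta>_1: "\<And>t x. 1 / R \<le> t \<and> t \<le> R powr \<alpha> / 2 \<and> norm x \<le> R / 2 \<Longrightarrow> \<eta> (t, x) = 1"
     and \<eta>_t: "\<And>t x. - time_deriv \<eta> (t, x) \<le> (if t \<le> R powr \<alpha> / 2 then 0 else b * R powr - \<alpha>)"
     and \<eta>_x: "\<And>t x. norm (space_grad \<eta> (t, x)) \<le> (if R / 2 < norm x \<and> norm x < R then b / R else 0)"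
      using cutoff[OF R] by blast
    define Kc where "Kc = {1 / (2 * R)..R powr \<alpha>} \<times> (cball 0 R :: (real ^ 'n) set)"
    let ?\<Omega> = "cylinder \<alpha> R :: (real \<times> (real ^ 'n)) set"
    let ?E = "outer_region \<alpha> R :: (real \<times> (real ^ 'n)) set"
    have dom: "bounded_domain ?\<Omega>" by (rule bounded_domain_cylinder[OF R alpha_pos])
    have Kc: "compact Kc" unfolding Kc_def by (intro compact_Times) auto
    have pos: "0 < R powr \<alpha>" using R by simp
    have quarter: "1 / (4 * R) < 1 / (2 * R)" using R by (simp add: field_simps)
    have Kc_sub: "Kc \<subseteq> ?\<Omega>"
    proof
      fix z assume "z \<in> Kc"
      then obtain t x where z: "z = (t, x)" "1 / (2 * R) \<le> t" "t \<le> R powr \<alpha>" "norm x \<le> R"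
        by (auto simp: Kc_def)
      have "1 / (4 * R) < t" "t < 2 * R powr \<alpha>" "norm x < 2 * R"
        using z quarter pos R by linarith+
      then show "z \<in> ?\<Omega>" by (simp add: cylinder_def z(1))
    qed
    have off: "\<eta> z = 0" if "z \<notin> Kc" for z
      using \<eta>_supp[of "fst z" "snd z"] that by (cases z) (auto simp: Kc_def)
    define \<delta> where "\<delta> = \<kappa> * R powr (- \<alpha> / (q - 1))"
    have \<delta>: "\<delta> > 0" using \<kappa> R by (simp add: \<delta>_def)
    define Q where "Q = 2 powr q * \<delta> powr (1 - q) * K powr (- \<mu>)"
    have Q: "0 \<le> Q" by (simp add: Q_def)
    have bound: "\<delta> * (1 + y / \<delta>) powr (1 + \<nu>) * e ^ (2 * \<beta>) \<le> \<delta> * K\<^sup>2 + Q * (y powr q * e ^ s)"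
      if "0 \<le> y" "0 \<le> e" "e \<le> 1" for y e
      unfolding Q_def s_def by (rule multiplier_threshold) (use \<delta> that K \<nu> \<mu> q_eq \<beta> in auto)
    have tE: "- time_deriv \<eta> z \<le> (if z \<in> ?E then b * R powr - \<alpha> else 0)" for z
    proof (cases z)
      case (Pair t x)
      have "0 \<le> b * R powr - \<alpha>" using b by simp
      then show ?thesis using \<eta>_t[of t x] unfolding Pair outer_region_def by (auto split: if_splits)
    qed
    have xE: "norm (space_grad \<eta> z) \<le> (if R / 2 < norm (snd z) \<and> norm (snd z) < R then b / R else 0)" for z
      using \<eta>_x[of "fst z" "snd z"] by simp
    have inE: "z \<in> ?E" if "R / 2 < norm (snd z)" for z
      using that by (cases z) (auto simp: outer_region_def)
    have Em: "?E \<in> sets borel"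
      unfolding outer_region_def by (intro borel_open open_Compl closed_Times) auto
    have P: "0 \<le> \<delta> * K\<^sup>2" using \<delta> by simp
    define f where "f z = \<bar>w z\<bar> powr q * \<eta> z ^ s" for z
    have est: "2 powr (- q) * (\<integral>z. f z \<partial>lebesgue_on ?\<Omega>) \<le> C0 * R powr - \<alpha> *
      (\<delta> * K\<^sup>2 * measure (lebesgue_on ?\<Omega>) (space (lebesgue_on ?\<Omega>)) + Q * (\<integral>z. indicator ?E z * f z \<partial>lebesgue_on ?\<Omega>))"
      unfolding C0_def f_def
      by (rule tested_inequality[OF R dom Kc Kc_sub off \<eta> tE xE inE b h c0 h'_le \<nu>(1) \<delta> s_def bound P Q Em]; assumption)
    have off_f: "f z = 0" if "z \<notin> ?\<Omega>" for z
      using off[of z] that Kc_sub by (auto simp: f_def s_def)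
    have \<Omega>: "?\<Omega> \<subseteq> half_space" "?\<Omega> \<in> sets lebesgue" using dom by (auto simp: bounded_domain_def)
    have f_bounds: "0 \<le> f z \<and> f z \<le> \<bar>w z\<bar> powr q" for z
    proof -
      have "\<bar>w z\<bar> powr q * \<eta> z ^ s \<le> \<bar>w z\<bar> powr q * 1"
        using \<eta> by (intro mult_left_mono power_le_one) auto
      then show ?thesis using \<eta> by (simp add: f_def)
    qed
    have f_inner: "f z = \<bar>w z\<bar> powr q" if "z \<in> inner_cylinder \<alpha> R" for z
      using that \<eta>_1 by (auto simp: inner_cylinder_def f_def)
    have meas\<eta>: "(\<lambda>z. \<eta> z ^ s) \<in> borel_measurable (lebesgue_on ?\<Omega>)"
      using \<Omega>(2) by (intro continuous_imp_measurable_on_sets_lebesgue continuous_on_power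
          continuous_on_subset[OF smooth_on_continuous[OF \<eta>(1)]]) auto
    have "integrable (lebesgue_on ?\<Omega>) (\<lambda>z. \<eta> z ^ s * \<bar>w z\<bar> powr q)"
      using \<eta> by (intro integrable_bounded_mult[OF integrable_w_powr[OF dom] meas\<eta>, of 1]) (simp add: power_le_one)
    then have fint: "integrable (lebesgue_on ?\<Omega>) f" by (simp add: f_def[abs_def] mult.commute)
    define J where "J = (\<integral>z. indicator ?E z * f z \<partial>lebesgue_on ?\<Omega>)"
    have J0: "0 \<le> J" unfolding J_def using f_bounds by (intro integral_nonneg_AE AE_I2) simp
    have 1: "R powr - \<alpha> * (\<delta> * K\<^sup>2 * measure (lebesgue_on ?\<Omega>) (space (lebesgue_on ?\<Omega>))) \<le> 2 * 4 ^ CARD('n) * (K\<^sup>2 * \<kappa>)"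
    proof -
      have "R powr - \<alpha> * (\<delta> * K\<^sup>2 * measure (lebesgue_on ?\<Omega>) (space (lebesgue_on ?\<Omega>)))
         \<le> R powr - \<alpha> * (\<delta> * K\<^sup>2 * (2 * 4 ^ CARD('n) * R powr (\<alpha> + ?n)))"
        using measure_cylinder_le[OF R alpha_pos, where 'n = 'n] P by (intro mult_left_mono) auto
      also have "\<dots> = 2 * 4 ^ CARD('n) * (K\<^sup>2 * \<kappa>) * (R powr - \<alpha> * R powr (- \<alpha> / (q - 1)) * R powr (\<alpha> + ?n))"
        by (simp add: \<delta>_def)
      \<comment> \<open>The powers of R add up to a non-positive exponent; for the critical q it is
        0, and only the factor \<kappa> remains as a source of smallness.\<close>
      also have "R powr - \<alpha> * R powr (- \<alpha> / (q - 1)) * R powr (\<alpha> + ?n) = R powr (?n - \<alpha> / (q - 1))"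
        by (simp add: powr_add[symmetric])
      also have "R powr (?n - \<alpha> / (q - 1)) \<le> R powr 0"
        using n_le R by (intro powr_mono) auto
      finally show ?thesis using R \<kappa> by (simp add: mult_left_mono)
    qed
    have 2: "R powr - \<alpha> * Q = 2 powr q * (\<kappa> powr (1 - q) * K powr - \<mu>)"
    proof -
      have "\<delta> powr (1 - q) = \<kappa> powr (1 - q) * R powr \<alpha>"
      proof -
        have "- \<alpha> / (q - 1) * (1 - q) = \<alpha>" using q_gt_1 by (simp add: field_simps)
        then show ?thesis unfolding \<delta>_def by (simp add: powr_mult powr_powr)
      qed
      moreover have "R powr - \<alpha> * R powr \<alpha> = 1" using R by (simp add: powr_add[symmetric])
      ultimately show ?thesis by (simp add: Q_def)
    qed
    have "(\<integral>z. f z \<partial>lebesgue_on ?\<Omega>) = 2 powr q * (2 powr (- q) * (\<integral>z. f z \<partial>lebesgue_on ?\<Omega>))"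
      by (simp add: powr_add[symmetric] mult.assoc[symmetric])
    also have "\<dots> \<le> 2 powr q * (C0 * R powr - \<alpha> *
      (\<delta> * K\<^sup>2 * measure (lebesgue_on ?\<Omega>) (space (lebesgue_on ?\<Omega>)) + Q * J))"
      using est unfolding J_def by (intro mult_left_mono) auto
    also have "\<dots> = 2 powr q * C0 * (R powr - \<alpha> * (\<delta> * K\<^sup>2 * measure (lebesgue_on ?\<Omega>) (space (lebesgue_on ?\<Omega>)))
        + R powr - \<alpha> * Q * J)"
      by (simp add: algebra_simps)
    also have "\<dots> \<le> 2 powr q * C0 * (2 * 4 ^ CARD('n) * (K\<^sup>2 * \<kappa>) + 2 powr q * (\<kappa> powr (1 - q) * K powr - \<mu>) * J)"
      unfolding 2 using 1 C0 by (intro mult_left_mono add_right_mono) auto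
    also have "\<dots> \<le> 2 powr q * C0 * ((2 * 4 ^ CARD('n) + 2 powr q) * (K\<^sup>2 * \<kappa> + \<kappa> powr (1 - q) * K powr - \<mu> * J))"
      using C0 J0 \<kappa> by (intro mult_left_mono) (auto simp: algebra_simps intro!: add_nonneg_nonneg mult_nonneg_nonneg)
    also have "\<dots> \<le> C * (K\<^sup>2 * \<kappa> + \<kappa> powr (1 - q) * K powr - \<mu> * J)"
      using J0 \<kappa> unfolding C_def mult.assoc[symmetric] by (intro mult_right_mono) auto
    finally have "(\<integral>z. f z \<partial>lebesgue_on ?\<Omega>) \<le> C * (K\<^sup>2 * \<kappa> + \<kappa> powr (1 - q) * K powr - \<mu> * J)" .
    moreover have "(\<integral>z. f z \<partial>lebesgue_on half_space) = (\<integral>z. f z \<partial>lebesgue_on ?\<Omega>)"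
      and "integrable (lebesgue_on half_space) f"
      using lebesgue_on_support[OF \<Omega> half_space_measurable, of f] off_f fint by simp_all
    moreover have "(\<integral>z. indicator ?E z * f z \<partial>lebesgue_on half_space) = J"
      unfolding J_def using off_f
      by (intro lebesgue_on_support(2)[OF \<Omega> half_space_measurable, of "\<lambda>z. indicator ?E z * f z"]) simp
    ultimately show "\<exists>f. integrable (lebesgue_on half_space) f \<and>
      (\<forall>z. 0 \<le> f z \<and> f z \<le> \<bar>w z\<bar> powr q) \<and> (\<forall>z\<in>inner_cylinder \<alpha> R. f z = \<bar>w z\<bar> powr q) \<and>
      (\<integral>z. f z \<partial>lebesgue_on half_space) \<le> C * (K\<^sup>2 * \<kappa> + \<kappa> powr (1 - q) * K powr - \<mu> *
         (\<integral>z. indicator (outer_region \<alpha> R) z * f z \<partial>lebesgue_on half_space))"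
      using f_bounds f_inner by (intro exI[of _ f]) simp
  qed
qed

lemma w_eq_0:
  assumes u_meas: "u \<in> borel_measurable (lebesgue_on half_space)"
    and v_meas: "v \<in> borel_measurable (lebesgue_on half_space)"
  shows "AE z in lebesgue_on half_space. w z = 0"
proof -
  let ?M = "lebesgue_on (half_space :: (real \<times> (real ^ 'n)) set)"
  obtain C \<mu> where C: "0 < C" and \<mu>: "0 < \<mu>" and est:
    "\<And>R \<kappa> K. 1 < R \<Longrightarrow> 0 < \<kappa> \<Longrightarrow> 2 \<le> K \<Longrightarrow> \<exists>f. integrable ?M f \<and>
      (\<forall>z. 0 \<le> f z \<and> f z \<le> \<bar>w z\<bar> powr q) \<and> (\<forall>z\<in>inner_cylinder \<alpha> R. f z = \<bar>w z\<bar> powr q) \<and>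
      (\<integral>z. f z \<partial>?M) \<le> C * (K\<^sup>2 * \<kappa> + \<kappa> powr (1 - q) * K powr - \<mu> *
         (\<integral>z. indicator (outer_region \<alpha> R) z * f z \<partial>?M))"
    by (rule capacity_estimate) blast
  define W where "W z = \<bar>w z\<bar> powr q" for z
  have [measurable]: "w \<in> borel_measurable ?M" unfolding w_def[abs_def] using u_meas v_meas by measurable
  have Wmeas [measurable]: "W \<in> borel_measurable ?M" unfolding W_def[abs_def] by measurable
  have W0: "0 \<le> W z" for z by (simp add: W_def)
  \<comment> \<open>The shift by 2 keeps \<open>R k\<close> above 1 from k = 0 on.\<close>
  define R where "R k = real (k + 2)" for k
  have R1: "1 < R k" for k by (simp add: R_def)
  define S where "S k = (inner_cylinder \<alpha> (R k) :: (real \<times> (real ^ 'n)) set)" for k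
  define E where "E k = (outer_region \<alpha> (R k) :: (real \<times> (real ^ 'n)) set)" for k
  have "closed (S k)" "open (E k)" for k
    unfolding S_def E_def inner_cylinder_def outer_region_def by (auto intro!: closed_Times)
  then have borel: "S k \<in> sets borel" "E k \<in> sets borel" for k by auto
  have indm [measurable]: "indicat_real (S k) \<in> borel_measurable ?M" "indicat_real (E k) \<in> borel_measurable ?M" for k
    using borel by (auto intro!: measurable_restrict_space1 measurable_completion)
  have disj: "indicator (S k) z + indicator (E k) z \<le> (1 :: real)" for k z
    unfolding S_def E_def inner_cylinder_def outer_region_def by (auto simp: indicator_def)
  have iS: "integrable ?M (\<lambda>z. indicator (S k) z * W z)"
    and le_f: "\<And>f. integrable ?M f \<Longrightarrow> (\<And>z. 0 \<le> f z) \<Longrightarrow> (\<And>z. z \<in> S k \<Longrightarrow> f z = W z) \<Longrightarrow>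
      (\<integral>z. indicator (S k) z * W z \<partial>?M) \<le> (\<integral>z. f z \<partial>?M)" for k
  proof -
    have dom: "integrable ?M (\<lambda>z. indicator (S k) z * W z)"
      if "integrable ?M f" "\<And>z. 0 \<le> f z" "\<And>z. z \<in> S k \<Longrightarrow> f z = W z" for f
    proof (rule Bochner_Integration.integrable_bound[OF that(1)])
      show "(\<lambda>z. indicator (S k) z * W z) \<in> borel_measurable ?M" by measurable
      show "AE z in ?M. norm (indicator (S k) z * W z) \<le> norm (f z)"
        using that W0 by (intro AE_I2) (auto simp: indicator_def)
    qed
    \<comment> \<open>The values \<kappa> = 1 and K = 2 are arbitrary: only an integrable function
      agreeing with \<open>W\<close> on \<open>S k\<close> is wanted.\<close>
    obtain f where "integrable ?M f" "\<And>z. 0 \<le> f z" "\<And>z. z \<in> S k \<Longrightarrow> f z = W z"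
      using est[OF R1, of 1 2 k] unfolding S_def W_def by auto
    then show "integrable ?M (\<lambda>z. indicator (S k) z * W z)" by (rule dom)
    show "(\<integral>z. indicator (S k) z * W z \<partial>?M) \<le> (\<integral>z. f z \<partial>?M)"
      if "integrable ?M f" "\<And>z. 0 \<le> f z" "\<And>z. z \<in> S k \<Longrightarrow> f z = W z" for f
      using dom[OF that] that by (intro integral_mono) (auto simp: indicator_def)
  qed
  define I where "I k = (\<integral>z. indicator (S k) z * W z \<partial>?M)" for k
  \<comment> \<open>Chosen so that the coefficient \<open>C * K powr - \<mu>\<close> of the integral
    on the right is at most 1/2.\<close>
  define K where "K = max 2 ((2 * C) powr (1 / \<mu>))"
  have K: "2 \<le> K" "C * K powr - \<mu> \<le> 1 / 2"
  proof -
    show "2 \<le> K" by (simp add: K_def)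
    have "2 * C = ((2 * C) powr (1 / \<mu>)) powr \<mu>" using C \<mu> by (simp add: powr_powr)
    also have "\<dots> \<le> K powr \<mu>" using \<mu> by (intro powr_mono2) (auto simp: K_def)
    finally show "C * K powr - \<mu> \<le> 1 / 2"
      using \<open>2 \<le> K\<close> by (simp add: powr_minus field_simps)
  qed
  have I_bound: "I k \<le> 2 * (C * K\<^sup>2)" for k
  proof -
    obtain f where f: "integrable ?M f" "\<And>z. 0 \<le> f z" "\<And>z. z \<in> S k \<Longrightarrow> f z = W z"
      and le: "(\<integral>z. f z \<partial>?M) \<le> C * (K\<^sup>2 + K powr - \<mu> * (\<integral>z. indicator (E k) z * f z \<partial>?M))"
      using est[OF R1, of 1 K k] K(1) unfolding S_def E_def W_def by auto
    have "integrable ?M (\<lambda>z. indicator (E k) z * f z)"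
      by (rule integrable_bounded_mult[where C = 1, OF f(1) indm(2)]) (simp add: indicator_def)
    then have J: "(\<integral>z. indicator (E k) z * f z \<partial>?M) \<le> (\<integral>z. f z \<partial>?M)"
      using f by (intro integral_mono) (auto simp: indicator_def)
    have "0 \<le> (\<integral>z. f z \<partial>?M)" using f(2) by simp
    have "(\<integral>z. f z \<partial>?M) \<le> C * K\<^sup>2 + (C * K powr - \<mu>) * (\<integral>z. indicator (E k) z * f z \<partial>?M)"
      using le by (simp add: algebra_simps)
    also have "\<dots> \<le> C * K\<^sup>2 + 1 / 2 * (\<integral>z. f z \<partial>?M)"
      using K J f by (intro add_left_mono mult_mono) (auto intro!: integral_nonneg_AE)
    \<comment> \<open>Absorption is legitimate because the integral of \<open>f\<close> is finite
      beforehand, thanks to the cutoff.\<close>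
    finally have "(\<integral>z. f z \<partial>?M) \<le> 2 * (C * K\<^sup>2)" by simp
    moreover have "I k \<le> (\<integral>z. f z \<partial>?M)" unfolding I_def using f by (intro le_f)
    ultimately show ?thesis by simp
  qed
  have S_mono: "S k \<subseteq> S l" if "k \<le> l" for k l
    unfolding S_def by (rule inner_cylinder_mono) (use that alpha_pos in \<open>auto simp: R_def\<close>)
  have "incseq I"
  proof (rule incseq_SucI)
    fix k
    have "indicator (S k) z \<le> (indicator (S (Suc k)) z :: real)" for z
      using S_mono[of k "Suc k"] by (auto simp: indicator_def)
    then show "I k \<le> I (Suc k)"
      unfolding I_def using iS W0 by (intro integral_mono mult_right_mono) auto
  qed
  then obtain L where L: "I \<longlonglongrightarrow> L"
    using incseq_convergent[of I "2 * (C * K\<^sup>2)"] I_bound by blast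
  have mono: "AE z in ?M. mono (\<lambda>k. indicator (S k) z * W z)"
    using S_mono W0 by (intro AE_I2 monoI mult_right_mono) (auto simp: indicator_def)
  have conv: "AE z in ?M. (\<lambda>k. indicator (S k) z * W z) \<longlonglongrightarrow> W z"
  proof (rule AE_I2)
    fix z assume "z \<in> space ?M"
    then have "\<forall>\<^sub>F k in sequentially. z \<in> S k"
      unfolding S_def R_def using alpha_pos by (intro inner_cylinder_exhaustion) auto
    then have "\<forall>\<^sub>F k in sequentially. indicator (S k) z * W z = W z"
      by eventually_elim simp
    then show "(\<lambda>k. indicator (S k) z * W z) \<longlonglongrightarrow> W z" by (rule tendsto_eventually)
  qed
  have iW: "integrable ?M W" and intW: "(\<integral>z. W z \<partial>?M) = L"
    using integrable_monotone_convergence[OF iS mono conv] integral_monotone_convergence[OF iS mono conv]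
      L[unfolded I_def[abs_def]] Wmeas by auto
  have "L \<le> 4 * C * \<kappa>" if \<kappa>: "0 < \<kappa>" for \<kappa>
  proof -
    \<comment> \<open>\<open>D\<close> blows up as \<kappa> tends to 0, so \<kappa> stays fixed
      while k tends to infinity.\<close>
    define D where "D = C * \<kappa> powr (1 - q) * 2 powr - \<mu>"
    have "I k \<le> 4 * C * \<kappa> + D * (L - I k)" for k
    proof -
      obtain f where f: "integrable ?M f" "\<And>z. 0 \<le> f z" "\<And>z. f z \<le> W z" "\<And>z. z \<in> S k \<Longrightarrow> f z = W z"
        and le: "(\<integral>z. f z \<partial>?M) \<le> C * (4 * \<kappa> + \<kappa> powr (1 - q) * 2 powr - \<mu> * (\<integral>z. indicator (E k) z * f z \<partial>?M))"
        using est[OF R1 \<kappa>, of 2 k] unfolding S_def E_def W_def by auto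
      have iE: "integrable ?M (\<lambda>z. indicator (E k) z * f z)"
        by (rule integrable_bounded_mult[where C = 1, OF f(1) indm(2)]) (simp add: indicator_def)
      \<comment> \<open>\<open>S k\<close> and \<open>E k\<close> are disjoint, so the mass of
        \<open>f\<close> on \<open>E k\<close> is at most what \<open>W\<close> has outside
        \<open>S k\<close>, the tail \<open>L - I k\<close>.\<close>
      have pt: "indicator (E k) z * f z \<le> W z - indicator (S k) z * W z" for z
        using disj[of k z] f(3)[of z] W0[of z] by (auto simp: indicator_def split: if_splits)
      have "(\<integral>z. indicator (E k) z * f z \<partial>?M) \<le> (\<integral>z. W z - indicator (S k) z * W z \<partial>?M)"
        using iE iW iS pt by (intro integral_mono) auto
      also have "\<dots> = L - I k" using iW iS by (simp add: intW I_def)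
      finally have "D * (\<integral>z. indicator (E k) z * f z \<partial>?M) \<le> D * (L - I k)"
        using C by (intro mult_left_mono) (auto simp: D_def)
      moreover have "(\<integral>z. f z \<partial>?M) \<le> 4 * C * \<kappa> + D * (\<integral>z. indicator (E k) z * f z \<partial>?M)"
        using le by (simp add: D_def algebra_simps)
      moreover have "I k \<le> (\<integral>z. f z \<partial>?M)" unfolding I_def using f by (intro le_f)
      ultimately show ?thesis by linarith
    qed
    moreover have "(\<lambda>k. 4 * C * \<kappa> + D * (L - I k)) \<longlonglongrightarrow> 4 * C * \<kappa> + D * (L - L)"
      by (intro tendsto_intros L)
    ultimately show ?thesis using LIMSEQ_le[OF L] by fastforce
  qed
  \<comment> \<open>The instance is \<kappa> = e / (4 C).\<close>
  from this[of "_ / (4 * C)"] have "L \<le> 0 + e" if "0 < e" for e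
    using that C by simp
  then have "L \<le> 0" by (rule field_le_epsilon)
  moreover have "0 \<le> (\<integral>z. W z \<partial>?M)" using W0 by simp
  ultimately have "(\<integral>z. W z \<partial>?M) = 0" using intW by simp
  then have "AE z in ?M. W z = 0"
    using integral_nonneg_eq_0_iff_AE[OF iW] W0 by simp
  then show ?thesis by eventually_elim (simp add: W_def)
qed

end

theorem theorem5:
  fixes a :: "'n::finite \<Rightarrow> 'n \<Rightarrow> real \<times> (real ^ 'n) \<Rightarrow> real"
    and A u v :: "real \<times> (real ^ 'n) \<Rightarrow> real"
    and u\<^sub>0 v\<^sub>0 :: "real ^ 'n \<Rightarrow> real"
    and \<alpha> q c :: real
  assumes "\<alpha> > 0" and "1 < q" and "q \<le> 1 + \<alpha> / real CARD('n)"
    and a_measurable: "\<And>i j. a i j \<in> borel_measurable (lebesgue_on half_space)"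
    and a_locally_bounded: "\<And>i j. locally_bounded_on half_space (a i j)"
    and a_symmetric: "\<And>i j. AE z in lebesgue_on half_space. a i j z = a j i z"
    and A_measurable: "A \<in> borel_measurable (lebesgue_on half_space)"
    and A_nonneg: "AE z in lebesgue_on half_space. 0 \<le> A z"
    and A_locally_bounded: "locally_bounded_on half_space A"
    and a_form: "AE z in lebesgue_on half_space.
        \<forall>\<xi>. 0 \<le> coeff_form a z \<xi> \<xi> \<and> coeff_form a z \<xi> \<xi> \<le> A z * (norm \<xi>)\<^sup>2"
    and "c > 0"
    and growth: "\<And>R. R > 1 \<Longrightarrow>
        esssup (lebesgue_on ({0<..} \<times> {x. R / 2 < norm x \<and> norm x < R})) (\<lambda>z. ereal (A z))
          \<le> ereal (c * R powr (2 - \<alpha>))"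
    and u_super: "weak_supersolution a q u" and u_data: "initial_data u u\<^sub>0"
    and v_sub: "weak_subsolution a q v" and v_data: "initial_data v v\<^sub>0"
    and "AE z in lebesgue_on half_space. v z \<le> u z"
  shows "AE z in lebesgue_on half_space. u z = v z"
proof -
  obtain pu gu where u: "u \<in> borel_measurable (lebesgue_on half_space)" "(u, pu, gu) \<in> W_loc a q"
    "\<And>\<phi>. test_function \<phi> \<Longrightarrow> 0 \<le> weak_form a q u pu gu \<phi>"
    using u_super unfolding weak_supersolution_def by blast
  obtain pv gv where v: "v \<in> borel_measurable (lebesgue_on half_space)" "(v, pv, gv) \<in> W_loc a q"
    "\<And>\<phi>. test_function \<phi> \<Longrightarrow> weak_form a q v pv gv \<phi> \<le> 0"
    using v_sub unfolding weak_subsolution_def by blast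
  interpret super_sub_pair a A u v pu pv gu gv \<alpha> q c
    by unfold_locales (use assms u v in blast)+
  show ?thesis using w_eq_0[OF u(1) v(1)] by eventually_elim (simp add: w_def)
qed

end
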